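(* Let $c\le0$ and, for $a\ge0$ and $\lambda>0$, let $u_{a,\lambda}$ denote an arbitrary element of $$\mathcal S^c_{a,\lambda}:=\{u\in\mathcal S_{a,\lambda}:\ \mathcal I_{a,\lambda}(u)\le c\}.$$ Then the squeezing in $\lambda$ (uniformly in $a$) holds: $$\lim_{\lambda\to0}\ \sup_{a>0}\|u_{a,\lambda}\|=0\qquad\text{and}\qquad\lim_{\lambda\to0}\|u_{0,\lambda}\|=0 .$$ In particular (for every $a>0$) $$\lim_{\lambda\to0}\mathcal I_{a,\lambda}(u_{a,\lambda})=\lim_{\lambda\to0}\mathcal I_{0,\lambda}(u_{0,\lambda})=\lim_{\lambda\to0}\mathcal I_{a,\lambda}(u_{0,\lambda})=\lim_{\lambda\to0}\mathcal I_{0,\lambda}(u_{a,\lambda})=0,$$ $$\lim_{\lambda\to0}\mathcal I'_{a,\lambda}(u_{0,\lambda})=\lim_{\lambda\to0}\mathcal I'_{0,\lambda}(u_{a,\lambda})=0\quad\text{in }H^{-1}(\mathbb R^3).$$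
   Context: Let $p\in(0,1)$. $|\cdot|_q$ is the norm of $L^q(\mathbb R^3)$, $H^1(\mathbb R^3)$ (real valued functions) has the norm $\|u\|^2=|\nabla u|_2^2+|u|_2^2$, and $H^{-1}(\mathbb R^3)$ is its dual. Assumptions on the given nontrivial functions $Q,K:\mathbb R^3\to\mathbb R$: - either $Q\in L^s(\mathbb R^3)$ for some $s\in[2,+\infty)$, or $Q\in L^\infty(\mathbb R^3)$ and $\mathrm{meas}\{x\in\mathbb R^3:|Q(x)|\ge t\}<+\infty$ for every $t>0$; - $K\in L^{\frac{2}{1-p}}(\mathbb R^3)$ and $\mathrm{meas}\{x\in\mathbb R^3:K(x)>0\}>0$. For $a>0$ let $\mathcal D=\{\phi\in D^{1,2}(\mathbb R^3):\Delta\phi\in L^2(\mathbb R^3)\}$ with $\|\phi\|_{\mathcal D}^2=|\nabla\phi|_2^2+a^2|\Delta\phi|_2^2$. For $u\in H^1(\mathbb R^3)$, $\phi^a_u$ is the unique weak solution in $\mathcal D$ of $-\Delta\phi+a^2\Delta^2\phi=4\pi Q(x)u^2$ in $\mathbb R^3$. For $a=0$, $\phi^0_u(x)=\int_{\mathbb R^3}\frac{Q(y)u^2(y)}{|x-y|}dy\in D^{1,2}(\mathbb R^3)$ is the unique weak solution in $D^{1,2}(\mathbb R^3)$ of $-\Delta\phi=4\pi Q(x)u^2$. For $a\ge 0$, $\lambda>0$, the $C^1$ energy functional on $H^1(\mathbb R^3)$ is $$\mathcal I_{a,\lambda}(u)=\frac12\|u\|^2+\frac14\int_{\mathbb R^3}Q(x)\phi^a_uu^2-\frac16\int_{\mathbb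 R^3}|u|^6-\frac{\lambda}{p+1}\int_{\mathbb R^3}K(x)|u|^{p+1}.$$ $\mathcal S_{a,\lambda}$ is the set of all (weak) solutions $u\in H^1(\mathbb R^3)$ of $-\Delta u+u+Q(x)\phi^a_u u=|u|^4u+\lambda K(x)|u|^{p-1}u$ in $\mathbb R^3$, i.e. the set of all critical points of $\mathcal I_{a,\lambda}$. Limits as $\lambda\to0$ (with $\lambda>0$) and suprema in $a$ are taken over those $(a,\lambda)$ for which the involved sets $\mathcal S^c_{a,\lambda}$ are nonempty. *)

theory Defs
  imports "HOL-Analysis.Analysis"
begin

text \<open>Elements of function spaces are represented by Lebesgue measurable functions on
  \<open>real ^ 3\<close> (not by classes modulo a.e. equality).\<close>

section \<open>Lebesgue spaces\<close>

definition in_L :: "real \<Rightarrow> (real ^ 3 \<Rightarrow> 'b::euclidean_space) \<Rightarrow> bool" where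
  "in_L q f \<longleftrightarrow> f \<in> borel_measurable lebesgue \<and> integrable lebesgue (\<lambda>x. norm (f x) powr q)"

definition in_L_infty :: "(real ^ 3 \<Rightarrow> 'b::euclidean_space) \<Rightarrow> bool" where
  "in_L_infty f \<longleftrightarrow> f \<in> borel_measurable lebesgue \<and> (\<exists>C. AE x in lebesgue. norm (f x) \<le> C)"

definition Lnorm :: "real \<Rightarrow> (real ^ 3 \<Rightarrow> 'b::euclidean_space) \<Rightarrow> real" where
  "Lnorm q f = (LINT x|lebesgue. norm (f x) powr q) powr (1 / q)"

section \<open>Test functions and weak derivatives\<close>

definition partial_deriv :: "3 \<Rightarrow> (real ^ 3 \<Rightarrow> real) \<Rightarrow> real ^ 3 \<Rightarrow> real" where
  "partial_deriv i f x = frechet_derivative f (at x) (axis i 1)"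

primrec Ck :: "nat \<Rightarrow> (real ^ 3 \<Rightarrow> real) \<Rightarrow> bool" where
  "Ck 0 f \<longleftrightarrow> continuous_on UNIV f"
| "Ck (Suc k) f \<longleftrightarrow> (\<forall>x. f differentiable (at x)) \<and> (\<forall>i. Ck k (partial_deriv i f))"

definition test_function :: "(real ^ 3 \<Rightarrow> real) \<Rightarrow> bool" where
  "test_function \<psi> \<longleftrightarrow> (\<forall>k. Ck k \<psi>) \<and> compact (closure {x. \<psi> x \<noteq> 0})"

definition laplacian :: "(real ^ 3 \<Rightarrow> real) \<Rightarrow> real ^ 3 \<Rightarrow> real" where
  "laplacian \<psi> x = (\<Sum>i\<in>UNIV. partial_deriv i (partial_deriv i \<psi>) x)"

definition locally_integrable :: "(real ^ 3 \<Rightarrow> 'b::euclidean_space) \<Rightarrow> bool" where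
  "locally_integrable f \<longleftrightarrow> (\<forall>S. compact S \<longrightarrow> f absolutely_integrable_on S)"

definition has_weak_gradient :: "(real ^ 3 \<Rightarrow> real) \<Rightarrow> (real ^ 3 \<Rightarrow> real ^ 3) \<Rightarrow> bool" where
  "has_weak_gradient u g \<longleftrightarrow> locally_integrable u \<and> locally_integrable g \<and>
     (\<forall>\<psi> i. test_function \<psi> \<longrightarrow>
        (LINT x|lebesgue. u x * partial_deriv i \<psi> x) = - (LINT x|lebesgue. (g x $ i) * \<psi> x))"

definition has_weak_laplacian :: "(real ^ 3 \<Rightarrow> real) \<Rightarrow> (real ^ 3 \<Rightarrow> real) \<Rightarrow> bool" where
  "has_weak_laplacian u h \<longleftrightarrow> locally_integrable u \<and> locally_integrable h \<and>
     (\<forall>\<psi>. test_function \<psi> \<longrightarrow>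
        (LINT x|lebesgue. u x * laplacian \<psi> x) = (LINT x|lebesgue. h x * \<psi> x))"

text \<open>Weak derivatives are determined only up to null sets, so \<open>SOME\<close> fixes a representative;
  it is used only under integrals.\<close>

definition weak_gradient :: "(real ^ 3 \<Rightarrow> real) \<Rightarrow> real ^ 3 \<Rightarrow> real ^ 3" where
  "weak_gradient u = (SOME g. has_weak_gradient u g)"

definition weak_laplacian :: "(real ^ 3 \<Rightarrow> real) \<Rightarrow> real ^ 3 \<Rightarrow> real" where
  "weak_laplacian u = (SOME h. has_weak_laplacian u h)"

section \<open>Sobolev spaces\<close>

definition H1 :: "(real ^ 3 \<Rightarrow> real) set" where
  "H1 = {u. in_L 2 u \<and> (\<exists>g. has_weak_gradient u g \<and> in_L 2 g)}"

definition H1_norm :: "(real ^ 3 \<Rightarrow> real) \<Rightarrow> real" where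
  "H1_norm u = sqrt ((Lnorm 2 (weak_gradient u))\<^sup>2 + (Lnorm 2 u)\<^sup>2)"

text \<open>\<open>D\<^sup>1\<^sup>,\<^sup>2\<close> is taken in its concrete form as a space of functions;
  \<open>6\<close> is the critical Sobolev exponent in dimension \<open>3\<close>.\<close>

definition D12 :: "(real ^ 3 \<Rightarrow> real) set" where
  "D12 = {\<phi>. in_L 6 \<phi> \<and> (\<exists>g. has_weak_gradient \<phi> g \<and> in_L 2 g)}"

definition D_space :: "(real ^ 3 \<Rightarrow> real) set" where
  "D_space = {\<phi> \<in> D12. \<exists>h. has_weak_laplacian \<phi> h \<and> in_L 2 h}"

section \<open>The potential\<close>

definition potential_weak_solution ::
  "(real ^ 3 \<Rightarrow> real) \<Rightarrow> real \<Rightarrow> (real ^ 3 \<Rightarrow> real) \<Rightarrow> (real ^ 3 \<Rightarrow> real) \<Rightarrow> bool" where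
  "potential_weak_solution Q a u \<phi> \<longleftrightarrow> \<phi> \<in> D_space \<and>
     (\<forall>\<psi>\<in>D_space.
        (LINT x|lebesgue. weak_gradient \<phi> x \<bullet> weak_gradient \<psi> x)
        + a\<^sup>2 * (LINT x|lebesgue. weak_laplacian \<phi> x * weak_laplacian \<psi> x)
        = 4 * pi * (LINT x|lebesgue. Q x * (u x)\<^sup>2 * \<psi> x))"

text \<open>For \<open>a > 0\<close> the solution is unique up to a null set. Only \<open>a \<ge> 0\<close> is meaningful.\<close>

definition potential ::
  "(real ^ 3 \<Rightarrow> real) \<Rightarrow> real \<Rightarrow> (real ^ 3 \<Rightarrow> real) \<Rightarrow> real ^ 3 \<Rightarrow> real" where
  "potential Q a u =
     (if a = 0 then (\<lambda>x. LINT y|lebesgue. Q y * (u y)\<^sup>2 / norm (x - y))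
      else (SOME \<phi>. potential_weak_solution Q a u \<phi>))"

section \<open>Energy functional and solutions\<close>

definition energy ::
  "(real ^ 3 \<Rightarrow> real) \<Rightarrow> (real ^ 3 \<Rightarrow> real) \<Rightarrow> real \<Rightarrow> real \<Rightarrow> real \<Rightarrow> (real ^ 3 \<Rightarrow> real) \<Rightarrow> real" where
  "energy Q K p a l u =
     1/2 * (H1_norm u)\<^sup>2
     + 1/4 * (LINT x|lebesgue. Q x * potential Q a u x * (u x)\<^sup>2)
     - 1/6 * (LINT x|lebesgue. \<bar>u x\<bar> ^ 6)
     - l / (p + 1) * (LINT x|lebesgue. K x * \<bar>u x\<bar> powr (p + 1))"

text \<open>At zeros of \<open>u\<close> the nonlinearity \<open>\<bar>u\<bar> powr (p - 1) * u\<close> is \<open>0\<close>, as intended.\<close>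

definition solutions ::
  "(real ^ 3 \<Rightarrow> real) \<Rightarrow> (real ^ 3 \<Rightarrow> real) \<Rightarrow> real \<Rightarrow> real \<Rightarrow> real \<Rightarrow> (real ^ 3 \<Rightarrow> real) set" where
  "solutions Q K p a l = {u \<in> H1. \<forall>v\<in>H1.
     (LINT x|lebesgue. weak_gradient u x \<bullet> weak_gradient v x)
     + (LINT x|lebesgue. u x * v x)
     + (LINT x|lebesgue. Q x * potential Q a u x * u x * v x)
     = (LINT x|lebesgue. \<bar>u x\<bar> ^ 4 * u x * v x)
       + l * (LINT x|lebesgue. K x * \<bar>u x\<bar> powr (p - 1) * u x * v x)}"

definition sublevel_solutions ::
  "(real ^ 3 \<Rightarrow> real) \<Rightarrow> (real ^ 3 \<Rightarrow> real) \<Rightarrow> real \<Rightarrow> real \<Rightarrow> real \<Rightarrow> real \<Rightarrow> (real ^ 3 \<Rightarrow> real) set" where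
  "sublevel_solutions Q K p c a l = {u \<in> solutions Q K p a l. energy Q K p a l u \<le> c}"

section \<open>Derivatives of functionals on \<open>H1\<close> and the dual norm\<close>

definition H1_functional :: "((real ^ 3 \<Rightarrow> real) \<Rightarrow> real) \<Rightarrow> bool" where
  "H1_functional L \<longleftrightarrow>
     (\<forall>v\<in>H1. \<forall>w\<in>H1. L (\<lambda>x. v x + w x) = L v + L w) \<and>
     (\<forall>r. \<forall>v\<in>H1. L (\<lambda>x. r * v x) = r * L v) \<and>
     (\<exists>C. \<forall>v\<in>H1. \<bar>L v\<bar> \<le> C * H1_norm v)"

definition has_H1_derivative ::
  "((real ^ 3 \<Rightarrow> real) \<Rightarrow> real) \<Rightarrow> ((real ^ 3 \<Rightarrow> real) \<Rightarrow> real) \<Rightarrow> (real ^ 3 \<Rightarrow> real) \<Rightarrow> bool" where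
  "has_H1_derivative F L u \<longleftrightarrow> H1_functional L \<and>
     (\<forall>e>0. \<exists>d>0. \<forall>v\<in>H1. H1_norm v < d \<longrightarrow>
        \<bar>F (\<lambda>x. u x + v x) - F u - L v\<bar> \<le> e * H1_norm v)"

text \<open>The Frechet derivative is unique as a functional on \<open>H1\<close>; its values outside \<open>H1\<close>
  are unspecified and do not enter the dual norm.\<close>

definition H1_derivative ::
  "((real ^ 3 \<Rightarrow> real) \<Rightarrow> real) \<Rightarrow> (real ^ 3 \<Rightarrow> real) \<Rightarrow> (real ^ 3 \<Rightarrow> real) \<Rightarrow> real" where
  "H1_derivative F u = (SOME L. has_H1_derivative F L u)"

definition H1_dual_norm :: "((real ^ 3 \<Rightarrow> real) \<Rightarrow> real) \<Rightarrow> ennreal" where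
  "H1_dual_norm L = (SUP v\<in>{v\<in>H1. H1_norm v \<le> 1}. ennreal \<bar>L v\<bar>)"

text \<open>The limit \<open>l \<rightarrow> 0\<close>, \<open>l > 0\<close>, along those \<open>l\<close> for which the solution set is nonempty.\<close>

definition lambda_to_zero ::
  "(real ^ 3 \<Rightarrow> real) \<Rightarrow> (real ^ 3 \<Rightarrow> real) \<Rightarrow> real \<Rightarrow> real \<Rightarrow> real \<Rightarrow> real filter" where
  "lambda_to_zero Q K p c a = at 0 within {l. 0 < l \<and> sublevel_solutions Q K p c a l \<noteq> {}}"

end

theory Submission
  imports Defs "HOL-Computational_Algebra.Polynomial"
begin

text \<open>
  Let \<open>u\<close> be a solution with \<open>I(u) \<le> c \<le> 0\<close>. In \<open>I(u) - I'(u)u / 4\<close> the nonlocal term cancels, and what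
  remains is \<open>\<parallel>u\<parallel>\<^sup>2/4 + \<bar>u\<bar>\<^sub>6\<^sup>6/12 \<le> c + C \<lambda> \<integral>\<bar>K\<bar> \<bar>u\<bar>\<^sup>p\<^sup>+\<^sup>1 \<le> C' \<lambda> \<parallel>u\<parallel>\<^sup>p\<^sup>+\<^sup>1\<close>, by Hoelder's inequality
  for \<open>K\<close> in \<open>L\<^bsup>2/(1-p)\<^esup>\<close>. As \<open>p + 1 < 2\<close>, this forces \<open>\<parallel>u\<parallel>\<close> below a power of \<open>\<lambda>\<close>, with
  constants that do not see \<open>a\<close> (\<open>solution_norm_bound\<close>). This is the squeezing.

  The other limits hold because \<open>\<bar>I(w)\<bar>\<close> and the dual norm of \<open>I'(w)\<close>, for the functional of any
  parameter \<open>b\<close> and any \<open>w\<close> in \<open>H\<^sup>1\<close>, are bounded by expressions in \<open>\<parallel>w\<parallel>\<close> and \<open>\<lambda>\<close> that vanish as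
  \<open>\<parallel>w\<parallel>\<close> tends to zero (\<open>energy_bound\<close>, \<open>dual_norm_bound\<close>). So nothing about solutions enters there, but
  the functional has to be controlled on all of \<open>H\<^sup>1\<close>:

  \<^item> The Sobolev inequality \<open>\<bar>u\<bar>\<^sub>6 \<le> C \<bar>\<nabla>u\<bar>\<^sub>2\<close> (\<open>Sobolev_inequality\<close>) handles the critical term. It is
    proved with the argument of Gagliardo and Nirenberg for averages of \<open>u\<close> over small cubes, which
    have continuous partial derivatives along the coordinate lines.

  \<^item> The function \<open>Q u\<^sup>2\<close> is in \<open>L\<^sup>6\<^sup>/\<^sup>5\<close>, the dual of \<open>L\<^sup>6\<close> (\<open>source_in_L65\<close>), because \<open>Q\<close> is the sum of a
    bounded function and a function in \<open>L\<^sup>2\<close>. The nonlocal term is \<open>T(Q u\<^sup>2, Q u\<^sup>2)\<close> for a bounded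
    symmetric bilinear form \<open>T\<close> on this space. For \<open>a = 0\<close> the form has the Newton kernel, and its
    boundedness is the Hardy-Littlewood-Sobolev inequality (\<open>HLS\<close>). For \<open>a > 0\<close> the potential
    is the solution of a variational problem; it exists by the Riesz representation theorem, the
    completeness of the underlying space following from the Sobolev inequality
    (\<open>D_space_complete\<close>).

  \<^item> All terms are Frechet differentiable (\<open>energy_derivative\<close>). The nonlocal and the critical term are
    polynomial, and \<open>\<bar>t\<bar>\<^sup>p\<^sup>+\<^sup>1\<close> has a Hoelder continuous derivative.

  Since gradients and Laplacians are selected from all weak derivatives, their uniqueness up to null
  sets (\<open>fundamental_lemma\<close>) is used throughout.
\<close>

section \<open>Smooth cut-off functions of one variable\<close>

text \<open>The counterpart for one variable of the classes \<open>Ck\<close>. Test functions on the space are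
  built as products of such functions of the single coordinates.\<close>

primrec Ck1 :: "nat \<Rightarrow> (real \<Rightarrow> real) \<Rightarrow> bool" where
  "Ck1 0 f \<longleftrightarrow> continuous_on UNIV f"
| "Ck1 (Suc k) f \<longleftrightarrow> (\<exists>f'. (\<forall>x. (f has_real_derivative f' x) (at x)) \<and> Ck1 k f')"

definition smooth :: "(real \<Rightarrow> real) \<Rightarrow> bool" where
  "smooth f \<longleftrightarrow> (\<forall>k. Ck1 k f)"

lemma Ck1_SucD: "Ck1 (Suc k) f \<Longrightarrow> Ck1 k f"
proof (induction k arbitrary: f)
  case 0
  then show ?case
    by (auto intro!: continuous_at_imp_continuous_on dest: DERIV_isCont)
next
  case (Suc k)
  then show ?case by (metis Ck1.simps(2))
qed

lemma Ck1_const: "Ck1 k (\<lambda>x. c)"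
proof (induction k arbitrary: c)
  case (Suc k)
  then show ?case by (auto intro!: exI[of _ "\<lambda>x. 0"])
qed auto

lemma Ck1_add: "Ck1 k f \<Longrightarrow> Ck1 k g \<Longrightarrow> Ck1 k (\<lambda>x. f x + g x)"
proof (induction k arbitrary: f g)
  case 0
  then show ?case by (simp add: continuous_on_add)
next
  case (Suc k)
  then obtain f' g' where "\<And>x. (f has_real_derivative f' x) (at x)" "Ck1 k f'"
    "\<And>x. (g has_real_derivative g' x) (at x)" "Ck1 k g'" by auto
  then show ?case using Suc.IH[of f' g']
    by (auto intro!: exI[of _ "\<lambda>x. f' x + g' x"] derivative_eq_intros)
qed

lemma Ck1_mult: "Ck1 k f \<Longrightarrow> Ck1 k g \<Longrightarrow> Ck1 k (\<lambda>x. f x * g x)"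
proof (induction k arbitrary: f g)
  case 0
  then show ?case by (simp add: continuous_on_mult)
next
  case (Suc k)
  then obtain f' g' where d: "\<And>x. (f has_real_derivative f' x) (at x)" "Ck1 k f'"
    "\<And>x. (g has_real_derivative g' x) (at x)" "Ck1 k g'" by auto
  have "Ck1 k (\<lambda>x. f' x * g x + f x * g' x)"
    using Suc d by (intro Ck1_add Suc.IH Ck1_SucD[of k f] Ck1_SucD[of k g])
  with d show ?case
    by (auto intro!: exI[of _ "\<lambda>x. f' x * g x + f x * g' x"] derivative_eq_intros)
qed

lemma Ck1_affine: "Ck1 k f \<Longrightarrow> Ck1 k (\<lambda>x. f (c * x + d))"
proof (induction k arbitrary: f)
  case 0
  then show ?case by (auto intro!: continuous_on_compose2[of UNIV f] continuous_on_add continuous_on_mult)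
next
  case (Suc k)
  then obtain f' where d: "\<And>x. (f has_real_derivative f' x) (at x)" "Ck1 k f'" by auto
  have "((\<lambda>x. f (c * x + d)) has_real_derivative c * f' (c * x + d)) (at x)" for x
    by (rule DERIV_chain2[where f = f and g = "\<lambda>x. c * x + d", THEN DERIV_cong, OF d(1)])
       (auto intro!: derivative_eq_intros)
  moreover have "Ck1 k (\<lambda>x. c * f' (c * x + d))"
    by (intro Ck1_mult Ck1_const Suc.IH d)
  ultimately show ?case by (auto intro!: exI[of _ "\<lambda>x. c * f' (c * x + d)"])
qed

lemma smooth_const: "smooth (\<lambda>x. c)"
  and smooth_add: "smooth f \<Longrightarrow> smooth g \<Longrightarrow> smooth (\<lambda>x. f x + g x)"
  and smooth_mult: "smooth f \<Longrightarrow> smooth g \<Longrightarrow> smooth (\<lambda>x. f x * g x)"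
  and smooth_affine: "smooth f \<Longrightarrow> smooth (\<lambda>x. f (a * x + b))"
  by (simp_all add: smooth_def Ck1_const Ck1_add Ck1_mult Ck1_affine)

lemma smooth_derivative:
  assumes "smooth f"
  shows "\<exists>f'. (\<forall>x. (f has_real_derivative f' x) (at x)) \<and> smooth f'"
proof -
  have *: "\<exists>f'. (\<forall>x. (f has_real_derivative f' x) (at x)) \<and> Ck1 k f'" for k
  proof -
    have "Ck1 (Suc k) f" using assms unfolding smooth_def by blast
    then show ?thesis by simp
  qed
  then obtain f' where f': "\<And>x. (f has_real_derivative f' x) (at x)" by blast
  have "Ck1 k f'" for k
  proof -
    obtain g where g: "\<And>x. (f has_real_derivative g x) (at x)" "Ck1 k g" using * by blast
    then have "g = f'" using f' DERIV_unique by blast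
    with g show ?thesis by simp
  qed
  with f' show ?thesis by (auto simp: smooth_def)
qed

lemma smooth_antiderivative:
  assumes "\<And>x. (F has_real_derivative f x) (at x)" "smooth f"
  shows "smooth F"
  unfolding smooth_def
proof
  fix k show "Ck1 k F"
  proof (cases k)
    case 0
    then show ?thesis using assms(1)
      by (auto intro!: continuous_at_imp_continuous_on dest: DERIV_isCont)
  next
    case (Suc j)
    then show ?thesis using assms by (auto simp: smooth_def)
  qed
qed

text \<open>The class of all \<open>P (1/t) exp (- c/t)\<close>, extended by zero to \<open>t \<le> 0\<close>, is closed under
  differentiation, since such a function, even divided by \<open>t\<close>, vanishes as \<open>t\<close> decreases
  to zero; hence its members are smooth.\<close>

definition flat :: "real poly \<Rightarrow> real \<Rightarrow> real \<Rightarrow> real" where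
  "flat P c t = (if t \<le> 0 then 0 else poly P (inverse t) * exp (- c * inverse t))"

lemma poly_exp_tendsto_0:
  fixes P :: "real poly"
  assumes "c > 0"
  shows "((\<lambda>s. s ^ k * poly P s * exp (- c * s)) \<longlongrightarrow> 0) at_top"
proof (induction P arbitrary: k)
  case 0
  then show ?case by simp
next
  case (pCons a P)
  have "((\<lambda>s. (c * s) ^ k / exp (c * s)) \<longlongrightarrow> 0) at_top"
    by (rule filterlim_compose[OF tendsto_power_div_exp_0])
       (use assms in \<open>auto intro!: filterlim_tendsto_pos_mult_at_top filterlim_ident\<close>)
  from tendsto_mult_left[OF this, of "a / c ^ k"]
  have "((\<lambda>s. a * (s ^ k * exp (- c * s))) \<longlongrightarrow> 0) at_top"
    using assms by (simp add: power_mult_distrib exp_minus divide_simps mult_ac)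
  from tendsto_add[OF this pCons.IH[of "Suc k"]] show ?case
    by (simp add: algebra_simps)
qed

lemma flat_tendsto_0:
  assumes "c > 0" shows "(flat P c \<longlongrightarrow> 0) (at 0)"
proof (rule filterlim_split_at)
  show "(flat P c \<longlongrightarrow> 0) (at_left 0)"
    by (rule tendsto_eventually) (auto simp: flat_def eventually_at_filter)
  have "((\<lambda>t. (inverse t) ^ 0 * poly P (inverse t) * exp (- c * inverse t)) \<longlongrightarrow> 0) (at_right 0)"
    by (rule filterlim_compose[OF poly_exp_tendsto_0[OF assms] filterlim_inverse_at_top_right])
  then show "(flat P c \<longlongrightarrow> 0) (at_right 0)"
    by (rule Lim_transform_eventually) (auto simp: flat_def eventually_at_filter)
qed

lemma flat_has_derivative:
  assumes "c > 0"
  shows "(flat P c has_real_derivative flat ([:0,0,1:] * (smult c P - pderiv P)) c t) (at t)"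
proof -
  consider "t < 0" | "t = 0" | "t > 0" by linarith
  then show ?thesis
  proof cases
    case 1
    have "((\<lambda>_. 0) has_real_derivative 0) (at t)" by simp
    moreover have "eventually (\<lambda>x. x < 0) (nhds t)"
      using 1 by (metis eventually_nhds lessThan_iff open_lessThan)
    ultimately show ?thesis using 1
      by (subst DERIV_cong_ev[OF refl _ refl, where g = "\<lambda>_. 0"])
         (auto simp: flat_def elim!: eventually_mono)
  next
    case 2
    have "((\<lambda>h. flat P c h / h) \<longlongrightarrow> 0) (at 0)"
      using flat_tendsto_0[OF assms, of "pCons 0 P"]
      by (rule Lim_transform_eventually) (auto simp: flat_def eventually_at_filter divide_simps)
    then show ?thesis using 2 by (simp add: DERIV_def flat_def)
  next
    case 3
    have "((\<lambda>t. poly P (inverse t) * exp (- c * inverse t)) has_real_derivative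
       flat ([:0,0,1:] * (smult c P - pderiv P)) c t) (at t)"
      using 3 by (auto intro!: derivative_eq_intros DERIV_chain2[OF poly_DERIV] simp: flat_def algebra_simps power2_eq_square)
    moreover have "eventually (\<lambda>x. x > 0) (nhds t)"
      using 3 by (metis eventually_nhds greaterThan_iff open_greaterThan)
    ultimately show ?thesis using 3
      by (subst DERIV_cong_ev[OF refl _ refl, where g = "\<lambda>t. poly P (inverse t) * exp (- c * inverse t)"])
         (auto simp: flat_def elim!: eventually_mono)
  qed
qed

lemma smooth_flat: assumes "c > 0" shows "smooth (flat P c)"
proof -
  have "Ck1 k (flat P c)" for k
  proof (induction k arbitrary: P)
    case 0
    then show ?case
      using flat_has_derivative[OF assms]
      by (auto intro!: continuous_at_imp_continuous_on dest: DERIV_isCont)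
  next
    case (Suc k)
    then show ?case using flat_has_derivative[OF assms] by (metis Ck1.simps(2))
  qed
  then show ?thesis by (simp add: smooth_def)
qed

text \<open>As \<open>n\<close> grows, \<open>exp (- 1 / ((n+1) t))\<close> increases to one for every \<open>t > 0\<close>; so the bumps
  increase to the indicator of \<open>(a, b)\<close>.\<close>

definition bump :: "real \<Rightarrow> real \<Rightarrow> nat \<Rightarrow> real \<Rightarrow> real" where
  "bump a b n t = flat 1 (1 / real (Suc n)) (t - a) * flat 1 (1 / real (Suc n)) (b - t)"

lemma smooth_bump: "smooth (bump a b n)"
  unfolding bump_def
  using smooth_mult[OF smooth_affine[OF smooth_flat[of "1 / real (Suc n)" 1], of 1 "-a"]
      smooth_affine[OF smooth_flat[of "1 / real (Suc n)" 1], of "-1" b]]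
  by simp

lemma flat_1_bounds: "c > 0 \<Longrightarrow> 0 \<le> flat 1 c t \<and> flat 1 c t \<le> 1"
  by (auto simp: flat_def)

lemma bump_bounds: "0 \<le> bump a b n t" "bump a b n t \<le> 1"
  using flat_1_bounds[of "1 / real (Suc n)" "t-a"] flat_1_bounds[of "1 / real (Suc n)" "b-t"]
  by (auto simp: bump_def intro: mult_le_one)

lemma bump_eq_0: "t \<le> a \<or> b \<le> t \<Longrightarrow> bump a b n t = 0"
  by (auto simp: bump_def flat_def)

lemma bump_tendsto: "(\<lambda>n. bump a b n t) \<longlonglongrightarrow> indicator {a<..<b} t"
proof (cases "a < t \<and> t < b")
  case True
  have *: "(\<lambda>n. exp (- (1 / real (Suc n)) * r)) \<longlonglongrightarrow> 1" for r :: real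
  proof -
    have "(\<lambda>n. exp (- (1 / real (Suc n)) * r)) \<longlonglongrightarrow> exp (- 0 * r)"
      using LIMSEQ_inverse_real_of_nat by (intro tendsto_intros) (simp add: inverse_eq_divide)
    then show ?thesis by simp
  qed
  have "(\<lambda>n. exp (- (1 / real (Suc n)) * inverse (t - a)) * exp (- (1 / real (Suc n)) * inverse (b - t))) \<longlonglongrightarrow> 1 * 1"
    by (intro tendsto_mult *)
  moreover have "bump a b n t = exp (- (1 / real (Suc n)) * inverse (t - a)) * exp (- (1 / real (Suc n)) * inverse (b - t))" for n
    using True by (simp add: bump_def flat_def)
  ultimately show ?thesis using True by simp
qed (auto simp: bump_eq_0 not_less)

section \<open>Test functions and the uniqueness of weak derivatives\<close>

lemma partial_deriv_prod:
  fixes m :: "3 \<Rightarrow> real \<Rightarrow> real"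
  assumes "\<And>j t. (m j has_real_derivative m' j t) (at t)"
  shows "(\<lambda>x. \<Prod>j\<in>UNIV. m j (x $ j)) differentiable (at x)"
    and "partial_deriv i (\<lambda>x. \<Prod>j\<in>UNIV. m j (x $ j)) x = (\<Prod>j\<in>UNIV. (m(i := m' i)) j (x $ j))"
proof -
  have d: "((\<lambda>x. m j (x $ j)) has_derivative (\<lambda>h. m' j (x $ j) * h $ j)) (at x)" for j
  proof -
    have "((\<lambda>x. x $ j) has_derivative (\<lambda>h. h $ j)) (at x)"
      by (rule bounded_linear_imp_has_derivative) (rule bounded_linear_vec_nth)
    then show ?thesis
      using has_derivative_compose[of "\<lambda>x. x $ j" "\<lambda>h. h $ j" x UNIV "m j" "\<lambda>h. m' j (x $ j) * h"]
        assms[of j "x $ j"] by (simp add: has_field_derivative_def)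
  qed
  have D: "((\<lambda>x. \<Prod>j\<in>UNIV. m j (x $ j)) has_derivative
     (\<lambda>h. \<Sum>k\<in>UNIV. m' k (x $ k) * h $ k * (\<Prod>j\<in>UNIV-{k}. m j (x $ j)))) (at x)"
    by (rule has_derivative_prod) (use d in auto)
  then show "(\<lambda>x. \<Prod>j\<in>UNIV. m j (x $ j)) differentiable (at x)"
    by (auto simp: differentiable_def)
  have "partial_deriv i (\<lambda>x. \<Prod>j\<in>UNIV. m j (x $ j)) x
     = (\<Sum>k\<in>UNIV. m' k (x $ k) * axis i 1 $ k * (\<Prod>j\<in>UNIV-{k}. m j (x $ j)))"
    unfolding partial_deriv_def using D by (subst frechet_derivative_at[OF D, symmetric]) simp
  also have "\<dots> = (\<Sum>k\<in>UNIV. if k = i then m' i (x $ i) * (\<Prod>j\<in>UNIV-{i}. m j (x $ j)) else 0)"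
    by (intro sum.cong) (auto simp: axis_def)
  also have "\<dots> = m' i (x $ i) * (\<Prod>j\<in>UNIV-{i}. m j (x $ j))" by simp
  also have "\<dots> = (\<Prod>j\<in>UNIV. (m(i := m' i)) j (x $ j))"
    by (subst prod.remove[of _ i]) auto
  finally show "partial_deriv i (\<lambda>x. \<Prod>j\<in>UNIV. m j (x $ j)) x = (\<Prod>j\<in>UNIV. (m(i := m' i)) j (x $ j))" .
qed

text \<open>A partial derivative only replaces one factor by its derivative, which is again smooth.\<close>

lemma Ck_prod:
  fixes m :: "3 \<Rightarrow> real \<Rightarrow> real"
  assumes "\<And>j. smooth (m j)"
  shows "Ck k (\<lambda>x. \<Prod>j\<in>UNIV. m j (x $ j))"
  using assms
proof (induction k arbitrary: m)
  case 0
  have "continuous_on UNIV (m j)" for j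
  proof -
    have "Ck1 0 (m j)" using 0[of j] unfolding smooth_def by blast
    then show ?thesis by simp
  qed
  then show ?case
    by (simp, intro continuous_on_prod ballI continuous_on_compose2[OF _ continuous_on_component[OF continuous_on_id]]) auto
next
  case (Suc k)
  have "\<forall>j. \<exists>f'. (\<forall>x. (m j has_real_derivative f' x) (at x)) \<and> smooth f'"
    using Suc.prems smooth_derivative by blast
  from choice[OF this] obtain m' where m': "\<And>j x. (m j has_real_derivative m' j x) (at x)" "\<And>j. smooth (m' j)"
    by blast
  have "Ck k (partial_deriv i (\<lambda>x. \<Prod>j\<in>UNIV. m j (x $ j)))" for i
    using Suc.IH[of "m(i := m' i)"] Suc.prems m'(2)
    by (simp add: partial_deriv_prod(2)[OF m'(1), abs_def] )
  then show ?case by (simp add: partial_deriv_prod(1)[OF m'(1)])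
qed

lemma test_function_prod:
  fixes m :: "3 \<Rightarrow> real \<Rightarrow> real"
  assumes "\<And>j. smooth (m j)" "\<And>j t. m j t \<noteq> 0 \<Longrightarrow> a $ j \<le> t \<and> t \<le> b $ j"
  shows "test_function (\<lambda>x. \<Prod>j\<in>UNIV. m j (x $ j))"
proof -
  have "{x. (\<Prod>j\<in>UNIV. m j (x $ j)) \<noteq> 0} \<subseteq> cbox a b"
    using assms(2) by (auto simp: mem_box_cart)
  then have "bounded {x. (\<Prod>j\<in>UNIV. m j (x $ j)) \<noteq> 0}"
    using bounded_cbox bounded_subset by blast
  then show ?thesis using Ck_prod[OF assms(1)]
    by (simp add: test_function_def)
qed

definition box_bump :: "real ^ 3 \<Rightarrow> real ^ 3 \<Rightarrow> nat \<Rightarrow> real ^ 3 \<Rightarrow> real" where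
  "box_bump a b n x = (\<Prod>j\<in>UNIV. bump (a $ j) (b $ j) n (x $ j))"

lemma test_function_box_bump: "test_function (box_bump a b n)"
  unfolding box_bump_def
proof (rule test_function_prod[where m = "\<lambda>j. bump (a $ j) (b $ j) n", of a b])
  show "a $ j \<le> t \<and> t \<le> b $ j" if "bump (a $ j) (b $ j) n t \<noteq> 0" for j t
    using that bump_eq_0[of t "a $ j" "b $ j" n] by linarith
qed (rule smooth_bump)

lemma indicator_box_prod:
  fixes a b x :: "real ^ 3"
  shows "indicator (box a b) x = (\<Prod>j\<in>UNIV. indicator {a $ j<..<b $ j} (x $ j) :: real)"
proof (cases "x \<in> box a b")
  case False
  then obtain j where "x $ j \<notin> {a $ j<..<b $ j}" by (auto simp: mem_box_cart)
  then have "(\<Prod>j\<in>UNIV. indicator {a $ j<..<b $ j} (x $ j) :: real) = 0"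
    by (intro prod_zero bexI[of _ j]) auto
  then show ?thesis using False by simp
qed (simp add: mem_box_cart)

lemma box_bump_tendsto: "(\<lambda>n. box_bump a b n x) \<longlonglongrightarrow> indicator (box a b) x"
  unfolding box_bump_def indicator_box_prod by (intro tendsto_prod bump_tendsto)

lemma box_bump_le: "\<bar>box_bump a b n x\<bar> \<le> indicator (cbox a b) x"
proof (cases "x \<in> cbox a b")
  case True
  then show ?thesis unfolding box_bump_def
    by (simp add: abs_prod bump_bounds) (rule prod_le_1, simp add: bump_bounds)
next
  case False
  then obtain j where "x $ j < a $ j \<or> b $ j < x $ j"
    by (auto simp: mem_box_cart not_le)
  then have "\<exists>j. bump (a $ j) (b $ j) n (x $ j) = 0"
    using bump_eq_0 less_imp_le by blast
  then show ?thesis using False by (auto simp: box_bump_def)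
qed

lemma locally_integrable_cbox:
  "locally_integrable f \<Longrightarrow> integrable lebesgue (\<lambda>x. indicator (cbox a b) x *\<^sub>R f x)"
  by (auto simp: locally_integrable_def set_integrable_def)

lemma locally_integrable_measurable:
  assumes "locally_integrable f" shows "f \<in> borel_measurable lebesgue"
proof -
  have "(\<lambda>x. indicator (cbox (-(real n *\<^sub>R One)) (real n *\<^sub>R One)) x *\<^sub>R f x) \<in> borel_measurable lebesgue" for n
    by (rule borel_measurable_integrable) (rule locally_integrable_cbox[OF assms])
  moreover have "(\<lambda>n. indicator (cbox (-(real n *\<^sub>R One)) (real n *\<^sub>R One)) x *\<^sub>R f x) \<longlonglongrightarrow> f x" for x :: "real ^ 3"
  proof (rule tendsto_eventually)
    obtain N :: nat where N: "norm x \<le> real N" using real_arch_simple by blast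
    have "x \<in> cbox (-(real n *\<^sub>R One)) (real n *\<^sub>R One)" if "n \<ge> N" for n
    proof -
      have "\<bar>x \<bullet> i\<bar> \<le> real n" if "i \<in> Basis" for i
        using Basis_le_norm[OF that, of x] N \<open>n \<ge> N\<close> by linarith
      then show ?thesis by (force simp: mem_box abs_le_iff inner_sum_left_Basis)
    qed
    then show "\<forall>\<^sub>F n in sequentially. indicator (cbox (-(real n *\<^sub>R One)) (real n *\<^sub>R One)) x *\<^sub>R f x = f x"
      unfolding eventually_sequentially by (intro exI[of _ N]) (simp add: indicator_def)
  qed
  ultimately show ?thesis by (rule borel_measurable_LIMSEQ_metric)
qed

lemma integral_cbox_lebesgue:
  fixes f :: "real ^ 3 \<Rightarrow> 'b::euclidean_space"
  assumes "locally_integrable f"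
  shows "integral (cbox a b) f = (LINT x|lebesgue. indicator (box a b) x *\<^sub>R f x)"
    and "f integrable_on cbox a b"
proof -
  have si: "set_integrable lebesgue (cbox a b) f"
    using assms by (auto simp: locally_integrable_def)
  show "f integrable_on cbox a b" using si by (rule set_lebesgue_integral_eq_integral)
  have si': "set_integrable lebesgue (box a b) f"
    by (rule set_integrable_subset[OF si]) (auto simp: box_subset_cbox)
  have "integral (cbox a b) f = integral (box a b) f"
    using negligible_frontier_interval[of a b] box_subset_cbox[of a b]
    by (intro integral_spike_set) (auto elim!: negligible_subset)
  also have "\<dots> = (LINT x|lebesgue. indicator (box a b) x *\<^sub>R f x)"
    using set_lebesgue_integral_eq_integral(2)[OF si'] by (simp add: set_lebesgue_integral_def)
  finally show "integral (cbox a b) f = (LINT x|lebesgue. indicator (box a b) x *\<^sub>R f x)" .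
qed

text \<open>Lebesgue's differentiation theorem for cubes with corner \<open>x\<close>.\<close>

lemma cube_average_tendsto:
  fixes f :: "real ^ 3 \<Rightarrow> 'b::euclidean_space"
  assumes "locally_integrable f"
  shows "AE x in lebesgue. ((\<lambda>h. integral (cbox x (x + h *\<^sub>R One)) f /\<^sub>R h ^ 3) \<longlongrightarrow> f x) (at_right 0)"
proof -
  obtain N where N: "negligible N" "\<And>x e. \<lbrakk>x \<notin> N; 0 < e\<rbrakk> \<Longrightarrow> \<exists>d>0. \<forall>h. 0 < h \<and> h < d \<longrightarrow>
      norm (integral (cbox x (x + h *\<^sub>R One)) f /\<^sub>R h ^ DIM(real^3) - f x) < e"
    using integrable_ccontinuous_explicit[OF integral_cbox_lebesgue(2)[OF assms]] by metis
  show ?thesis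
  proof (rule AE_I'[of N])
    show "N \<in> null_sets lebesgue" using N(1) negligible_iff_null_sets by blast
    have "((\<lambda>h. integral (cbox x (x + h *\<^sub>R One)) f /\<^sub>R h ^ 3) \<longlongrightarrow> f x) (at_right 0)" if "x \<notin> N" for x
      unfolding tendsto_iff eventually_at dist_norm
      using N(2)[OF that] by (simp add: greaterThan_def) (metis abs_of_pos)
    then show "{x \<in> space lebesgue. \<not> ((\<lambda>h. integral (cbox x (x + h *\<^sub>R One)) f /\<^sub>R h ^ 3) \<longlongrightarrow> f x) (at_right 0)} \<subseteq> N"
      by auto
  qed
qed

text \<open>Box bumps converge boundedly to indicators of boxes; so the integrals of \<open>f\<close> over all boxes
  vanish, and Lebesgue's differentiation theorem recovers \<open>f\<close> from them.\<close>

lemma fundamental_lemma: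
  fixes f :: "real ^ 3 \<Rightarrow> real"
  assumes f: "locally_integrable f"
    and test: "\<And>\<psi>. test_function \<psi> \<Longrightarrow> (LINT x|lebesgue. f x * \<psi> x) = 0"
  shows "AE x in lebesgue. f x = 0"
proof -
  have fm: "f \<in> borel_measurable lebesgue" using f by (rule locally_integrable_measurable)
  have cm: "box_bump a b n \<in> borel_measurable lebesgue" for a b n
  proof -
    have "continuous_on UNIV (box_bump a b n)"
      using test_function_box_bump[of a b n] by (metis Ck.simps(1) test_function_def)
    then show ?thesis by (simp add: borel_measurable_continuous_onI measurable_completion)
  qed
  have "integral (cbox a b) f = 0" for a b
  proof -
    have "(\<lambda>n. LINT x|lebesgue. f x * box_bump a b n x) \<longlonglongrightarrow> (LINT x|lebesgue. f x * indicator (box a b) x)"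
    proof (rule integral_dominated_convergence[where w = "\<lambda>x. norm (indicator (cbox a b) x *\<^sub>R f x)"])
      show "integrable lebesgue (\<lambda>x. norm (indicator (cbox a b) x *\<^sub>R f x))"
        using locally_integrable_cbox[OF f] by (rule integrable_norm)
      show "AE x in lebesgue. (\<lambda>i. f x * box_bump a b i x) \<longlonglongrightarrow> f x * indicator (box a b) x"
        by (intro AE_I2 tendsto_intros box_bump_tendsto)
      show "AE x in lebesgue. norm (f x * box_bump a b n x) \<le> norm (indicator (cbox a b) x *\<^sub>R f x)" for n
        using box_bump_le[of a b n] by (simp add: abs_mult mult.commute[of _ "\<bar>f _\<bar>"] mult_left_mono)
    qed (use fm cm in \<open>auto intro!: borel_measurable_times borel_measurable_indicator\<close>)
    then have "(LINT x|lebesgue. f x * indicator (box a b) x) = 0"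
      using test[OF test_function_box_bump] by (simp add: LIMSEQ_const_iff)
    then show ?thesis by (simp add: integral_cbox_lebesgue[OF f] mult.commute)
  qed
  then show ?thesis using cube_average_tendsto[OF f]
    by (simp add: tendsto_const_iff eq_commute[of 0])
qed

lemma locally_integrable_diff:
  "locally_integrable f \<Longrightarrow> locally_integrable g \<Longrightarrow> locally_integrable (\<lambda>x. f x - g x)"
  by (auto simp: locally_integrable_def)

lemma locally_integrable_component:
  fixes g :: "real ^ 3 \<Rightarrow> real ^ 3"
  assumes "locally_integrable g" shows "locally_integrable (\<lambda>x. g x $ i)"
proof -
  have "(\<lambda>x. g x \<bullet> axis i 1) absolutely_integrable_on S" if "compact S" for S
    using assms that absolutely_integrable_component by (auto simp: locally_integrable_def)
  then show ?thesis by (simp add: locally_integrable_def inner_axis)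
qed

lemma test_function_bounded_support:
  assumes "test_function \<psi>"
  obtains a b M where "\<And>x. \<bar>\<psi> x\<bar> \<le> M * indicator (cbox a b) x" "0 \<le> M"
     "\<psi> \<in> borel_measurable lebesgue"
proof -
  have c: "continuous_on UNIV \<psi>" using assms by (metis Ck.simps(1) test_function_def)
  have k: "compact (closure {x. \<psi> x \<noteq> 0})" using assms by (simp add: test_function_def)
  obtain b where ab: "closure {x. \<psi> x \<noteq> 0} \<subseteq> cbox (- b) b"
    using bounded_subset_cbox_symmetric[OF compact_imp_bounded[OF k]] by metis
  have "compact (\<psi> ` cbox (- b) b)"
    using c by (intro compact_continuous_image) (auto intro: continuous_on_subset)
  then have "bounded (\<psi> ` cbox (- b) b)" by (rule compact_imp_bounded)
  then obtain M where M': "\<forall>y\<in>\<psi> ` cbox (- b) b. \<bar>y\<bar> \<le> M"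
    unfolding bounded_real by (elim exE)
  have M: "\<bar>\<psi> x\<bar> \<le> M" if "x \<in> cbox (- b) b" for x
    using M' that by simp
  show ?thesis
  proof (rule that[of "max M 0" "- b" b])
    show "\<bar>\<psi> x\<bar> \<le> (max M 0) * indicator (cbox (- b) b) x" for x
    proof (cases "\<psi> x = 0")
      case False
      then have "x \<in> closure {x. \<psi> x \<noteq> 0}" using closure_subset by fastforce
      then have "x \<in> cbox (- b) b" using ab by blast
      then show ?thesis using M[of x] by simp
    qed auto
    show "\<psi> \<in> borel_measurable lebesgue"
      using c by (simp add: borel_measurable_continuous_onI measurable_completion)
  qed auto
qed

lemma integrable_times_test_function:
  fixes f :: "real ^ 3 \<Rightarrow> real"
  assumes "locally_integrable f" "test_function \<psi>"
  shows "integrable lebesgue (\<lambda>x. f x * \<psi> x)"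
proof -
  obtain a b M where M: "\<And>x. \<bar>\<psi> x\<bar> \<le> M * indicator (cbox a b) x" "0 \<le> M"
     "\<psi> \<in> borel_measurable lebesgue"
    using test_function_bounded_support[OF assms(2)] by metis
  have "integrable lebesgue (\<lambda>x. M * (indicator (cbox a b) x *\<^sub>R f x))"
    using locally_integrable_cbox[OF assms(1)] by simp
  then show ?thesis
  proof (rule Bochner_Integration.integrable_bound)
    show "AE x in lebesgue. norm (f x * \<psi> x) \<le> norm (M * (indicator (cbox a b) x *\<^sub>R f x))"
    proof (rule AE_I2)
      fix x show "norm (f x * \<psi> x) \<le> norm (M * (indicator (cbox a b) x *\<^sub>R f x))"
        using mult_left_mono[OF M(1)[of x], of "\<bar>f x\<bar>"] M(2) by (simp add: abs_mult mult_ac)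
    qed
  qed (use locally_integrable_measurable[OF assms(1)] M in measurable)
qed

lemma test_function_partial_deriv:
  assumes "test_function \<psi>" shows "test_function (partial_deriv i \<psi>)"
proof -
  have "{x. partial_deriv i \<psi> x \<noteq> 0} \<subseteq> closure {x. \<psi> x \<noteq> 0}"
  proof clarify
    fix x assume x: "partial_deriv i \<psi> x \<noteq> 0"
    show "x \<in> closure {x. \<psi> x \<noteq> 0}"
    proof (rule ccontr)
      assume nx: "x \<notin> closure {x. \<psi> x \<noteq> 0}"
      have "(\<psi> has_derivative (\<lambda>h. 0)) (at x)"
        by (rule has_derivative_transform_within_open[of "\<lambda>x. 0" _ x UNIV "- closure {x. \<psi> x \<noteq> 0}"])
           (use nx closure_subset in force)+
      then have "frechet_derivative \<psi> (at x) = (\<lambda>h. 0)" using frechet_derivative_at by metis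
      with x show False by (simp add: partial_deriv_def)
    qed
  qed
  then have "closure {x. partial_deriv i \<psi> x \<noteq> 0} \<subseteq> closure {x. \<psi> x \<noteq> 0}"
    by (simp add: closure_minimal)
  moreover have "Ck k (partial_deriv i \<psi>)" for k
    using assms by (metis Ck.simps(2) test_function_def)
  ultimately show ?thesis using assms
    by (auto simp: test_function_def compact_eq_bounded_closed intro: bounded_subset)
qed

lemma laplacian_integral:
  assumes "locally_integrable u" "test_function \<psi>"
  shows "integrable lebesgue (\<lambda>x. u x * laplacian \<psi> x)"
  unfolding laplacian_def sum_distrib_left
  by (intro Bochner_Integration.integrable_sum integrable_times_test_function test_function_partial_deriv assms)

lemma has_weak_gradientD:
  assumes "has_weak_gradient u g"
  shows "locally_integrable u" "locally_integrable g"
    "test_function \<psi> \<Longrightarrow> (LINT x|lebesgue. u x * partial_deriv i \<psi> x) = - (LINT x|lebesgue. (g x $ i) * \<psi> x)"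
  using assms by (simp_all add: has_weak_gradient_def)

lemma has_weak_laplacianD:
  assumes "has_weak_laplacian u h"
  shows "locally_integrable u" "locally_integrable h"
    "test_function \<psi> \<Longrightarrow> (LINT x|lebesgue. u x * laplacian \<psi> x) = (LINT x|lebesgue. h x * \<psi> x)"
  using assms by (simp_all add: has_weak_laplacian_def)

lemma weak_gradient_unique:
  assumes "has_weak_gradient u g" "has_weak_gradient u g'"
  shows "AE x in lebesgue. g x = g' x"
proof -
  have "AE x in lebesgue. g x $ i - g' x $ i = 0" for i
  proof (rule fundamental_lemma)
    have l: "locally_integrable (\<lambda>x. g x $ i)" "locally_integrable (\<lambda>x. g' x $ i)"
      using assms by (auto simp: has_weak_gradient_def intro: locally_integrable_component)
    then show "locally_integrable (\<lambda>x. g x $ i - g' x $ i)" by (rule locally_integrable_diff)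
    fix \<psi> assume t: "test_function \<psi>"
    have "(LINT x|lebesgue. g x $ i * \<psi> x) = (LINT x|lebesgue. g' x $ i * \<psi> x)"
      using has_weak_gradientD(3)[OF assms(1) t, of i] has_weak_gradientD(3)[OF assms(2) t, of i] by simp
    then show "(LINT x|lebesgue. (g x $ i - g' x $ i) * \<psi> x) = 0"
      using l t by (simp add: left_diff_distrib integrable_times_test_function)
  qed
  then have "AE x in lebesgue. \<forall>i\<in>UNIV. g x $ i - g' x $ i = 0"
    by (intro AE_finite_allI) auto
  then show ?thesis by (auto simp: vec_eq_iff)
qed

lemma weak_laplacian_unique:
  assumes "has_weak_laplacian u h" "has_weak_laplacian u h'"
  shows "AE x in lebesgue. h x = h' x"
proof -
  have "AE x in lebesgue. h x - h' x = 0"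
  proof (rule fundamental_lemma)
    have l: "locally_integrable h" "locally_integrable h'"
      using assms by (auto simp: has_weak_laplacian_def)
    then show "locally_integrable (\<lambda>x. h x - h' x)" by (rule locally_integrable_diff)
    fix \<psi> assume t: "test_function \<psi>"
    have "(LINT x|lebesgue. h x * \<psi> x) = (LINT x|lebesgue. h' x * \<psi> x)"
      using has_weak_laplacianD(3)[OF assms(1) t] has_weak_laplacianD(3)[OF assms(2) t] by simp
    then show "(LINT x|lebesgue. (h x - h' x) * \<psi> x) = 0"
      using l t by (simp add: left_diff_distrib integrable_times_test_function)
  qed
  then show ?thesis by simp
qed

section \<open>Averages over cubes\<close>

text \<open>Integrating over the cubes \<open>x + (0, h)\<^sup>3\<close> turns a weak gradient into classical partial
  derivatives along the coordinate lines.\<close>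

definition cube_integral :: "real \<Rightarrow> (real ^ 3 \<Rightarrow> 'b::euclidean_space) \<Rightarrow> real ^ 3 \<Rightarrow> 'b" where
  "cube_integral h f x = (LINT z|lebesgue. indicator (box x (x + h *\<^sub>R One)) z *\<^sub>R f z)"

lemma sum_Basis_nth [simp]: "(\<Sum>x\<in>(Basis :: (real ^ 3) set). x $ j) = 1"
proof -
  have "(\<Sum>x\<in>(Basis :: (real ^ 3) set). x $ j) = (\<Sum>x\<in>(Basis :: (real ^ 3) set). if x = axis j 1 then 1 else 0)"
    by (intro sum.cong) (auto simp: Basis_vec_def axis_def vec_eq_iff split: if_splits)
  also have "\<dots> = 1" by (simp add: axis_in_Basis_iff)
  finally show ?thesis .
qed

lemma integrable_indicator_box:
  "locally_integrable f \<Longrightarrow> integrable lebesgue (\<lambda>x. indicator (box a b) x *\<^sub>R f x)"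
  using set_integrable_subset[of lebesgue "cbox a b" f "box a b"] box_subset_cbox[of a b]
  by (auto simp: locally_integrable_def set_integrable_def)

text \<open>When the cube moves, the indicator converges at all points outside the boundary of the limit
  cube, a null set.\<close>

lemma continuous_cube_integral:
  fixes f :: "real ^ 3 \<Rightarrow> 'b::euclidean_space"
  assumes f: "locally_integrable f"
  shows "continuous_on UNIV (cube_integral h f)"
proof (rule continuous_on_sequentiallyI)
  fix X :: "nat \<Rightarrow> real ^ 3" and x assume X: "X \<longlonglongrightarrow> x"
  have "bounded (range X)" using X convergent_imp_bounded by blast
  then obtain b where b: "range X \<subseteq> cbox (- b) b" using bounded_subset_cbox_symmetric by metis
  have bb: "box (X n) (X n + h *\<^sub>R One) \<subseteq> cbox (- b) (b + h *\<^sub>R One)" for n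
  proof
    fix z assume z: "z \<in> box (X n) (X n + h *\<^sub>R One)"
    have "X n \<in> cbox (- b) b" using b by blast
    then show "z \<in> cbox (- b) (b + h *\<^sub>R One)"
      using z by (auto simp: mem_box_cart) (meson less_imp_le order_trans add_right_mono less_le_trans)+
  qed
  define N where "N = cbox x (x + h *\<^sub>R One) - box x (x + h *\<^sub>R One)"
  have N: "N \<in> null_sets lebesgue"
    using negligible_frontier_interval negligible_iff_null_sets N_def by blast
  have lim: "(\<lambda>n. indicator (box (X n) (X n + h *\<^sub>R One)) z :: real) \<longlonglongrightarrow> indicator (box x (x + h *\<^sub>R One)) z"
    if "z \<notin> N" for z
  proof (cases "z \<in> box x (x + h *\<^sub>R One)")
    case True
    have "eventually (\<lambda>n. X n $ j < z $ j \<and> z $ j < X n $ j + h) sequentially" for j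
    proof -
      have l: "(\<lambda>n. X n $ j) \<longlonglongrightarrow> x $ j" using X by (rule tendsto_vec_nth)
      have "x $ j < z $ j" "z $ j - h < x $ j" using True by (auto simp: mem_box_cart algebra_simps)
      with order_tendstoD[OF l] have "eventually (\<lambda>n. X n $ j < z $ j) sequentially"
         "eventually (\<lambda>n. z $ j - h < X n $ j) sequentially" by auto
      then show ?thesis by eventually_elim auto
    qed
    then have "eventually (\<lambda>n. \<forall>j. X n $ j < z $ j \<and> z $ j < X n $ j + h) sequentially"
      by (rule eventually_all_finite)
    then have "eventually (\<lambda>n. indicator (box (X n) (X n + h *\<^sub>R One)) z = (1::real)) sequentially"
      by eventually_elim (simp add: mem_box_cart)
    then show ?thesis using True by (simp add: tendsto_eventually)
  next
    case False
    then have "z \<notin> cbox x (x + h *\<^sub>R One)" using that by (auto simp: N_def)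
    then obtain j where j: "z $ j < x $ j \<or> x $ j < z $ j - h"
      by (auto simp: mem_box_cart not_le algebra_simps)
    have l: "(\<lambda>n. X n $ j) \<longlonglongrightarrow> x $ j" using X by (rule tendsto_vec_nth)
    have "eventually (\<lambda>n. z $ j < X n $ j \<or> X n $ j < z $ j - h) sequentially"
      using j
    proof
      assume "z $ j < x $ j"
      from order_tendstoD(1)[OF l this] show ?thesis by eventually_elim simp
    next
      assume "x $ j < z $ j - h"
      from order_tendstoD(2)[OF l this] show ?thesis by eventually_elim simp
    qed
    then have "eventually (\<lambda>n. indicator (box (X n) (X n + h *\<^sub>R One)) z = (0::real)) sequentially"
    proof eventually_elim
      case (elim n)
      then have "\<not> (X n $ j < z $ j \<and> z $ j < X n $ j + h)" by auto
      then have "z \<notin> box (X n) (X n + h *\<^sub>R One)" by (auto simp: mem_box_cart)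
      then show ?case by simp
    qed
    then show ?thesis using False by (simp add: tendsto_eventually)
  qed
  show "(\<lambda>n. cube_integral h f (X n)) \<longlonglongrightarrow> cube_integral h f x"
    unfolding cube_integral_def
  proof (rule integral_dominated_convergence[where w = "\<lambda>z. norm (indicator (cbox (- b) (b + h *\<^sub>R One)) z *\<^sub>R f z)"])
    show "integrable lebesgue (\<lambda>z. norm (indicator (cbox (- b) (b + h *\<^sub>R One)) z *\<^sub>R f z))"
      using locally_integrable_cbox[OF f] by (rule integrable_norm)
    show "AE z in lebesgue. (\<lambda>n. indicator (box (X n) (X n + h *\<^sub>R One)) z *\<^sub>R f z)
        \<longlonglongrightarrow> indicator (box x (x + h *\<^sub>R One)) z *\<^sub>R f z"
    proof (rule AE_I'[OF N], clarify, rule ccontr)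
      fix z assume a: "\<not> (\<lambda>n. indicator (box (X n) (X n + h *\<^sub>R One)) z *\<^sub>R f z)
        \<longlonglongrightarrow> indicator (box x (x + h *\<^sub>R One)) z *\<^sub>R f z" and "z \<notin> N"
      from tendsto_scaleR[OF lim[OF this(2)] tendsto_const[of "f z"]] a show False by simp
    qed
    show "AE z in lebesgue. norm (indicator (box (X n) (X n + h *\<^sub>R One)) z *\<^sub>R f z)
        \<le> norm (indicator (cbox (- b) (b + h *\<^sub>R One)) z *\<^sub>R f z)" for n
      using bb[of n] by (intro AE_I2) (auto simp: indicator_def)
  qed (auto intro!: borel_measurable_integrable integrable_indicator_box f)
qed

text \<open>The antiderivative of the indicator of \<open>(a, b)\<close> and its smooth approximations. The integrals start at
  \<open>a - 1\<close>, so that all points from \<open>a\<close> on are interior to the range of integration.\<close>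

definition bump_int :: "real \<Rightarrow> real \<Rightarrow> nat \<Rightarrow> real \<Rightarrow> real" where
  "bump_int a b n z = (LINT y|lborel. indicator {a - 1..z} y * bump a b n y)"

definition clamp_int :: "real \<Rightarrow> real \<Rightarrow> real \<Rightarrow> real" where
  "clamp_int a b z = max 0 (min z b - a)"

lemma continuous_bump: "continuous_on S (bump a b n)"
proof -
  have "Ck1 0 (bump a b n)" using smooth_bump[of a b n] unfolding smooth_def by blast
  then have "continuous_on UNIV (bump a b n)" by simp
  then show ?thesis by (rule continuous_on_subset) simp
qed

lemma bump_measurable [measurable]: "bump a b n \<in> borel_measurable borel"
  by (intro borel_measurable_continuous_onI continuous_bump)

lemma bump_le_indicator: "\<bar>bump a b n y\<bar> \<le> indicator {a<..<b} y"
  using bump_bounds[of a b n y] bump_eq_0[of y a b n] by (auto simp: indicator_def)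

lemma bump_int_integrable: "integrable lborel (\<lambda>y. indicator {a - 1..z} y * bump a b n y)"
proof (rule Bochner_Integration.integrable_bound)
  show "integrable lborel (\<lambda>y. indicator {a<..<b} y :: real)" by (cases "a \<le> b") auto
  show "AE y in lborel. norm (indicator {a - 1..z} y * bump a b n y) \<le> norm (indicator {a<..<b} y :: real)"
  proof (rule AE_I2)
    fix y show "norm (indicator {a - 1..z} y * bump a b n y) \<le> norm (indicator {a<..<b} y :: real)"
      using bump_le_indicator[of a b n y] by (auto simp: indicator_def)
  qed
qed measurable

lemma bump_int_eq_0: "z \<le> a \<Longrightarrow> bump_int a b n z = 0"
  unfolding bump_int_def by (rule integral_eq_zero_AE) (auto simp: indicator_def bump_eq_0)

lemma bump_int_const: "b \<le> z \<Longrightarrow> bump_int a b n z = bump_int a b n b"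
  unfolding bump_int_def by (rule Bochner_Integration.integral_cong) (auto simp: indicator_def bump_eq_0)

lemma bump_int_has_derivative: "(bump_int a b n has_real_derivative bump a b n z) (at z)"
proof (cases "z < a")
  case True
  have "eventually (\<lambda>x. x < a) (nhds z)" using True by (simp add: eventually_nhds) (metis lessThan_iff open_lessThan)
  then show ?thesis using True
    by (subst DERIV_cong_ev[OF refl _ refl, where g = "\<lambda>_. 0"])
       (auto simp: bump_int_eq_0 bump_eq_0 elim!: eventually_mono)
next
  case False
  have eq: "bump_int a b n z = integral {a - 1..z} (bump a b n)" for z
    using bump_int_integrable[of a z b n]
    by (simp add: bump_int_def set_borel_integral_eq_integral(2)[symmetric] set_lebesgue_integral_def set_integrable_def)
  have "((\<lambda>z. integral {a - 1..z} (bump a b n)) has_real_derivative bump a b n z) (at z within {a - 1..z + 1})"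
    using False by (intro integral_has_real_derivative continuous_bump) auto
  then have "(bump_int a b n has_real_derivative bump a b n z) (at z within {a - 1..z + 1})"
    by (simp add: eq[abs_def])
  moreover have "z \<in> interior {a - 1..z + 1}" using False by simp
  ultimately show ?thesis by (simp only: at_within_interior)
qed

lemma bump_int_tendsto:
  assumes "a < b"
  shows "(\<lambda>n. bump_int a b n z) \<longlonglongrightarrow> clamp_int a b z"
proof -
  have "(\<lambda>n. bump_int a b n z) \<longlonglongrightarrow> (LINT y|lborel. indicator {a - 1..z} y * indicator {a<..<b} y)"
    unfolding bump_int_def
  proof (rule integral_dominated_convergence[where w = "indicator {a<..<b}"])
    show "AE y in lborel. (\<lambda>n. indicator {a - 1..z} y * bump a b n y) \<longlonglongrightarrow> indicator {a - 1..z} y * indicator {a<..<b} y"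
      by (intro AE_I2 tendsto_intros bump_tendsto)
    show "AE y in lborel. norm (indicator {a - 1..z} y * bump a b n y) \<le> indicator {a<..<b} y" for n
    proof (rule AE_I2)
      fix y show "norm (indicator {a - 1..z} y * bump a b n y) \<le> indicator {a<..<b} y"
        using bump_le_indicator[of a b n y] by (auto simp: indicator_def)
    qed
  qed (use assms in auto)
  also have "(LINT y|lborel. indicator {a - 1..z} y * indicator {a<..<b} y) = measure lborel ({a - 1..z} \<inter> {a<..<b})"
    by (subst indicator_inter_arith[symmetric]) simp
  also have "{a - 1..z} \<inter> {a<..<b} = (if z \<le> a then {} else if z < b then {a<..z} else {a<..<b})" by auto
  also have "measure lborel \<dots> = clamp_int a b z" using assms by (simp add: clamp_int_def)
  finally show ?thesis .
qed

lemma bump_int_bounds: "a < b \<Longrightarrow> \<bar>bump_int a b n z\<bar> \<le> b - a"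
proof -
  assume ab: "a < b"
  have "bump_int a b n z \<le> (LINT y|lborel. indicator {a<..<b} y)"
    unfolding bump_int_def
  proof (rule integral_mono[OF bump_int_integrable])
    fix y show "indicator {a - 1..z} y * bump a b n y \<le> indicator {a<..<b} y"
      using bump_le_indicator[of a b n y] by (auto simp: indicator_def)
  qed (use ab in auto)
  moreover have "0 \<le> bump_int a b n z" unfolding bump_int_def
    by (intro integral_nonneg_AE AE_I2 mult_nonneg_nonneg bump_bounds) auto
  ultimately show ?thesis using ab by simp
qed

text \<open>The kernel that compares the integrals over two cubes shifted against each other by \<open>t\<close>
  in direction \<open>i\<close>.\<close>

definition shift_kernel :: "3 \<Rightarrow> real \<Rightarrow> real ^ 3 \<Rightarrow> real ^ 3 \<Rightarrow> real ^ 3 \<Rightarrow> real" where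
  "shift_kernel i t a b z =
     (\<Prod>j\<in>UNIV. ((\<lambda>j. indicator {a $ j<..<b $ j})(i := \<lambda>s. clamp_int (a $ i) (b $ i) s - clamp_int (a $ i) (b $ i) (s - t))) j (z $ j))"

lemma prod_upd_split:
  fixes m :: "3 \<Rightarrow> real \<Rightarrow> real"
  shows "(\<Prod>j\<in>UNIV. (m(i := f)) j (z $ j)) = f (z $ i) * (\<Prod>j\<in>UNIV-{i}. m j (z $ j))"
  by (subst prod.remove[of _ i]) auto

lemma box_prod_split:
  fixes a b z :: "real ^ 3"
  shows "indicator (box a b) z = (indicator {a $ i<..<b $ i} (z $ i) :: real) * (\<Prod>j\<in>UNIV-{i}. indicator {a $ j<..<b $ j} (z $ j))"
  unfolding indicator_box_prod by (subst prod.remove[of _ i]) auto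

lemma abs_prod_le1: "(\<And>j. j \<in> J \<Longrightarrow> \<bar>f j :: real\<bar> \<le> 1) \<Longrightarrow> \<bar>\<Prod>j\<in>J. f j\<bar> \<le> 1"
  by (simp add: abs_prod prod_le_1)

lemma prod_bound_by_box:
  fixes m :: "3 \<Rightarrow> real \<Rightarrow> real"
  assumes "\<And>j s. j \<noteq> i \<Longrightarrow> \<bar>m j s\<bar> \<le> 1" "\<And>s. \<bar>m i s\<bar> \<le> C" "\<And>j s. m j s \<noteq> 0 \<Longrightarrow> c $ j \<le> s \<and> s \<le> d $ j"
  shows "\<bar>\<Prod>j\<in>UNIV. m j (z $ j)\<bar> \<le> C * indicator (cbox c d) z"
proof (cases "z \<in> cbox c d")
  case True
  have C: "0 \<le> C" using assms(2)[of 0] by linarith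
  have "\<bar>m i (z $ i) * (\<Prod>j\<in>UNIV-{i}. m j (z $ j))\<bar> \<le> C * 1"
    unfolding abs_mult using assms C by (intro mult_mono abs_prod_le1) auto
  then show ?thesis using True by (subst prod.remove[of _ i]) auto
next
  case False
  then obtain j where "\<not> (c $ j \<le> z $ j \<and> z $ j \<le> d $ j)" by (auto simp: mem_box_cart)
  then have "m j (z $ j) = 0" using assms(3)[of j "z $ j"] by blast
  then have "(\<Prod>j\<in>UNIV. m j (z $ j)) = 0" by (intro prod_zero bexI[of _ j]) auto
  then show ?thesis using False by simp
qed

text \<open>Test with products of bumps in the directions other than \<open>i\<close> and of a difference of
  antiderivatives of bumps in direction \<open>i\<close>; the latter has compact support because the two
  shifted bumps have the same integral.\<close>

lemma cube_integral_shift: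
  assumes w: "has_weak_gradient u g" and h: "h > 0"
  shows "cube_integral h u (x + t *\<^sub>R axis i 1) - cube_integral h u x
     = (LINT z|lebesgue. (g z $ i) * shift_kernel i t x (x + h *\<^sub>R One) z)"
proof -
  define b where "b = x + h *\<^sub>R One"
  have xb: "x $ j < b $ j" for j using h by (simp add: b_def)
  define m where "m n = (\<lambda>j. bump (x $ j) (b $ j) n)(i := \<lambda>s. bump_int (x $ i) (b $ i) n s - bump_int (x $ i) (b $ i) n (s - t))" for n
  define m' where "m' n = (\<lambda>j. bump (x $ j) (b $ j) n)(i := \<lambda>s. bump (x $ i) (b $ i) n s - bump (x $ i) (b $ i) n (s - t))" for n
  define \<psi> where "\<psi> n z = (\<Prod>j\<in>UNIV. m n j (z $ j))" for n z
  define c where "c = x - \<bar>t\<bar> *\<^sub>R One"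
  define d where "d = b + \<bar>t\<bar> *\<^sub>R One"
  have u: "locally_integrable u" and g: "locally_integrable (\<lambda>z. g z $ i)"
    using has_weak_gradientD[OF w] locally_integrable_component by auto
  have um: "u \<in> borel_measurable lebesgue" and gm: "(\<lambda>z. g z $ i) \<in> borel_measurable lebesgue"
    using u g by (auto intro: locally_integrable_measurable)
  have sm: "smooth (m n j)" for n j
  proof (cases "j = i")
    case True
    have "smooth (bump_int (x $ i) (b $ i) n)"
      by (rule smooth_antiderivative[OF bump_int_has_derivative smooth_bump])
    from smooth_add[OF this smooth_mult[OF smooth_const[of "-1"] smooth_affine[OF this, of 1 "-t"]]]
    show ?thesis using True by (simp add: m_def)
  qed (auto simp: m_def smooth_bump)
  have dm: "(m n j has_real_derivative (if j = i then m' n i s else 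
      (SOME f'. \<forall>s. (bump (x $ j) (b $ j) n has_real_derivative f' s) (at s)) s)) (at s)" for n j s
  proof (cases "j = i")
    case True
    have "((\<lambda>s. bump_int (x $ i) (b $ i) n (s - t)) has_real_derivative bump (x $ i) (b $ i) n (s - t)) (at s)"
      using DERIV_shift[of "bump_int (x $ i) (b $ i) n" _ s "-t"]
        bump_int_has_derivative[of "x $ i" "b $ i" n "s - t"] by simp
    then show ?thesis using True bump_int_has_derivative[of "x $ i" "b $ i" n s]
      by (auto simp: m_def m'_def intro!: DERIV_diff)
  next
    case False
    have "\<exists>f'. \<forall>s. (bump (x $ j) (b $ j) n has_real_derivative f' s) (at s)"
      using smooth_derivative[OF smooth_bump[of "x $ j" "b $ j" n]] by blast
    from someI_ex[OF this] show ?thesis using False by (simp add: m_def)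
  qed
  have supp: "c $ j \<le> s \<and> s \<le> d $ j" if "m n j s \<noteq> 0" for n j s
  proof (rule ccontr)
    assume "\<not> ?thesis"
    then have "s < x $ j - \<bar>t\<bar> \<or> b $ j + \<bar>t\<bar> < s" by (auto simp: c_def d_def)
    moreover from this have "s \<le> x $ j \<or> b $ j \<le> s" by linarith
    ultimately have "m n j s = 0"
      using bump_int_eq_0[of s "x $ i" "b $ i" n] bump_int_eq_0[of "s - t" "x $ i" "b $ i" n]
        bump_int_const[of "b $ i" s "x $ i" n] bump_int_const[of "b $ i" "s - t" "x $ i" n]
        bump_eq_0[of s "x $ j" "b $ j" n]
      by (cases "j = i") (auto simp: m_def)
    with that show False by simp
  qed
  have supp': "c $ j \<le> s \<and> s \<le> d $ j" if "m' n j s \<noteq> 0" for n j s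
  proof (rule ccontr)
    assume "\<not> ?thesis"
    then have "s < x $ j - \<bar>t\<bar> \<or> b $ j + \<bar>t\<bar> < s" by (auto simp: c_def d_def)
    then have "s \<le> x $ j \<or> b $ j \<le> s" "s - t \<le> x $ j \<or> b $ j \<le> s - t" by linarith+
    then have "m' n j s = 0"
      using bump_eq_0[of s "x $ j" "b $ j" n] bump_eq_0[of "s - t" "x $ i" "b $ i" n]
      by (cases "j = i") (auto simp: m'_def)
    with that show False by simp
  qed
  have test: "test_function (\<psi> n)" for n
    unfolding \<psi>_def using sm supp by (intro test_function_prod)
  have pd: "partial_deriv i (\<psi> n) z = (\<Prod>j\<in>UNIV. m' n j (z $ j))" for n z
    unfolding \<psi>_def by (subst partial_deriv_prod(2)[OF dm]) (auto simp: m_def m'_def fun_upd_def intro!: prod.cong)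
  have meas: "\<psi> n \<in> borel_measurable lebesgue" "partial_deriv i (\<psi> n) \<in> borel_measurable lebesgue" for n
    using test_function_bounded_support[OF test] test_function_bounded_support[OF test_function_partial_deriv[OF test]]
    by blast+
  have mb: "\<bar>m n j s\<bar> \<le> 1" "\<bar>m' n j s\<bar> \<le> 1" if "j \<noteq> i" for n j s
    using that bump_bounds[of "x $ j" "b $ j" n s] by (auto simp: m_def m'_def)
  have mi: "\<bar>m n i s\<bar> \<le> 2 * h" for n s
    using bump_int_bounds[OF xb, of i n s] bump_int_bounds[OF xb, of i n "s - t"]
    by (auto simp: m_def b_def)
  have mi': "\<bar>m' n i s\<bar> \<le> 1" for n s
    using bump_bounds[of "x $ i" "b $ i" n s] bump_bounds[of "x $ i" "b $ i" n "s-t"] by (auto simp: m'_def)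
  have intg: "integrable lebesgue (\<lambda>z. C * norm (indicator (cbox c d) z *\<^sub>R f z))"
    if "locally_integrable f" for C and f :: "real ^ 3 \<Rightarrow> real"
    using integrable_norm[OF locally_integrable_cbox[OF that]] by simp
  have L1: "(\<lambda>n. LINT z|lebesgue. u z * partial_deriv i (\<psi> n) z) \<longlonglongrightarrow>
      (LINT z|lebesgue. u z * (indicator (box x b) z - indicator (box (x + t *\<^sub>R axis i 1) (b + t *\<^sub>R axis i 1)) z))"
  proof (rule integral_dominated_convergence[where w = "\<lambda>z. 1 * norm (indicator (cbox c d) z *\<^sub>R u z)"])
    show "AE z in lebesgue. (\<lambda>n. u z * partial_deriv i (\<psi> n) z) \<longlonglongrightarrow>
       u z * (indicator (box x b) z - indicator (box (x + t *\<^sub>R axis i 1) (b + t *\<^sub>R axis i 1)) z)"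
    proof (intro AE_I2 tendsto_mult tendsto_const)
      fix z
      let ?P = "\<Prod>j\<in>UNIV-{i}. indicator {x $ j<..<b $ j} (z $ j) :: real"
      have "(\<lambda>n. (bump (x $ i) (b $ i) n (z $ i) - bump (x $ i) (b $ i) n (z $ i - t)) * (\<Prod>j\<in>UNIV-{i}. bump (x $ j) (b $ j) n (z $ j)))
         \<longlonglongrightarrow> (indicator {x $ i<..<b $ i} (z $ i) - indicator {x $ i<..<b $ i} (z $ i - t)) * ?P"
        by (intro tendsto_intros bump_tendsto)
      also have "(indicator {x $ i<..<b $ i} (z $ i) - indicator {x $ i<..<b $ i} (z $ i - t)) * ?P
         = indicator (box x b) z - indicator (box (x + t *\<^sub>R axis i 1) (b + t *\<^sub>R axis i 1)) z"
      proof -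
        have "(\<Prod>j\<in>UNIV-{i}. indicator {(x + t *\<^sub>R axis i 1) $ j<..<(b + t *\<^sub>R axis i 1) $ j} (z $ j) :: real) = ?P"
          by (intro prod.cong) (auto simp: axis_def)
        moreover have "indicator {x $ i<..<b $ i} (z $ i - t) = (indicator {(x + t *\<^sub>R axis i 1) $ i<..<(b + t *\<^sub>R axis i 1) $ i} (z $ i) :: real)"
          by (auto simp: axis_def indicator_def)
        ultimately show ?thesis
          by (simp only: box_prod_split[of _ _ z i] left_diff_distrib)
      qed
      finally show "(\<lambda>n. partial_deriv i (\<psi> n) z) \<longlonglongrightarrow> indicator (box x b) z - indicator (box (x + t *\<^sub>R axis i 1) (b + t *\<^sub>R axis i 1)) z"
        unfolding pd m'_def prod_upd_split .
    qed
    show "AE z in lebesgue. norm (u z * partial_deriv i (\<psi> n) z) \<le> 1 * norm (indicator (cbox c d) z *\<^sub>R u z)" for n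
    proof (rule AE_I2)
      fix z
      have "\<bar>partial_deriv i (\<psi> n) z\<bar> \<le> 1 * indicator (cbox c d) z"
        unfolding pd by (rule prod_bound_by_box[where i = i]) (use mb mi' supp' in auto)
      from mult_left_mono[OF this, of "\<bar>u z\<bar>"]
      show "norm (u z * partial_deriv i (\<psi> n) z) \<le> 1 * norm (indicator (cbox c d) z *\<^sub>R u z)"
        by (simp add: abs_mult mult_ac)
    qed
  qed (use um meas intg[OF u] in \<open>auto intro!: borel_measurable_times borel_measurable_diff borel_measurable_indicator\<close>)
  have L2: "(\<lambda>n. LINT z|lebesgue. (g z $ i) * \<psi> n z) \<longlonglongrightarrow> (LINT z|lebesgue. (g z $ i) * shift_kernel i t x b z)"
  proof (rule integral_dominated_convergence[where w = "\<lambda>z. (2 * h) * norm (indicator (cbox c d) z *\<^sub>R (g z $ i))"])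
    show *: "AE z in lebesgue. (\<lambda>n. (g z $ i) * \<psi> n z) \<longlonglongrightarrow> (g z $ i) * shift_kernel i t x b z"
      unfolding shift_kernel_def \<psi>_def m_def prod_upd_split
      by (intro AE_I2 tendsto_intros bump_int_tendsto bump_tendsto xb)
    show "AE z in lebesgue. norm ((g z $ i) * \<psi> n z) \<le> (2 * h) * norm (indicator (cbox c d) z *\<^sub>R (g z $ i))" for n
    proof (rule AE_I2)
      fix z
      have "\<bar>\<psi> n z\<bar> \<le> (2 * h) * indicator (cbox c d) z"
        unfolding \<psi>_def by (rule prod_bound_by_box[where i = i]) (use mb mi supp in auto)
      from mult_left_mono[OF this, of "\<bar>g z $ i\<bar>"]
      show "norm ((g z $ i) * \<psi> n z) \<le> (2 * h) * norm (indicator (cbox c d) z *\<^sub>R (g z $ i))"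
        by (simp add: abs_mult mult_ac)
    qed
    have "(\<lambda>z. shift_kernel i t x b z) \<in> borel_measurable lebesgue"
    proof (rule borel_measurable_LIMSEQ_real)
      show "(\<lambda>n. \<psi> n z) \<longlonglongrightarrow> shift_kernel i t x b z" for z
        unfolding shift_kernel_def \<psi>_def m_def prod_upd_split
        by (intro tendsto_intros bump_int_tendsto bump_tendsto xb)
    qed (rule meas)
    then show "(\<lambda>z. (g z $ i) * shift_kernel i t x b z) \<in> borel_measurable lebesgue"
      using gm by (intro borel_measurable_times)
  qed (use gm meas intg[OF g] in \<open>auto intro!: borel_measurable_times\<close>)
  have "(\<lambda>n. LINT z|lebesgue. u z * partial_deriv i (\<psi> n) z) \<longlonglongrightarrow> - (LINT z|lebesgue. (g z $ i) * shift_kernel i t x b z)"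
    using tendsto_minus[OF L2] has_weak_gradientD(3)[OF w test] by simp
  with L1 have "(LINT z|lebesgue. u z * (indicator (box x b) z - indicator (box (x + t *\<^sub>R axis i 1) (b + t *\<^sub>R axis i 1)) z))
      = - (LINT z|lebesgue. (g z $ i) * shift_kernel i t x b z)"
    using LIMSEQ_unique by blast
  moreover have "(LINT z|lebesgue. u z * (indicator (box x b) z - indicator (box (x + t *\<^sub>R axis i 1) (b + t *\<^sub>R axis i 1)) z))
     = cube_integral h u x - cube_integral h u (x + t *\<^sub>R axis i 1)"
  proof -
    have "b + t *\<^sub>R axis i 1 = x + t *\<^sub>R axis i 1 + h *\<^sub>R One" by (simp add: b_def)
    then show ?thesis
      using integrable_indicator_box[OF u, of x b] integrable_indicator_box[OF u, of "x + t *\<^sub>R axis i 1" "b + t *\<^sub>R axis i 1"]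
      by (simp add: cube_integral_def b_def right_diff_distrib mult.commute add.assoc add.commute[of "h *\<^sub>R One"])
  qed
  ultimately show ?thesis by (simp add: b_def)
qed

text \<open>The shift kernel divided by \<open>t\<close> involves difference quotients of the clamping function. These are bounded
  by one, and as \<open>t\<close> tends to zero they converge to the indicator except on the two hyperplanes that
  contain the faces of the cube orthogonal to direction \<open>i\<close>.\<close>

lemma cube_integral_derivative:
  assumes w: "has_weak_gradient u g" and h: "h > 0"
  shows "((\<lambda>t. cube_integral h u (x + t *\<^sub>R axis i 1)) has_real_derivative cube_integral h (\<lambda>z. g z $ i) (x + s *\<^sub>R axis i 1)) (at s)"
proof -
  have g: "locally_integrable (\<lambda>z. g z $ i)"
    using has_weak_gradientD[OF w] locally_integrable_component by auto
  have gm: "(\<lambda>z. g z $ i) \<in> borel_measurable lebesgue"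
    using g by (rule locally_integrable_measurable)
  define y where "y = x + s *\<^sub>R axis i 1"
  define b where "b = y + h *\<^sub>R One"
  have yb: "y $ j < b $ j" for j using h by (simp add: b_def)
  have "((\<lambda>t. (cube_integral h u (y + t *\<^sub>R axis i 1) - cube_integral h u y) / t) \<longlongrightarrow> cube_integral h (\<lambda>z. g z $ i) y) (at 0)"
    unfolding tendsto_at_iff_sequentially comp_def
  proof (intro allI impI)
    fix T :: "nat \<Rightarrow> real" assume T0: "\<forall>n. T n \<in> UNIV - {0}" and T: "T \<longlonglongrightarrow> 0"
    have "Bseq T" using T by (intro convergent_imp_Bseq convergentI)
    then obtain M where M: "\<And>n. \<bar>T n\<bar> \<le> M" by (auto simp: Bseq_def)
    define c where "c = y - M *\<^sub>R One"
    define d where "d = b + M *\<^sub>R One"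
    define m where "m n = (\<lambda>j. indicator {y $ j<..<b $ j})(i := \<lambda>s. (clamp_int (y $ i) (b $ i) s - clamp_int (y $ i) (b $ i) (s - T n)) / T n)" for n
    have eq: "shift_kernel i (T n) y b z / T n = (\<Prod>j\<in>UNIV. m n j (z $ j))" for n z
      unfolding shift_kernel_def m_def prod_upd_split by simp
    have lim: "(\<lambda>n. \<Prod>j\<in>UNIV. m n j (z $ j)) \<longlonglongrightarrow> indicator (box y b) z" if z: "z $ i \<noteq> y $ i" "z $ i \<noteq> b $ i" for z
    proof -
      have "(\<lambda>n. (clamp_int (y $ i) (b $ i) (z $ i) - clamp_int (y $ i) (b $ i) (z $ i - T n)) / T n) \<longlonglongrightarrow> indicator {y $ i<..<b $ i} (z $ i)"
      proof (rule tendsto_eventually)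
        define \<delta> where "\<delta> = min \<bar>z $ i - y $ i\<bar> \<bar>z $ i - b $ i\<bar>"
        have "\<delta> > 0" using z by (simp add: \<delta>_def)
        from T this have "eventually (\<lambda>n. \<bar>T n\<bar> < \<delta>) sequentially"
          by (auto simp: tendsto_iff dist_real_def)
        then show "\<forall>\<^sub>F n in sequentially. (clamp_int (y $ i) (b $ i) (z $ i) - clamp_int (y $ i) (b $ i) (z $ i - T n)) / T n = indicator {y $ i<..<b $ i} (z $ i)"
        proof eventually_elim
          case (elim n)
          have t: "T n \<noteq> 0" using T0 by auto
          from elim yb[of i] z have "clamp_int (y $ i) (b $ i) (z $ i) - clamp_int (y $ i) (b $ i) (z $ i - T n) = T n * indicator {y $ i<..<b $ i} (z $ i)"
            by (auto simp: clamp_int_def \<delta>_def indicator_def abs_if max_def min_def split: if_splits)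
          then show ?case using t by simp
        qed
      qed
      then show ?thesis
        unfolding m_def prod_upd_split box_prod_split[of _ _ z i] by (intro tendsto_intros)
    qed
    define N where "N = {z. z \<bullet> axis i 1 = y $ i} \<union> {z :: real ^ 3. z \<bullet> axis i 1 = b $ i}"
    have "negligible N" unfolding N_def
      by (intro negligible_Un negligible_standard_hyperplane) (auto simp: axis_in_Basis_iff)
    then have N: "N \<in> null_sets lebesgue" by (simp add: negligible_iff_null_sets)
    have aelim: "AE z in lebesgue. (\<lambda>n. \<Prod>j\<in>UNIV. m n j (z $ j)) \<longlonglongrightarrow> indicator (box y b) z"
      by (rule AE_I'[OF N]) (use lim in \<open>auto simp: N_def inner_axis\<close>)
    have mm: "(\<lambda>z. \<Prod>j\<in>UNIV. m n j (z $ j)) \<in> borel_measurable lebesgue" for n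
    proof -
      have "m n j \<in> borel_measurable borel" for j
        by (auto simp: m_def clamp_int_def)
      then have "(\<lambda>z :: real ^ 3. m n j (z $ j)) \<in> borel_measurable borel" for j
        by (rule measurable_compose[rotated]) simp
      then have "(\<lambda>z. \<Prod>j\<in>UNIV. m n j (z $ j)) \<in> borel_measurable borel" by measurable
      then show ?thesis by (simp add: measurable_completion)
    qed
    have "(\<lambda>n. LINT z|lebesgue. (g z $ i) * (\<Prod>j\<in>UNIV. m n j (z $ j))) \<longlonglongrightarrow> (LINT z|lebesgue. (g z $ i) * indicator (box y b) z)"
    proof (rule integral_dominated_convergence[where w = "\<lambda>z. norm (indicator (cbox c d) z *\<^sub>R (g z $ i))"])
      show "integrable lebesgue (\<lambda>z. norm (indicator (cbox c d) z *\<^sub>R (g z $ i)))"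
        using locally_integrable_cbox[OF g] by (rule integrable_norm)
      show "AE z in lebesgue. (\<lambda>n. (g z $ i) * (\<Prod>j\<in>UNIV. m n j (z $ j))) \<longlonglongrightarrow> (g z $ i) * indicator (box y b) z"
        using aelim by eventually_elim (intro tendsto_intros)
      show "AE z in lebesgue. norm ((g z $ i) * (\<Prod>j\<in>UNIV. m n j (z $ j))) \<le> norm (indicator (cbox c d) z *\<^sub>R (g z $ i))" for n
      proof (rule AE_I2)
        fix z
        have t: "T n \<noteq> 0" using T0 by auto
        have "\<bar>\<Prod>j\<in>UNIV. m n j (z $ j)\<bar> \<le> 1 * indicator (cbox c d) z"
        proof (rule prod_bound_by_box[where i = i])
          show "\<bar>m n j r\<bar> \<le> 1" if "j \<noteq> i" for j r using that by (simp add: m_def)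
          have "\<bar>clamp_int (y $ i) (b $ i) r - clamp_int (y $ i) (b $ i) (r - T n)\<bar> \<le> \<bar>T n\<bar>" for r
            by (auto simp: clamp_int_def)
          then show "\<bar>m n i r\<bar> \<le> 1" for r using t by (simp add: m_def divide_simps)
          show "c $ j \<le> r \<and> r \<le> d $ j" if "m n j r \<noteq> 0" for j r
          proof (rule ccontr)
            assume "\<not> ?thesis"
            then have "r < y $ j - M \<or> b $ j + M < r" by (auto simp: c_def d_def)
            then have "m n j r = 0" using M[of n] yb[of j]
              by (cases "j = i") (auto simp: m_def clamp_int_def indicator_def)
            with that show False by simp
          qed
        qed
        from mult_left_mono[OF this, of "\<bar>g z $ i\<bar>"]
        show "norm ((g z $ i) * (\<Prod>j\<in>UNIV. m n j (z $ j))) \<le> norm (indicator (cbox c d) z *\<^sub>R (g z $ i))"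
          by (simp add: abs_mult mult_ac)
      qed
    qed (use gm mm in \<open>auto intro!: borel_measurable_times borel_measurable_indicator\<close>)
    moreover have "(cube_integral h u (y + T n *\<^sub>R axis i 1) - cube_integral h u y) / T n
       = (LINT z|lebesgue. (g z $ i) * (\<Prod>j\<in>UNIV. m n j (z $ j)))" for n
      unfolding cube_integral_shift[OF w h] by (simp add: eq[symmetric] b_def)
    ultimately show "(\<lambda>n. (cube_integral h u (y + T n *\<^sub>R axis i 1) - cube_integral h u y) / T n) \<longlonglongrightarrow> cube_integral h (\<lambda>z. g z $ i) y"
      by (simp add: cube_integral_def b_def mult.commute)
  qed
  then show ?thesis
    by (simp add: DERIV_def y_def algebra_simps)
qed

section \<open>Integration over coordinate lines\<close>

definition vec3 :: "real \<Rightarrow> real \<Rightarrow> real \<Rightarrow> real ^ 3" where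
  "vec3 x y z = x *\<^sub>R axis 1 1 + y *\<^sub>R axis 2 1 + z *\<^sub>R axis 3 1"

lemma vec3_nth [simp]: "vec3 x y z $ 1 = x" "vec3 x y z $ 2 = y" "vec3 x y z $ 3 = z"
  by (simp_all add: vec3_def axis_def)

lemma vec3_line [simp]:
  "vec3 x y z + s *\<^sub>R axis 1 1 = vec3 (x + s) y z"
  "vec3 x y z + s *\<^sub>R axis 2 1 = vec3 x (y + s) z"
  "vec3 x y z + s *\<^sub>R axis 3 1 = vec3 x y (z + s)"
  by (simp_all add: vec3_def algebra_simps)

lemma vec3_measurable [measurable]:
  assumes [measurable]: "f \<in> borel_measurable M" "g \<in> borel_measurable M" "h \<in> borel_measurable M"
  shows "(\<lambda>p. vec3 (f p) (g p) (h p)) \<in> borel_measurable M"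
  unfolding vec3_def by measurable

lemma lborel_vec3: "distr (lborel \<Otimes>\<^sub>M (lborel \<Otimes>\<^sub>M lborel)) borel (\<lambda>(x, y, z). vec3 x y z) = lborel"
proof (rule lborel_eqI[symmetric])
  fix l u :: "real ^ 3" assume le: "\<And>b. b \<in> Basis \<Longrightarrow> l \<bullet> b \<le> u \<bullet> b"
  have le': "l $ j \<le> u $ j" for j
    using le[of "axis j 1"] by (simp add: inner_axis axis_in_Basis_iff)
  have "(\<lambda>(x, y, z). vec3 x y z) -` box l u \<inter> space (lborel \<Otimes>\<^sub>M (lborel \<Otimes>\<^sub>M lborel))
      = {l $ 1<..<u $ 1} \<times> ({l $ 2<..<u $ 2} \<times> {l $ 3<..<u $ 3})"
    by (auto simp: mem_box_cart forall_3 space_pair_measure)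
  then have "emeasure (distr (lborel \<Otimes>\<^sub>M (lborel \<Otimes>\<^sub>M lborel)) borel (\<lambda>(x, y, z). vec3 x y z)) (box l u)
     = emeasure (lborel \<Otimes>\<^sub>M (lborel \<Otimes>\<^sub>M lborel)) ({l $ 1<..<u $ 1} \<times> ({l $ 2<..<u $ 2} \<times> {l $ 3<..<u $ 3}))"
    by (subst emeasure_distr) auto
  also have "\<dots> = ennreal (u $ 1 - l $ 1) * (ennreal (u $ 2 - l $ 2) * ennreal (u $ 3 - l $ 3))"
  proof -
    have "emeasure (lborel \<Otimes>\<^sub>M (lborel \<Otimes>\<^sub>M lborel)) ({l $ 1<..<u $ 1} \<times> ({l $ 2<..<u $ 2} \<times> {l $ 3<..<u $ 3}))
       = emeasure lborel {l $ 1<..<u $ 1} * emeasure (lborel \<Otimes>\<^sub>M lborel) ({l $ 2<..<u $ 2} \<times> {l $ 3<..<u $ 3})"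
      by (rule sigma_finite_measure.emeasure_pair_measure_Times) (auto simp: lborel_prod sigma_finite_lborel)
    also have "emeasure (lborel \<Otimes>\<^sub>M lborel) ({l $ 2<..<u $ 2} \<times> {l $ 3<..<u $ 3})
       = emeasure lborel {l $ 2<..<u $ 2} * emeasure lborel {l $ 3<..<u $ 3}"
      by (rule lborel.emeasure_pair_measure_Times) auto
    finally show ?thesis using le'[of 1] le'[of 2] le'[of 3] by (simp add: emeasure_lborel_Ioo)
  qed
  also have "\<dots> = ennreal ((u $ 1 - l $ 1) * ((u $ 2 - l $ 2) * (u $ 3 - l $ 3)))"
  proof -
    have "0 \<le> u $ 1 - l $ 1" "0 \<le> u $ 2 - l $ 2" "0 \<le> u $ 3 - l $ 3" using le' by auto
    then show ?thesis by (simp only: ennreal_mult mult_nonneg_nonneg)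
  qed
  also have "(u $ 1 - l $ 1) * ((u $ 2 - l $ 2) * (u $ 3 - l $ 3)) = (\<Prod>j\<in>UNIV. u $ j - l $ j)"
    unfolding UNIV_3 by simp
  also have "(\<Prod>j\<in>UNIV. u $ j - l $ j) = (\<Prod>b\<in>Basis. (u - l) \<bullet> b)"
  proof -
    have B: "Basis = (\<lambda>j. axis j 1 :: real ^ 3) ` UNIV" by (auto simp: Basis_vec_def)
    have inj: "inj (\<lambda>j. axis j 1 :: real ^ 3)" by (auto simp: inj_def axis_eq_axis)
    have "(\<Prod>b\<in>Basis. (u - l) \<bullet> b) = (\<Prod>j\<in>UNIV. (u - l) \<bullet> axis j 1)"
      unfolding B prod.reindex[OF inj] comp_def ..
    then show ?thesis by (simp add: inner_axis)
  qed
  finally show "emeasure (distr (lborel \<Otimes>\<^sub>M (lborel \<Otimes>\<^sub>M lborel)) borel (\<lambda>(x, y, z). vec3 x y z)) (box l u)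
     = ennreal (\<Prod>b\<in>Basis. (u - l) \<bullet> b)" .
qed simp

lemma nn_integral_vec3:
  fixes f :: "real ^ 3 \<Rightarrow> ennreal"
  assumes [measurable]: "f \<in> borel_measurable borel"
  shows "(\<integral>\<^sup>+x. f x \<partial>lborel) = (\<integral>\<^sup>+x. \<integral>\<^sup>+y. \<integral>\<^sup>+z. f (vec3 x y z) \<partial>lborel \<partial>lborel \<partial>lborel)"
proof -
  have "(\<integral>\<^sup>+x. f x \<partial>lborel) = (\<integral>\<^sup>+p. (\<lambda>(x, y, z). f (vec3 x y z)) p \<partial>(lborel \<Otimes>\<^sub>M (lborel \<Otimes>\<^sub>M lborel)))"
    by (subst lborel_vec3[symmetric], subst nn_integral_distr) (simp_all add: case_prod_unfold)
  also have "\<dots> = (\<integral>\<^sup>+x. \<integral>\<^sup>+q. (\<lambda>(x, y, z). f (vec3 x y z)) (x, q) \<partial>(lborel \<Otimes>\<^sub>M lborel) \<partial>lborel)"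
  proof -
    have "sigma_finite_measure (lborel \<Otimes>\<^sub>M lborel :: (real \<times> real) measure)"
      by (simp add: lborel_prod sigma_finite_lborel)
    then show ?thesis by (rule sigma_finite_measure.nn_integral_fst[symmetric]) measurable
  qed
  also have "\<dots> = (\<integral>\<^sup>+x. \<integral>\<^sup>+y. \<integral>\<^sup>+z. f (vec3 x y z) \<partial>lborel \<partial>lborel \<partial>lborel)"
    by (subst lborel.nn_integral_fst[symmetric]) auto
  finally show ?thesis .
qed

lemma nn_integral_swap:
  fixes f :: "'a::euclidean_space \<Rightarrow> 'b::euclidean_space \<Rightarrow> ennreal"
  assumes [measurable]: "case_prod f \<in> borel_measurable (borel \<Otimes>\<^sub>M borel)"
  shows "(\<integral>\<^sup>+x. \<integral>\<^sup>+y. f x y \<partial>lborel \<partial>lborel) = (\<integral>\<^sup>+y. \<integral>\<^sup>+x. f x y \<partial>lborel \<partial>lborel)"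
  using lborel_pair.Fubini'[of f] by simp

text \<open>Apply the Cauchy-Schwarz inequality in the third variable, then in the first two together.\<close>

lemma Loomis_Whitney:
  fixes h1 h2 h3 :: "real \<Rightarrow> real \<Rightarrow> ennreal"
  assumes [measurable]: "case_prod h1 \<in> borel_measurable (borel \<Otimes>\<^sub>M borel)"
    "case_prod h2 \<in> borel_measurable (borel \<Otimes>\<^sub>M borel)" "case_prod h3 \<in> borel_measurable (borel \<Otimes>\<^sub>M borel)"
  shows "(\<integral>\<^sup>+x. \<integral>\<^sup>+y. \<integral>\<^sup>+z. h1 y z * h2 x z * h3 x y \<partial>lborel \<partial>lborel \<partial>lborel)\<^sup>2
    \<le> (\<integral>\<^sup>+y. \<integral>\<^sup>+z. (h1 y z)\<^sup>2 \<partial>lborel \<partial>lborel) * (\<integral>\<^sup>+x. \<integral>\<^sup>+z. (h2 x z)\<^sup>2 \<partial>lborel \<partial>lborel)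
      * (\<integral>\<^sup>+x. \<integral>\<^sup>+y. (h3 x y)\<^sup>2 \<partial>lborel \<partial>lborel)"
proof -
  define k where "k x y = (\<integral>\<^sup>+z. h1 y z * h2 x z \<partial>lborel)" for x y
  define a where "a y = (\<integral>\<^sup>+z. (h1 y z)\<^sup>2 \<partial>lborel)" for y
  define b where "b x = (\<integral>\<^sup>+z. (h2 x z)\<^sup>2 \<partial>lborel)" for x
  have [measurable]: "a \<in> borel_measurable borel" "b \<in> borel_measurable borel"
    "case_prod k \<in> borel_measurable (borel \<Otimes>\<^sub>M borel)"
    unfolding a_def b_def k_def by measurable
  have k: "(k x y)\<^sup>2 \<le> b x * a y" for x y
    using Cauchy_Schwarz_nn_integral[of "h1 y" lborel "h2 x"]
    unfolding k_def a_def b_def by (simp add: mult.commute)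
  have "(\<integral>\<^sup>+x. \<integral>\<^sup>+y. \<integral>\<^sup>+z. h1 y z * h2 x z * h3 x y \<partial>lborel \<partial>lborel \<partial>lborel)
     = (\<integral>\<^sup>+x. \<integral>\<^sup>+y. k x y * h3 x y \<partial>lborel \<partial>lborel)"
    by (simp add: k_def nn_integral_multc)
  also have "\<dots> = (\<integral>\<^sup>+p. case_prod k p * case_prod h3 p \<partial>(lborel \<Otimes>\<^sub>M lborel))"
    by (subst lborel.nn_integral_fst[symmetric]) (auto simp: case_prod_beta)
  also have "\<dots>\<^sup>2 \<le> (\<integral>\<^sup>+p. (case_prod k p)\<^sup>2 \<partial>(lborel \<Otimes>\<^sub>M lborel)) * (\<integral>\<^sup>+p. (case_prod h3 p)\<^sup>2 \<partial>(lborel \<Otimes>\<^sub>M lborel))"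
    by (rule Cauchy_Schwarz_nn_integral) auto
  also have "(\<integral>\<^sup>+p. (case_prod h3 p)\<^sup>2 \<partial>(lborel \<Otimes>\<^sub>M lborel)) = (\<integral>\<^sup>+x. \<integral>\<^sup>+y. (h3 x y)\<^sup>2 \<partial>lborel \<partial>lborel)"
    by (subst lborel.nn_integral_fst[symmetric]) (auto simp: case_prod_beta)
  also have "(\<integral>\<^sup>+p. (case_prod k p)\<^sup>2 \<partial>(lborel \<Otimes>\<^sub>M lborel)) = (\<integral>\<^sup>+x. \<integral>\<^sup>+y. (k x y)\<^sup>2 \<partial>lborel \<partial>lborel)"
    by (subst lborel.nn_integral_fst[symmetric]) (auto simp: case_prod_beta)
  also have "\<dots> \<le> (\<integral>\<^sup>+x. \<integral>\<^sup>+y. b x * a y \<partial>lborel \<partial>lborel)"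
    by (intro nn_integral_mono k)
  also have "\<dots> = integral\<^sup>N lborel a * integral\<^sup>N lborel b"
    by (simp add: nn_integral_cmult nn_integral_multc mult.commute)
  finally show ?thesis
    by (simp add: a_def[symmetric] b_def[symmetric] mult_right_mono)
qed

text \<open>A square root with the value infinity at infinity: integrals over single lines need not
  be finite.\<close>

definition esqrt :: "ennreal \<Rightarrow> ennreal" where
  "esqrt r = (if r = \<infinity> then \<infinity> else ennreal (sqrt (enn2real r)))"

lemma esqrt_measurable [measurable]: "esqrt \<in> borel_measurable borel"
  unfolding esqrt_def by measurable

lemma esqrt_power2: "(esqrt r)\<^sup>2 = r"
proof (cases r)
  case (real x) then show ?thesis by (simp add: esqrt_def ennreal_power)
qed (simp add: esqrt_def)

lemma le_esqrt: "0 \<le> x \<Longrightarrow> ennreal (x\<^sup>2) \<le> r \<Longrightarrow> ennreal x \<le> esqrt r"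
  by (cases r) (auto simp: esqrt_def real_le_rsqrt)

text \<open>On a line on which \<open>f\<close> is in \<open>L\<^sup>6\<close>, the function comes arbitrarily close to zero somewhere;
  integrate the derivative of \<open>f\<^sup>4\<close> from there.\<close>

lemma line_bound:
  fixes f f' :: "real \<Rightarrow> real"
  assumes d: "\<And>s. (f has_real_derivative f' s) (at s)" and c: "continuous_on UNIV f'"
    and fin: "(\<integral>\<^sup>+s. ennreal (f s ^ 6) \<partial>lborel) < \<infinity>"
  shows "ennreal (f x ^ 4) \<le> (\<integral>\<^sup>+s. ennreal (4 * \<bar>f s\<bar> ^ 3 * \<bar>f' s\<bar>) \<partial>lborel)"
proof -
  have cf: "continuous_on UNIV f"
    using d by (auto intro!: continuous_at_imp_continuous_on dest: DERIV_isCont)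
  define F where "F s = 4 * f s ^ 3 * f' s" for s
  have cF: "continuous_on A F" for A
    unfolding F_def using cf c by (auto intro!: continuous_intros intro: continuous_on_subset)
  have dF: "((\<lambda>s. f s ^ 4) has_real_derivative F s) (at s)" for s
    using DERIV_power[OF d, of 4 s] by (simp add: F_def mult_ac)
  have diff: "ennreal \<bar>f b ^ 4 - f a ^ 4\<bar> \<le> (\<integral>\<^sup>+s. ennreal \<bar>F s\<bar> \<partial>lborel)" if "a \<le> b" for a b
  proof -
    have i: "integrable lborel (\<lambda>s. indicator {a..b} s *\<^sub>R F s)"
      using borel_integrable_atLeastAtMost'[OF cF, of a b] by (simp add: set_integrable_def)
    have "f b ^ 4 - f a ^ 4 = (LINT s|lborel. indicator {a..b} s *\<^sub>R F s)"
      by (rule integral_FTC_atLeastAtMost[symmetric, OF that])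
         (use dF cF in \<open>auto simp: has_real_derivative_iff_has_vector_derivative[symmetric] intro: has_field_derivative_at_within\<close>)
    then have "ennreal \<bar>f b ^ 4 - f a ^ 4\<bar> \<le> (\<integral>\<^sup>+s. norm (indicator {a..b} s *\<^sub>R F s) \<partial>lborel)"
      using integral_norm_bound_ennreal[OF i] by simp
    also have "\<dots> \<le> (\<integral>\<^sup>+s. ennreal \<bar>F s\<bar> \<partial>lborel)"
      by (intro nn_integral_mono) (auto simp: indicator_def)
    finally show ?thesis .
  qed
  have eqF: "(\<integral>\<^sup>+s. ennreal (4 * \<bar>f s\<bar> ^ 3 * \<bar>f' s\<bar>) \<partial>lborel) = (\<integral>\<^sup>+s. ennreal \<bar>F s\<bar> \<partial>lborel)"
    by (simp add: F_def abs_mult power_abs)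
  show ?thesis
  proof (cases "(\<integral>\<^sup>+s. ennreal \<bar>F s\<bar> \<partial>lborel)")
    case (real R)
    have "f x ^ 4 \<le> R + e" if "e > 0" for e
    proof -
      have "\<exists>s. f s ^ 4 < e"
      proof (rule ccontr)
        assume "\<nexists>s. f s ^ 4 < e"
        then have ge: "e \<le> \<bar>f s\<bar> ^ 4" for s by (simp add: not_less)
        define r where "r = root 4 e"
        have r: "r > 0" "r ^ 4 = e" using \<open>e > 0\<close> by (auto simp: r_def)
        have "r \<le> \<bar>f s\<bar>" for s
          using ge[of s] r by (metis abs_ge_zero power_mono_iff less_imp_le zero_less_numeral)
        then have "r ^ 6 \<le> f s ^ 6" for s
          using power_mono[of r "\<bar>f s\<bar>" 6] r by simp
        then have "(\<integral>\<^sup>+s. ennreal (r ^ 6) \<partial>(lborel :: real measure)) \<le> (\<integral>\<^sup>+s. ennreal (f s ^ 6) \<partial>lborel)"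
          by (intro nn_integral_mono ennreal_leI)
        moreover have "(\<integral>\<^sup>+s. ennreal (r ^ 6) \<partial>(lborel :: real measure)) = \<infinity>"
          using r by (simp add: ennreal_mult_top)
        ultimately show False using fin by (simp add: top_unique)
      qed
      then obtain s where s: "f s ^ 4 < e" by blast
      have "ennreal \<bar>f x ^ 4 - f s ^ 4\<bar> \<le> ennreal R"
        using diff[of x s] diff[of s x] real by (cases "x \<le> s") (auto simp: abs_minus_commute)
      then have "\<bar>f x ^ 4 - f s ^ 4\<bar> \<le> R" using real by simp
      with s show ?thesis by linarith
    qed
    then have "f x ^ 4 \<le> R" by (rule field_le_epsilon)
    then show ?thesis using real eqF by simp
  qed (simp add: eqF)
qed

text \<open>The Gagliardo-Nirenberg argument: on almost every coordinate line, \<open>v\<^sup>4\<close> is bounded by the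
  line integral of \<open>4 \<bar>v\<bar>\<^sup>3 \<bar>\<partial>\<^sub>i v\<bar>\<close>, which is independent of the \<open>i\<close>-th coordinate; then the
  Loomis-Whitney inequality bounds the integral of \<open>v\<^sup>6\<close>.\<close>

lemma Gagliardo_Nirenberg:
  fixes v :: "real ^ 3 \<Rightarrow> real" and G :: "3 \<Rightarrow> real ^ 3 \<Rightarrow> real"
  assumes cv: "continuous_on UNIV v" and cG: "\<And>i. continuous_on UNIV (G i)"
    and d: "\<And>i x s. ((\<lambda>t. v (x + t *\<^sub>R axis i 1)) has_real_derivative G i (x + s *\<^sub>R axis i 1)) (at s)"
    and fin: "(\<integral>\<^sup>+x. ennreal (v x ^ 6) \<partial>lborel) < \<infinity>"
    and B: "\<And>i. (\<integral>\<^sup>+x. ennreal ((G i x)\<^sup>2) \<partial>lborel) \<le> B"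
  shows "(\<integral>\<^sup>+x. ennreal (v x ^ 6) \<partial>lborel) \<le> 4096 * B ^ 3"
proof -
  have [measurable]: "v \<in> borel_measurable borel" "G i \<in> borel_measurable borel" for i
    using cv cG by (auto intro: borel_measurable_continuous_onI)
  define E where "E = (\<integral>\<^sup>+x. ennreal (v x ^ 6) \<partial>lborel)"
  define q where "q i x = ennreal (4 * \<bar>v x\<bar> ^ 3 * \<bar>G i x\<bar>)" for i x
  have qm [measurable]: "q i \<in> borel_measurable borel" for i unfolding q_def by measurable
  define e where "e x = ennreal (v x ^ 6)" for x
  have em [measurable]: "e \<in> borel_measurable borel" unfolding e_def by measurable
  \<comment> \<open>The value infinity on the exceptional lines makes \<open>v\<^sup>2 \<le> h\<^sub>i\<close> hold at every point.\<close>
  define h1 where "h1 y z = (if (\<integral>\<^sup>+x. e (vec3 x y z) \<partial>lborel) = \<infinity> then \<infinity> else esqrt (\<integral>\<^sup>+x. q 1 (vec3 x y z) \<partial>lborel))" for y z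
  define h2 where "h2 x z = (if (\<integral>\<^sup>+y. e (vec3 x y z) \<partial>lborel) = \<infinity> then \<infinity> else esqrt (\<integral>\<^sup>+y. q 2 (vec3 x y z) \<partial>lborel))" for x z
  define h3 where "h3 x y = (if (\<integral>\<^sup>+z. e (vec3 x y z) \<partial>lborel) = \<infinity> then \<infinity> else esqrt (\<integral>\<^sup>+z. q 3 (vec3 x y z) \<partial>lborel))" for x y
  have hm [measurable]: "case_prod h1 \<in> borel_measurable (borel \<Otimes>\<^sub>M borel)"
    "case_prod h2 \<in> borel_measurable (borel \<Otimes>\<^sub>M borel)" "case_prod h3 \<in> borel_measurable (borel \<Otimes>\<^sub>M borel)"
    unfolding h1_def h2_def h3_def by measurable
  have line: "ennreal ((v x)\<^sup>2) \<le> (if (\<integral>\<^sup>+s. e (p + s *\<^sub>R axis i 1) \<partial>lborel) = \<infinity> then \<infinity>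
       else esqrt (\<integral>\<^sup>+s. q i (p + s *\<^sub>R axis i 1) \<partial>lborel))" if "x = p + t *\<^sub>R axis i 1" for x p t i
  proof (cases "(\<integral>\<^sup>+s. e (p + s *\<^sub>R axis i 1) \<partial>lborel) = \<infinity>")
    case False
    have "continuous_on UNIV (\<lambda>s. G i (p + s *\<^sub>R axis i 1))"
      by (intro continuous_on_compose2[OF cG] continuous_intros) auto
    from line_bound[OF d this, of t] False
    have "ennreal (v x ^ 4) \<le> (\<integral>\<^sup>+s. q i (p + s *\<^sub>R axis i 1) \<partial>lborel)"
      unfolding that e_def q_def by (simp add: top.not_eq_extremum)
    then have "ennreal ((v x)\<^sup>2) \<le> esqrt (\<integral>\<^sup>+s. q i (p + s *\<^sub>R axis i 1) \<partial>lborel)"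
      by (intro le_esqrt) (auto simp flip: power_mult)
    then show ?thesis using False by simp
  qed simp
  have v1: "ennreal ((v (vec3 x y z))\<^sup>2) \<le> h1 y z" for x y z
    using line[of "vec3 x y z" "vec3 0 y z" x 1] by (simp add: h1_def cong: if_cong)
  have v2: "ennreal ((v (vec3 x y z))\<^sup>2) \<le> h2 x z" for x y z
    using line[of "vec3 x y z" "vec3 x 0 z" y 2] by (simp add: h2_def cong: if_cong)
  have v3: "ennreal ((v (vec3 x y z))\<^sup>2) \<le> h3 x y" for x y z
    using line[of "vec3 x y z" "vec3 x y 0" z 3] by (simp add: h3_def cong: if_cong)
  have ev: "e (vec3 x y z) \<le> h1 y z * h2 x z * h3 x y" for x y z
  proof -
    have "e (vec3 x y z) = ennreal ((v (vec3 x y z))\<^sup>2) * ennreal ((v (vec3 x y z))\<^sup>2) * ennreal ((v (vec3 x y z))\<^sup>2)"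
      by (simp add: e_def ennreal_mult[symmetric] flip: power_add)
    also have "\<dots> \<le> h1 y z * h2 x z * h3 x y" by (intro mult_mono v1 v2 v3) auto
    finally show ?thesis .
  qed
  \<comment> \<open>The three orders of integration, each with one coordinate innermost.\<close>
  have o3: "(\<integral>\<^sup>+x. f x \<partial>lborel) = (\<integral>\<^sup>+x. \<integral>\<^sup>+y. \<integral>\<^sup>+z. f (vec3 x y z) \<partial>lborel \<partial>lborel \<partial>lborel)"
    and o2: "(\<integral>\<^sup>+x. f x \<partial>lborel) = (\<integral>\<^sup>+x. \<integral>\<^sup>+z. \<integral>\<^sup>+y. f (vec3 x y z) \<partial>lborel \<partial>lborel \<partial>lborel)"
    and o1: "(\<integral>\<^sup>+x. f x \<partial>lborel) = (\<integral>\<^sup>+y. \<integral>\<^sup>+z. \<integral>\<^sup>+x. f (vec3 x y z) \<partial>lborel \<partial>lborel \<partial>lborel)"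
    if [measurable]: "f \<in> borel_measurable borel" for f :: "real ^ 3 \<Rightarrow> ennreal"
  proof -
    show 3: "(\<integral>\<^sup>+x. f x \<partial>lborel) = (\<integral>\<^sup>+x. \<integral>\<^sup>+y. \<integral>\<^sup>+z. f (vec3 x y z) \<partial>lborel \<partial>lborel \<partial>lborel)"
      by (rule nn_integral_vec3) measurable
    show "(\<integral>\<^sup>+x. f x \<partial>lborel) = (\<integral>\<^sup>+x. \<integral>\<^sup>+z. \<integral>\<^sup>+y. f (vec3 x y z) \<partial>lborel \<partial>lborel \<partial>lborel)"
      unfolding 3 by (intro nn_integral_cong nn_integral_swap) measurable
    have "(\<integral>\<^sup>+x. \<integral>\<^sup>+y. \<integral>\<^sup>+z. f (vec3 x y z) \<partial>lborel \<partial>lborel \<partial>lborel)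
       = (\<integral>\<^sup>+y. \<integral>\<^sup>+x. \<integral>\<^sup>+z. f (vec3 x y z) \<partial>lborel \<partial>lborel \<partial>lborel)"
      by (intro nn_integral_swap) measurable
    also have "\<dots> = (\<integral>\<^sup>+y. \<integral>\<^sup>+z. \<integral>\<^sup>+x. f (vec3 x y z) \<partial>lborel \<partial>lborel \<partial>lborel)"
      by (intro nn_integral_cong nn_integral_swap) measurable
    finally show "(\<integral>\<^sup>+x. f x \<partial>lborel) = (\<integral>\<^sup>+y. \<integral>\<^sup>+z. \<integral>\<^sup>+x. f (vec3 x y z) \<partial>lborel \<partial>lborel \<partial>lborel)"
      unfolding 3 .
  qed
  \<comment> \<open>The lines on which \<open>v\<close> is not in \<open>L\<^sup>6\<close> form a null set.\<close>
  have ae: "(\<integral>\<^sup>+a. \<integral>\<^sup>+b. (if X a b = \<infinity> then \<infinity> else esqrt (Y a b))\<^sup>2 \<partial>lborel \<partial>lborel) = (\<integral>\<^sup>+a. \<integral>\<^sup>+b. Y a b \<partial>lborel \<partial>lborel)"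
    if [measurable]: "case_prod X \<in> borel_measurable (borel \<Otimes>\<^sub>M borel)" "case_prod Y \<in> borel_measurable (borel \<Otimes>\<^sub>M borel)"
      and f: "(\<integral>\<^sup>+a. \<integral>\<^sup>+b. X a b \<partial>lborel \<partial>lborel) \<noteq> \<infinity>" for X Y :: "real \<Rightarrow> real \<Rightarrow> ennreal"
  proof (rule nn_integral_cong_AE)
    have "AE a in lborel. (\<integral>\<^sup>+b. X a b \<partial>lborel) \<noteq> \<infinity>"
      using f by (intro nn_integral_PInf_AE) auto
    then show "AE a in lborel. (\<integral>\<^sup>+b. (if X a b = \<infinity> then \<infinity> else esqrt (Y a b))\<^sup>2 \<partial>lborel) = (\<integral>\<^sup>+b. Y a b \<partial>lborel)"
    proof eventually_elim
      case (elim a)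
      have "AE b in lborel. X a b \<noteq> \<infinity>" using elim by (intro nn_integral_PInf_AE) auto
      then show ?case by (intro nn_integral_cong_AE, eventually_elim) (auto simp: esqrt_power2)
    qed
  qed
  have fin': "(\<integral>\<^sup>+x. e x \<partial>lborel) \<noteq> \<infinity>" using fin by (simp add: e_def)
  have q1: "(\<integral>\<^sup>+y. \<integral>\<^sup>+z. (h1 y z)\<^sup>2 \<partial>lborel \<partial>lborel) = integral\<^sup>N lborel (q 1)"
    unfolding h1_def using fin' by (subst ae) (simp_all add: o1[symmetric])
  have q2: "(\<integral>\<^sup>+y. \<integral>\<^sup>+z. (h2 y z)\<^sup>2 \<partial>lborel \<partial>lborel) = integral\<^sup>N lborel (q 2)"
    unfolding h2_def using fin' by (subst ae) (simp_all add: o2[symmetric])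
  have q3: "(\<integral>\<^sup>+y. \<integral>\<^sup>+z. (h3 y z)\<^sup>2 \<partial>lborel \<partial>lborel) = integral\<^sup>N lborel (q 3)"
    unfolding h3_def using fin' by (subst ae) (simp_all add: o3[symmetric])
  have "E \<le> (\<integral>\<^sup>+x. \<integral>\<^sup>+y. \<integral>\<^sup>+z. h1 y z * h2 x z * h3 x y \<partial>lborel \<partial>lborel \<partial>lborel)"
    unfolding E_def e_def[symmetric] by (subst o3) (auto intro!: nn_integral_mono ev)
  then have "E\<^sup>2 \<le> (\<integral>\<^sup>+x. \<integral>\<^sup>+y. \<integral>\<^sup>+z. h1 y z * h2 x z * h3 x y \<partial>lborel \<partial>lborel \<partial>lborel)\<^sup>2"
    by (rule power_mono) simp
  also have "\<dots> \<le> integral\<^sup>N lborel (q 1) * integral\<^sup>N lborel (q 2) * integral\<^sup>N lborel (q 3)"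
    using Loomis_Whitney[OF hm] unfolding q1 q2 q3 .
  finally have "(E\<^sup>2)\<^sup>2 \<le> (integral\<^sup>N lborel (q 1) * integral\<^sup>N lborel (q 2) * integral\<^sup>N lborel (q 3))\<^sup>2"
    by (rule power_mono) simp
  also have "\<dots> = (integral\<^sup>N lborel (q 1))\<^sup>2 * (integral\<^sup>N lborel (q 2))\<^sup>2 * (integral\<^sup>N lborel (q 3))\<^sup>2"
    by (simp add: power_mult_distrib)
  also have "\<dots> \<le> (16 * E * B) * (16 * E * B) * (16 * E * B)"
  proof -
    have "(integral\<^sup>N lborel (q i))\<^sup>2 \<le> 16 * E * B" for i
    proof -
      have "integral\<^sup>N lborel (q i) = (\<integral>\<^sup>+x. ennreal (4 * \<bar>v x\<bar> ^ 3) * ennreal \<bar>G i x\<bar> \<partial>lborel)"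
        by (intro nn_integral_cong) (simp add: q_def ennreal_mult)
      also have "\<dots>\<^sup>2 \<le> (\<integral>\<^sup>+x. (ennreal (4 * \<bar>v x\<bar> ^ 3))\<^sup>2 \<partial>lborel) * (\<integral>\<^sup>+x. (ennreal \<bar>G i x\<bar>)\<^sup>2 \<partial>lborel)"
        by (rule Cauchy_Schwarz_nn_integral) auto
      also have "(\<integral>\<^sup>+x. (ennreal (4 * \<bar>v x\<bar> ^ 3))\<^sup>2 \<partial>lborel) = (\<integral>\<^sup>+x. 16 * e x \<partial>lborel)"
        by (intro nn_integral_cong) (simp add: ennreal_power power_mult_distrib e_def ennreal_mult flip: power_mult)
      also have "\<dots> = 16 * E" by (simp add: nn_integral_cmult E_def e_def)
      also have "(\<integral>\<^sup>+x. (ennreal \<bar>G i x\<bar>)\<^sup>2 \<partial>lborel) \<le> B"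
        using B[of i] by (simp add: ennreal_power)
      finally show ?thesis by (simp add: mult_left_mono)
    qed
    then show ?thesis by (intro mult_mono) auto
  qed
  also have "\<dots> = 4096 * B ^ 3 * E ^ 3" by (simp add: power3_eq_cube mult_ac)
  finally have *: "E * E ^ 3 \<le> 4096 * B ^ 3 * E ^ 3"
    by (simp add: power2_eq_square power3_eq_cube mult_ac)
  have "E \<noteq> top" using fin by (simp add: E_def)
  show ?thesis
  proof (cases "E = 0")
    case False
    then obtain r where r: "E = ennreal r" "r > 0"
      using \<open>E \<noteq> top\<close> by (cases E) (auto simp: less_le)
    then have nz: "E ^ 3 \<noteq> 0" "E ^ 3 \<noteq> top" by (simp_all add: ennreal_power)
    have "E ^ 3 * E \<le> E ^ 3 * (4096 * B ^ 3)" using * by (simp only: mult.commute)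
    then have "E \<le> 4096 * B ^ 3" using nz by (simp add: ennreal_mult_le_mult_iff)
    then show ?thesis by (simp add: E_def)
  qed (simp add: E_def[symmetric])
qed


section \<open>The Sobolev inequality for weak gradients\<close>

lemma lborel_representative:
  fixes f :: "real ^ 3 \<Rightarrow> ennreal"
  assumes "f \<in> borel_measurable lebesgue"
  obtains f' where "f' \<in> borel_measurable borel" "AE x in lborel. f x = f' x"
  using completion_ex_borel_measurable[OF assms] by auto

lemma power_ge_tangent:
  fixes t m :: real
  assumes "0 \<le> t" "0 \<le> m"
  shows "m ^ n + real n * m ^ (n - 1) * (t - m) \<le> t ^ n"
proof (cases "m = 0 \<or> n = 0")
  case True
  then show ?thesis using assms by (cases n; cases "n = 1") (auto simp: zero_power)
next
  case False
  have "1 + real n * (t / m - 1) \<le> (1 + (t / m - 1)) ^ n"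
    using assms False by (intro Bernoulli_inequality) auto
  then have "m ^ n * (1 + real n * (t / m - 1)) \<le> m ^ n * (t / m) ^ n"
    using assms by (intro mult_left_mono) auto
  moreover have "m ^ n * (t / m) ^ n = t ^ n" using False by (simp add: power_divide)
  moreover have "m ^ n = m * m ^ (n - 1)" using False by (cases n) auto
  ultimately show ?thesis using False by (simp add: field_simps)
qed

lemma measure_cube:
  assumes "h > 0"
  shows "measure lebesgue (box x (x + h *\<^sub>R One) :: (real ^ 3) set) = h ^ 3"
    "emeasure lebesgue (box x (x + h *\<^sub>R One) :: (real ^ 3) set) = ennreal (h ^ 3)"
proof -
  have *: "(\<Prod>b\<in>Basis. (x + h *\<^sub>R One - x) \<bullet> b) = h ^ 3"
    by (simp add: inner_sum_left_Basis)
  have "x \<bullet> b \<le> (x + h *\<^sub>R One) \<bullet> b" if "b \<in> Basis" for b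
    using that assms by (simp add: inner_add_left inner_sum_left_Basis)
  then show "emeasure lebesgue (box x (x + h *\<^sub>R One)) = ennreal (h ^ 3)"
    using * by (simp add: emeasure_lborel_box)
  then show "measure lebesgue (box x (x + h *\<^sub>R One)) = h ^ 3"
    using assms by (simp add: measure_def)
qed

text \<open>Jensen's inequality for the average over a cube, from the tangent to \<open>t \<mapsto> t\<^sup>n\<close> at the average.\<close>

lemma cube_integral_power_le:
  fixes f :: "real ^ 3 \<Rightarrow> real"
  assumes f: "locally_integrable f" and h: "h > 0"
  shows "ennreal (\<bar>cube_integral h f x / h ^ 3\<bar> ^ n)
    \<le> (\<integral>\<^sup>+z. ennreal (\<bar>f z\<bar> ^ n) * indicator (box x (x + h *\<^sub>R One)) z \<partial>lebesgue) / ennreal (h ^ 3)"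
proof -
  let ?B = "box x (x + h *\<^sub>R One)"
  have h3: "h ^ 3 > 0" using h by simp
  have fm: "f \<in> borel_measurable lebesgue" using f by (rule locally_integrable_measurable)
  have i: "integrable lebesgue (\<lambda>z. indicator ?B z *\<^sub>R f z)" by (rule integrable_indicator_box[OF f])
  define m where "m = (LINT z|lebesgue. \<bar>indicator ?B z *\<^sub>R f z\<bar>) / h ^ 3"
  have m0: "m \<ge> 0" using h by (simp add: m_def)
  have "\<bar>cube_integral h f x\<bar> \<le> (LINT z|lebesgue. \<bar>indicator ?B z *\<^sub>R f z\<bar>)"
    unfolding cube_integral_def by (rule integral_abs_bound)
  then have le: "\<bar>cube_integral h f x / h ^ 3\<bar> \<le> m" using h by (simp add: m_def divide_right_mono)
  show ?thesis
  proof (cases "(\<integral>\<^sup>+z. ennreal (\<bar>f z\<bar> ^ n) * indicator ?B z \<partial>lebesgue) = \<infinity>")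
    case True
    then show ?thesis using h by (simp add: ennreal_top_divide)
  next
    case False
    have eq: "ennreal (\<bar>f z\<bar> ^ n) * indicator ?B z = ennreal (\<bar>f z\<bar> ^ n * indicator ?B z)" for z
      by (simp add: indicator_def)
    have i': "integrable lebesgue (\<lambda>z. \<bar>f z\<bar> ^ n * indicator ?B z)"
    proof (rule integrableI_bounded)
      show "(\<lambda>z. \<bar>f z\<bar> ^ n * indicator ?B z) \<in> borel_measurable lebesgue"
        using fm by (auto intro!: borel_measurable_times borel_measurable_indicator borel_measurable_power borel_measurable_abs)
      show "(\<integral>\<^sup>+ z. ennreal (norm (\<bar>f z\<bar> ^ n * indicator ?B z)) \<partial>lebesgue) < \<infinity>"
        using False by (simp add: eq abs_mult top.not_eq_extremum)
    qed
    have ind: "integrable lebesgue (\<lambda>z. indicator ?B z :: real)"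
      using measure_cube(2)[OF h, of x] by (intro integrable_real_indicator) auto
    have iB: "(LINT z|lebesgue. indicator ?B z :: real) = h ^ 3" using measure_cube(1)[OF h, of x] by simp
    let ?c = "real n * m ^ (n - 1)"
    have "m ^ n * h ^ 3 = (LINT z|lebesgue. (m ^ n - ?c * m) * indicator ?B z + ?c * \<bar>indicator ?B z *\<^sub>R f z\<bar>)"
      using i ind iB h by (simp add: m_def field_simps)
    also have "\<dots> \<le> (LINT z|lebesgue. \<bar>f z\<bar> ^ n * indicator ?B z)"
    proof (rule integral_mono)
      show "integrable lebesgue (\<lambda>z. (m ^ n - ?c * m) * indicator ?B z + ?c * \<bar>indicator ?B z *\<^sub>R f z\<bar>)"
        using i ind by (intro Bochner_Integration.integrable_add integrable_mult_right integrable_abs)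
      fix z
      show "(m ^ n - ?c * m) * indicator ?B z + ?c * \<bar>indicator ?B z *\<^sub>R f z\<bar> \<le> \<bar>f z\<bar> ^ n * indicator ?B z"
        using power_ge_tangent[OF abs_ge_zero m0, of n "f z"] by (cases "z \<in> ?B") (auto simp: algebra_simps)
    qed (rule i')
    finally have "ennreal (m ^ n * h ^ 3) \<le> ennreal (LINT z|lebesgue. \<bar>f z\<bar> ^ n * indicator ?B z)"
      by (rule ennreal_leI)
    also have "\<dots> = (\<integral>\<^sup>+z. ennreal (\<bar>f z\<bar> ^ n) * indicator ?B z \<partial>lebesgue)"
      by (subst nn_integral_eq_integral[symmetric]) (auto simp: i' eq)
    finally have *: "ennreal (m ^ n * h ^ 3) \<le> (\<integral>\<^sup>+z. ennreal (\<bar>f z\<bar> ^ n) * indicator ?B z \<partial>lebesgue)" .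
    have "ennreal (\<bar>cube_integral h f x / h ^ 3\<bar> ^ n) \<le> ennreal (m ^ n)"
      using le by (intro ennreal_leI power_mono) auto
    also have "\<dots> = ennreal (m ^ n * h ^ 3) / ennreal (h ^ 3)"
      using h m0 by (subst divide_ennreal) auto
    also have "\<dots> \<le> (\<integral>\<^sup>+z. ennreal (\<bar>f z\<bar> ^ n) * indicator ?B z \<partial>lebesgue) / ennreal (h ^ 3)"
      using * by (rule divide_right_mono_ennreal)
    finally show ?thesis .
  qed
qed

lemma cube_indicator_measurable [measurable]:
  "(\<lambda>p :: (real ^ 3) \<times> (real ^ 3). indicator (box (fst p) (fst p + h *\<^sub>R One)) (snd p) :: ennreal) \<in> borel_measurable (borel \<Otimes>\<^sub>M borel)"
proof -
  have "open (\<Inter>i\<in>UNIV. {p :: (real ^ 3) \<times> (real ^ 3). fst p $ i < snd p $ i} \<inter> {p. snd p $ i < fst p $ i + h})"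
    by (intro open_INT ballI open_Int open_Collect_less continuous_intros) auto
  then have "(\<lambda>p. indicator (\<Inter>i\<in>UNIV. {p :: (real ^ 3) \<times> (real ^ 3). fst p $ i < snd p $ i} \<inter> {p. snd p $ i < fst p $ i + h}) p :: ennreal) \<in> borel_measurable borel"
    by (intro borel_measurable_indicator borel_open)
  moreover have "indicator (box (fst p) (fst p + h *\<^sub>R One)) (snd p)
      = (indicator (\<Inter>i\<in>UNIV. {p :: (real ^ 3) \<times> (real ^ 3). fst p $ i < snd p $ i} \<inter> {p. snd p $ i < fst p $ i + h}) p :: ennreal)" for p :: "(real ^ 3) \<times> (real ^ 3)"
    by (simp add: indicator_def mem_box_cart)
  ultimately show ?thesis by (simp add: borel_prod)
qed

lemma cube_average_Ln:
  fixes f :: "real ^ 3 \<Rightarrow> real"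
  assumes f: "locally_integrable f" and h: "h > 0"
  shows "(\<integral>\<^sup>+x. ennreal (\<bar>cube_integral h f x / h ^ 3\<bar> ^ n) \<partial>lborel) \<le> (\<integral>\<^sup>+x. ennreal (\<bar>f x\<bar> ^ n) \<partial>lebesgue)"
proof -
  have fm: "f \<in> borel_measurable lebesgue" using f by (rule locally_integrable_measurable)
  then have "(\<lambda>x. ennreal (\<bar>f x\<bar> ^ n)) \<in> borel_measurable lebesgue" by measurable
  then obtain F where F [measurable]: "F \<in> borel_measurable borel" and ae: "AE x in lborel. ennreal (\<bar>f x\<bar> ^ n) = F x"
    by (rule lborel_representative)
  have e: "indicator (box x (x + h *\<^sub>R One)) z = (indicator (box (z - h *\<^sub>R One) z) x :: ennreal)" for x z :: "real ^ 3"
  proof -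
    have "z \<in> box x (x + h *\<^sub>R One) \<longleftrightarrow> x \<in> box (z - h *\<^sub>R One) z"
      unfolding mem_box_cart by (intro all_cong1) (auto simp: algebra_simps)
    then show ?thesis by (simp add: indicator_def)
  qed
  have "(\<integral>\<^sup>+x. ennreal (\<bar>cube_integral h f x / h ^ 3\<bar> ^ n) \<partial>lborel)
    \<le> (\<integral>\<^sup>+x. (\<integral>\<^sup>+z. F z * indicator (box x (x + h *\<^sub>R One)) z \<partial>lborel) / ennreal (h ^ 3) \<partial>lborel)"
  proof (rule nn_integral_mono)
    fix x
    have "(\<integral>\<^sup>+z. ennreal (\<bar>f z\<bar> ^ n) * indicator (box x (x + h *\<^sub>R One)) z \<partial>lebesgue)
      = (\<integral>\<^sup>+z. F z * indicator (box x (x + h *\<^sub>R One)) z \<partial>lborel)"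
      unfolding nn_integral_completion using ae by (intro nn_integral_cong_AE) auto
    then show "ennreal (\<bar>cube_integral h f x / h ^ 3\<bar> ^ n)
       \<le> (\<integral>\<^sup>+z. F z * indicator (box x (x + h *\<^sub>R One)) z \<partial>lborel) / ennreal (h ^ 3)"
      using cube_integral_power_le[OF f h, of x n] by simp
  qed
  also have "\<dots> = (\<integral>\<^sup>+x. (\<integral>\<^sup>+z. F z * indicator (box (z - h *\<^sub>R One) z) x \<partial>lborel) \<partial>lborel) / ennreal (h ^ 3)"
  proof -
    show ?thesis unfolding e[symmetric] by (subst nn_integral_divide[symmetric]) measurable
  qed
  also have "(\<integral>\<^sup>+x. (\<integral>\<^sup>+z. F z * indicator (box (z - h *\<^sub>R One) z) x \<partial>lborel) \<partial>lborel)
     = (\<integral>\<^sup>+z. (\<integral>\<^sup>+x. F z * indicator (box (z - h *\<^sub>R One) z) x \<partial>lborel) \<partial>lborel)"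
    unfolding e[symmetric] by (rule nn_integral_swap) measurable
  also have "\<dots> = (\<integral>\<^sup>+z. F z * ennreal (h ^ 3) \<partial>lborel)"
    using measure_cube(2)[OF h, of "_ - h *\<^sub>R One"] by (simp add: nn_integral_cmult_indicator)
  also have "\<dots> / ennreal (h ^ 3) = (\<integral>\<^sup>+z. F z \<partial>lborel)"
    using h by (simp add: nn_integral_multc ennreal_mult_divide_eq)
  also have "\<dots> = (\<integral>\<^sup>+x. ennreal (\<bar>f x\<bar> ^ n) \<partial>lebesgue)"
    unfolding nn_integral_completion using ae by (intro nn_integral_cong_AE) auto
  finally show ?thesis .
qed

text \<open>The averages \<open>u\<^sub>h\<close> over small cubes satisfy the Gagliardo-Nirenberg inequality, with constants
  that do not depend on \<open>h\<close>; if \<open>u\<close> is in \<open>L\<^sup>2\<close>, then \<open>u\<^sub>h\<close> is bounded, hence in \<open>L\<^sup>6\<close> as well.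
  As \<open>u\<^sub>h\<close> converges to \<open>u\<close> almost everywhere, Fatou's lemma gives the claim.\<close>

lemma Sobolev_inequality:
  assumes w: "has_weak_gradient u g"
    and u: "(\<integral>\<^sup>+x. ennreal (u x ^ 2) \<partial>lebesgue) < \<infinity> \<or> (\<integral>\<^sup>+x. ennreal (u x ^ 6) \<partial>lebesgue) < \<infinity>"
  shows "(\<integral>\<^sup>+x. ennreal (u x ^ 6) \<partial>lebesgue) \<le> 4096 * (\<integral>\<^sup>+x. ennreal ((norm (g x))\<^sup>2) \<partial>lebesgue) ^ 3"
proof -
  have ul: "locally_integrable u" and gl: "locally_integrable (\<lambda>z. g z $ i)" for i
    using has_weak_gradientD[OF w] locally_integrable_component by auto
  define B where "B = (\<integral>\<^sup>+x. ennreal ((norm (g x))\<^sup>2) \<partial>lebesgue)"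
  have bound: "(\<integral>\<^sup>+x. ennreal ((cube_integral h u x / h ^ 3) ^ 6) \<partial>lborel) \<le> 4096 * B ^ 3" if h: "h > 0" for h
  proof (rule Gagliardo_Nirenberg[where G = "\<lambda>i x. cube_integral h (\<lambda>z. g z $ i) x / h ^ 3"])
    show "continuous_on UNIV (\<lambda>x. cube_integral h u x / h ^ 3)"
      using h by (intro continuous_intros continuous_cube_integral ul) auto
    show "continuous_on UNIV (\<lambda>x. cube_integral h (\<lambda>z. g z $ i) x / h ^ 3)" for i
      using h by (intro continuous_intros continuous_cube_integral gl) auto
    show "((\<lambda>t. cube_integral h u (x + t *\<^sub>R axis i 1) / h ^ 3) has_real_derivative
           cube_integral h (\<lambda>z. g z $ i) (x + s *\<^sub>R axis i 1) / h ^ 3) (at s)" for i x s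
      by (rule DERIV_cdivide[OF cube_integral_derivative[OF w h]])
    show "(\<integral>\<^sup>+x. ennreal ((cube_integral h (\<lambda>z. g z $ i) x / h ^ 3)\<^sup>2) \<partial>lborel) \<le> B" for i
    proof -
      have "(\<integral>\<^sup>+x. ennreal ((cube_integral h (\<lambda>z. g z $ i) x / h ^ 3)\<^sup>2) \<partial>lborel)
         \<le> (\<integral>\<^sup>+x. ennreal (\<bar>g x $ i\<bar> ^ 2) \<partial>lebesgue)"
        using cube_average_Ln[OF gl h, of i 2] by (simp only: power2_abs)
      also have "\<dots> \<le> B" unfolding B_def
        by (intro nn_integral_mono ennreal_leI power_mono component_le_norm_cart) auto
      finally show ?thesis .
    qed
    have a6: "\<bar>t\<bar> ^ 6 = t ^ 6" for t :: real by simp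
    show "(\<integral>\<^sup>+x. ennreal ((cube_integral h u x / h ^ 3) ^ 6) \<partial>lborel) < \<infinity>"
    proof (cases "(\<integral>\<^sup>+x. ennreal (u x ^ 6) \<partial>lebesgue) < \<infinity>")
      case True
      then show ?thesis using cube_average_Ln[OF ul h, of 6] unfolding a6 by (rule le_less_trans[rotated])
    next
      case False
      then have 2: "(\<integral>\<^sup>+x. ennreal (u x ^ 2) \<partial>lebesgue) < \<infinity>" using u by blast
      define K where "K = (\<integral>\<^sup>+x. ennreal (u x ^ 2) \<partial>lebesgue) / ennreal (h ^ 3)"
      have "K \<noteq> top" using 2 h by (auto simp: K_def ennreal_divide_eq_top_iff)
      then have K: "K < \<infinity>" by (simp add: less_top)
      have b: "ennreal ((cube_integral h u x / h ^ 3)\<^sup>2) \<le> K" for x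
      proof -
        have "ennreal ((cube_integral h u x / h ^ 3)\<^sup>2)
           \<le> (\<integral>\<^sup>+z. ennreal (u z ^ 2) * indicator (box x (x + h *\<^sub>R One)) z \<partial>lebesgue) / ennreal (h ^ 3)"
          using cube_integral_power_le[OF ul h, of x 2] by (simp only: power2_abs)
        also have "\<dots> \<le> K" unfolding K_def
          by (intro divide_right_mono_ennreal nn_integral_mono) (auto simp: indicator_def)
        finally show ?thesis .
      qed
      have "(\<integral>\<^sup>+x. ennreal ((cube_integral h u x / h ^ 3) ^ 6) \<partial>lborel)
         \<le> (\<integral>\<^sup>+x. K * K * ennreal ((cube_integral h u x / h ^ 3)\<^sup>2) \<partial>lborel)"
      proof (rule nn_integral_mono)
        fix x
        have "ennreal ((cube_integral h u x / h ^ 3) ^ 6) = ennreal ((cube_integral h u x / h ^ 3)\<^sup>2)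
            * ennreal ((cube_integral h u x / h ^ 3)\<^sup>2) * ennreal ((cube_integral h u x / h ^ 3)\<^sup>2)"
          by (subst ennreal_mult[symmetric] | simp flip: power_add)+
        also have "\<dots> \<le> K * K * ennreal ((cube_integral h u x / h ^ 3)\<^sup>2)"
          by (intro mult_mono b) auto
        finally show "ennreal ((cube_integral h u x / h ^ 3) ^ 6) \<le> K * K * ennreal ((cube_integral h u x / h ^ 3)\<^sup>2)" .
      qed
      also have "\<dots> = K * K * (\<integral>\<^sup>+x. ennreal ((cube_integral h u x / h ^ 3)\<^sup>2) \<partial>lborel)"
        using continuous_cube_integral[OF ul, of h] h
        by (intro nn_integral_cmult) (auto intro!: continuous_intros borel_measurable_continuous_onI borel_measurable_power borel_measurable_divide measurable_compose[OF _ measurable_ennreal])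
      also have "\<dots> \<le> K * K * (\<integral>\<^sup>+x. ennreal (u x ^ 2) \<partial>lebesgue)"
        using cube_average_Ln[OF ul h, of 2] by (intro mult_left_mono) (simp_all only: power2_abs zero_le)
      also have "\<dots> < \<infinity>" using K 2 by (simp add: ennreal_mult_less_top)
      finally show ?thesis .
    qed
  qed
  define t where "t n = inverse (real (Suc n))" for n
  have t: "filterlim t (at_right 0) sequentially"
    unfolding t_def by (intro tendsto_imp_filterlim_at_right LIMSEQ_inverse_real_of_nat) simp
  have "AE x in lebesgue. (\<lambda>n. ennreal ((cube_integral (t n) u x / t n ^ 3) ^ 6)) \<longlonglongrightarrow> ennreal (u x ^ 6)"
    using cube_average_tendsto[OF ul]
  proof eventually_elim
    case (elim x)
    have "(\<lambda>n. cube_integral (t n) u x / t n ^ 3) \<longlonglongrightarrow> u x"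
      using filterlim_compose[OF elim t] by (simp add: cube_integral_def integral_cbox_lebesgue[OF ul] divide_inverse mult.commute)
    then show ?case by (intro tendsto_ennrealI tendsto_power)
  qed
  then have "(\<integral>\<^sup>+x. ennreal (u x ^ 6) \<partial>lebesgue)
      = (\<integral>\<^sup>+x. liminf (\<lambda>n. ennreal ((cube_integral (t n) u x / t n ^ 3) ^ 6)) \<partial>lebesgue)"
    by (intro nn_integral_cong_AE, eventually_elim) (rule lim_imp_Liminf[OF trivial_limit_sequentially, symmetric])
  also have "\<dots> \<le> liminf (\<lambda>n. \<integral>\<^sup>+x. ennreal ((cube_integral (t n) u x / t n ^ 3) ^ 6) \<partial>lebesgue)"
  proof (rule nn_integral_liminf)
    fix n
    have "(\<lambda>x. ennreal ((cube_integral (t n) u x / t n ^ 3) ^ 6)) \<in> borel_measurable borel"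
      using borel_measurable_continuous_onI[OF continuous_cube_integral[OF ul, of "t n"]] by measurable
    then show "(\<lambda>x. ennreal ((cube_integral (t n) u x / t n ^ 3) ^ 6)) \<in> borel_measurable lebesgue"
      by (simp add: measurable_completion)
  qed
  also have "\<dots> \<le> 4096 * B ^ 3"
    by (rule Liminf_le) (auto simp: nn_integral_completion t_def intro!: always_eventually bound)
  finally show ?thesis by (simp add: B_def)
qed

section \<open>The Hardy-Littlewood-Sobolev inequality for the Newton kernel\<close>

lemma emeasure_ball_le:
  fixes x :: "real ^ 3"
  assumes "r > 0" shows "emeasure lborel (ball x r) \<le> ennreal (8 * r ^ 3)"
proof -
  have "ball x r \<subseteq> box (x - r *\<^sub>R One) (x - r *\<^sub>R One + (2 * r) *\<^sub>R One)"
  proof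
    fix y assume "y \<in> ball x r"
    then have "\<bar>(y - x) $ j\<bar> < r" for j
      using component_le_norm_cart[of "y - x" j] by (simp add: dist_norm norm_minus_commute)
    then show "y \<in> box (x - r *\<^sub>R One) (x - r *\<^sub>R One + (2 * r) *\<^sub>R One)"
      by (auto simp: mem_box_cart abs_less_iff algebra_simps)
  qed
  then have "emeasure lborel (ball x r) \<le> emeasure lborel (box (x - r *\<^sub>R One) (x - r *\<^sub>R One + (2 * r) *\<^sub>R One))"
    by (intro emeasure_mono) auto
  also have "\<dots> = ennreal (8 * r ^ 3)"
    using measure_cube(2)[of "2 * r" "x - r *\<^sub>R One"] assms by (simp add: power_mult_distrib)
  finally show ?thesis .
qed

text \<open>Here \<open>\<phi>\<close> is at most \<open>c k\<close> on the \<open>k\<close>-th shell around \<open>x\<close>, a subset of the ball of radius \<open>r k\<close>; the two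
  kernel estimates below use dyadic shells.\<close>

lemma dyadic_nn_integral_le:
  fixes x :: "real ^ 3"
  assumes c: "\<And>k. 0 \<le> c k" and r: "\<And>k. 0 < r k"
    and pt: "\<And>y. \<phi> y \<noteq> 0 \<Longrightarrow> \<exists>k. y \<in> ball x (r k) \<and> \<phi> y \<le> c k"
    and s: "(\<lambda>k. c k * (8 * r k ^ 3)) sums S"
  shows "(\<integral>\<^sup>+y. ennreal (\<phi> y) \<partial>lborel) \<le> ennreal S"
proof -
  have "(\<integral>\<^sup>+y. ennreal (\<phi> y) \<partial>lborel) \<le> (\<integral>\<^sup>+y. (\<Sum>k. ennreal (c k) * indicator (ball x (r k)) y) \<partial>lborel)"
  proof (rule nn_integral_mono)
    fix y
    show "ennreal (\<phi> y) \<le> (\<Sum>k. ennreal (c k) * indicator (ball x (r k)) y)"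
    proof (cases "\<phi> y = 0")
      case False
      then obtain k where k: "y \<in> ball x (r k)" "\<phi> y \<le> c k" using pt by blast
      then have "ennreal (\<phi> y) \<le> (\<Sum>j\<in>{k}. ennreal (c j) * indicator (ball x (r j)) y)"
        by (simp add: ennreal_leI)
      also have "\<dots> \<le> (\<Sum>j. ennreal (c j) * indicator (ball x (r j)) y)"
        by (rule sum_le_suminf) auto
      finally show ?thesis .
    qed simp
  qed
  also have "\<dots> = (\<Sum>k. ennreal (c k) * emeasure lborel (ball x (r k)))"
    by (subst nn_integral_suminf)
       (auto intro!: borel_measurable_times_ennreal borel_measurable_indicator simp: nn_integral_cmult_indicator)
  also have "\<dots> \<le> (\<Sum>k. ennreal (c k * (8 * r k ^ 3)))"
  proof (intro suminf_le)
    fix k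
    have "ennreal (c k) * emeasure lborel (ball x (r k)) \<le> ennreal (c k) * ennreal (8 * r k ^ 3)"
      by (intro mult_left_mono emeasure_ball_le r) simp
    also have "\<dots> = ennreal (c k * (8 * r k ^ 3))"
      using c[of k] r[of k] by (intro ennreal_mult[symmetric]) auto
    finally show "ennreal (c k) * emeasure lborel (ball x (r k)) \<le> ennreal (c k * (8 * r k ^ 3))" .
  qed auto
  also have "\<dots> = ennreal S"
    using s c r by (intro suminf_ennreal_eq) (auto simp: less_imp_le)
  finally show ?thesis .
qed

lemma kernel_near:
  fixes x :: "real ^ 3"
  assumes r: "r > 0"
  shows "(\<integral>\<^sup>+y. ennreal (indicator (ball x r) y / norm (x - y)) \<partial>lborel) \<le> ennreal (22 * r\<^sup>2)"
proof -
  have "(\<integral>\<^sup>+y. ennreal (indicator (ball x r) y / norm (x - y)) \<partial>lborel) \<le> ennreal (16 * r\<^sup>2 * (1 / (1 - 1 / 4)))"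
  proof (rule dyadic_nn_integral_le[where x = x and c = "\<lambda>k. 2 ^ (k + 1) / r" and r = "\<lambda>k. r / 2 ^ k"])
    fix y assume "indicator (ball x r) y / norm (x - y) \<noteq> (0::real)"
    then have y: "norm (x - y) < r" "0 < norm (x - y)"
      by (auto simp: indicator_def dist_norm split: if_splits)
    have "\<exists>k. r / norm (x - y) < 2 ^ k" using real_arch_pow[of 2] by simp
    then have ex: "\<exists>k. r / 2 ^ (k + 1) \<le> norm (x - y)"
    proof
      fix k assume "r / norm (x - y) < 2 ^ k"
      then have "r < 2 ^ k * norm (x - y)" using y by (simp add: field_simps)
      also have "\<dots> \<le> 2 ^ (k + 1) * norm (x - y)" by simp
      finally show ?thesis by (intro exI[of _ k]) (simp add: field_simps)
    qed
    define k where "k = (LEAST k. r / 2 ^ (k + 1) \<le> norm (x - y))"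
    have k1: "r / 2 ^ (k + 1) \<le> norm (x - y)" unfolding k_def using ex by (rule LeastI_ex)
    have k2: "norm (x - y) < r / 2 ^ k"
    proof (cases k)
      case (Suc j)
      have "\<not> r / 2 ^ (j + 1) \<le> norm (x - y)"
        using not_less_Least[of j "\<lambda>k. r / 2 ^ (k + 1) \<le> norm (x - y)"] Suc by (simp add: k_def)
      then show ?thesis using Suc by simp
    qed (use y in simp)
    show "\<exists>k. y \<in> ball x (r / 2 ^ k) \<and> indicator (ball x r) y / norm (x - y) \<le> 2 ^ (k + 1) / r"
      using k1 k2 y r by (intro exI[of _ k]) (auto simp: dist_norm field_simps)
  next
    have "(\<lambda>k. 16 * r\<^sup>2 * (1 / 4) ^ k) sums (16 * r\<^sup>2 * (1 / (1 - 1 / 4)))"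
      by (intro sums_mult geometric_sums) simp
    moreover have "16 * r\<^sup>2 * (1 / 4) ^ k = 2 ^ (k + 1) / r * (8 * (r / 2 ^ k) ^ 3)" for k
    proof -
      have "(2::real) ^ k * 4 ^ k = (2 ^ k) ^ 3" 
      proof -
        have "(2::real) ^ k * 4 ^ k = (2 ^ 3) ^ k" by (simp flip: power_mult_distrib)
        also have "\<dots> = (2 ^ k) ^ 3" by (simp only: power_mult[symmetric] mult.commute)
        finally show ?thesis .
      qed
      then show ?thesis using r
        by (simp add: power_divide field_simps power2_eq_square power3_eq_cube)
    qed
    ultimately show "(\<lambda>k. 2 ^ (k + 1) / r * (8 * (r / 2 ^ k) ^ 3)) sums (16 * r\<^sup>2 * (1 / (1 - 1 / 4)))"
      by simp
  qed (use r in auto)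
  also have "\<dots> \<le> ennreal (22 * r\<^sup>2)" by (intro ennreal_leI) simp
  finally show ?thesis .
qed

lemma kernel_far:
  fixes x :: "real ^ 3"
  assumes r: "r > 0"
  shows "(\<integral>\<^sup>+y. ennreal (indicator (- ball x r) y / norm (x - y) ^ 6) \<partial>lborel) \<le> ennreal (74 / r ^ 3)"
proof -
  have "(\<integral>\<^sup>+y. ennreal (indicator (- ball x r) y / norm (x - y) ^ 6) \<partial>lborel) \<le> ennreal (64 / r ^ 3 * (1 / (1 - 1 / 8)))"
  proof (rule dyadic_nn_integral_le[where x = x and c = "\<lambda>k. 1 / (r * 2 ^ k) ^ 6" and r = "\<lambda>k. r * 2 ^ (k + 1)"])
    fix y assume "indicator (- ball x r) y / norm (x - y) ^ 6 \<noteq> (0::real)"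
    then have y: "r \<le> norm (x - y)"
      by (auto simp: indicator_def dist_norm split: if_splits)
    have "\<exists>k. norm (x - y) / r < 2 ^ k" using real_arch_pow[of 2] by simp
    then have ex: "\<exists>k. norm (x - y) < r * 2 ^ (k + 1)"
    proof
      fix k assume "norm (x - y) / r < 2 ^ k"
      then have "norm (x - y) < r * 2 ^ k" using r by (simp add: field_simps)
      also have "\<dots> \<le> r * 2 ^ (k + 1)" using r by simp
      finally show ?thesis by blast
    qed
    define k where "k = (LEAST k. norm (x - y) < r * 2 ^ (k + 1))"
    have k1: "norm (x - y) < r * 2 ^ (k + 1)" unfolding k_def using ex by (rule LeastI_ex)
    have k2: "r * 2 ^ k \<le> norm (x - y)"
    proof (cases k)
      case (Suc j)
      have "\<not> norm (x - y) < r * 2 ^ (j + 1)"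
        using not_less_Least[of j "\<lambda>k. norm (x - y) < r * 2 ^ (k + 1)"] Suc by (simp add: k_def)
      then show ?thesis using Suc by simp
    qed (use y in simp)
    have "1 / norm (x - y) ^ 6 \<le> 1 / (r * 2 ^ k) ^ 6"
      using k2 r y by (intro divide_left_mono power_mono mult_pos_pos zero_less_power) auto
    then show "\<exists>k. y \<in> ball x (r * 2 ^ (k + 1)) \<and> indicator (- ball x r) y / norm (x - y) ^ 6 \<le> 1 / (r * 2 ^ k) ^ 6"
      using k1 y by (intro exI[of _ k]) (auto simp: dist_norm)
  next
    have "(\<lambda>k. 64 / r ^ 3 * (1 / 8) ^ k) sums (64 / r ^ 3 * (1 / (1 - 1 / 8)))"
      by (intro sums_mult geometric_sums) simp
    moreover have "64 / r ^ 3 * (1 / 8) ^ k = 1 / (r * 2 ^ k) ^ 6 * (8 * (r * 2 ^ (k + 1)) ^ 3)" for k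
    proof -
      define q :: real where "q = 2 ^ k"
      have q: "q > 0" by (simp add: q_def)
      have "(8::real) ^ k = q ^ 3"
      proof -
        have "(8::real) ^ k = (2 ^ 3) ^ k" by simp
        also have "\<dots> = q ^ 3" unfolding q_def by (simp only: power_mult[symmetric] mult.commute)
        finally show ?thesis .
      qed
      moreover have "2 ^ (k + 1) = 2 * q" by (simp add: q_def)
      moreover have "64 / r ^ 3 * (1 / q ^ 3) = 1 / (r * q) ^ 6 * (8 * (r * (2 * q)) ^ 3)"
      proof -
        define R Q where "R = r ^ 3" "Q = q ^ 3"
        have "(r * q) ^ 6 = (R * Q) * (R * Q)" "(r * (2 * q)) ^ 3 = 8 * (R * Q)"
          unfolding R_Q_def by (simp_all add: eval_nat_numeral mult_ac)
        moreover have "R > 0" "Q > 0" using r q by (auto simp: R_Q_def)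
        ultimately show ?thesis unfolding R_Q_def(1)[symmetric] R_Q_def(2)[symmetric] by simp
      qed
      ultimately show ?thesis by (simp add: power_divide q_def)
    qed
    ultimately show "(\<lambda>k. 1 / (r * 2 ^ k) ^ 6 * (8 * (r * 2 ^ (k + 1)) ^ 3)) sums (64 / r ^ 3 * (1 / (1 - 1 / 8)))"
      by simp
  qed (use r in auto)
  also have "\<dots> \<le> ennreal (74 / r ^ 3)" using r by (intro ennreal_leI) (simp add: divide_simps)
  finally show ?thesis .
qed

text \<open>Young's inequality for the exponents \<open>6/5\<close> and \<open>6\<close>, with a free weight \<open>s\<close>: the first summand dominates if
  \<open>k \<le> s f\<^sup>1\<^sup>/\<^sup>5\<close>, the second otherwise.\<close>

lemma weighted_young:
  fixes f k s :: real
  assumes "0 \<le> f" "0 \<le> k" "0 < s"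
  shows "f * k \<le> s * f powr (6/5) + k ^ 6 / s ^ 5"
proof (cases "k \<le> s * f powr (1/5)")
  case True
  then have "f * k \<le> f * (s * f powr (1/5))" using assms by (intro mult_left_mono)
  also have "\<dots> = s * f powr (6/5)"
  proof (cases "f = 0")
    case False
    then have "f * f powr (1/5) = f powr (6/5)"
      using assms powr_add[of f 1 "1/5"] by simp
    then show ?thesis by (simp add: mult_ac)
  qed simp
  finally show ?thesis using assms by (simp add: add_increasing2)
next
  case False
  then have "f powr (1/5) \<le> k / s" using assms by (simp add: field_simps)
  then have "(f powr (1/5)) ^ 5 \<le> (k / s) ^ 5" by (intro power_mono) auto
  moreover have "(f powr (1/5)) ^ 5 = f"
    using assms by (cases "f = 0") (simp_all add: powr_powr flip: powr_realpow)
  ultimately have "f * k \<le> (k / s) ^ 5 * k" using assms by (intro mult_right_mono) auto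
  also have "\<dots> = k ^ 6 / s ^ 5" by (simp add: power_divide eval_nat_numeral)
  finally show ?thesis using assms by (simp add: add_increasing)
qed

text \<open>The part of the double integral where \<open>f y \<le> f x\<close>: inside the ball of radius \<open>r\<close> around
  \<open>x\<close> bound \<open>f y\<close> by \<open>f x\<close>, outside use Young's inequality with weight \<open>s = r\<^sup>-\<^sup>1\<^sup>/\<^sup>2\<close>; \<open>r = f(x)\<^sup>-\<^sup>2\<^sup>/\<^sup>5\<close> balances both parts and
  leaves \<open>f(x)\<^sup>1\<^sup>/\<^sup>5\<close>.\<close>

lemma HLS_inner:
  fixes f :: "real ^ 3 \<Rightarrow> real"
  assumes [measurable]: "f \<in> borel_measurable borel" and f: "\<And>x. 0 \<le> f x"
    and le1: "(\<integral>\<^sup>+x. ennreal (f x powr (6/5)) \<partial>lborel) \<le> 1"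
  shows "(\<integral>\<^sup>+y. ennreal (if f y \<le> f x then f x * f y / norm (x - y) else 0) \<partial>lborel) \<le> ennreal (97 * f x powr (6/5))"
proof (cases "f x = 0")
  case True
  then have "(if f y \<le> f x then f x * f y / norm (x - y) else 0) = 0" for y by simp
  then show ?thesis by (simp only:) simp
next
  case False
  define F where "F = f x"
  have F: "F > 0" using False f[of x] by (simp add: F_def less_le)
  define r where "r = F powr (- 2/5)"
  define s where "s = F powr (1/5)"
  have rs: "r > 0" "s > 0" using F by (auto simp: r_def s_def)
  have [measurable]: "ball x r \<in> sets borel" "- ball x r \<in> sets borel" by auto
  have "(\<integral>\<^sup>+y. ennreal (if f y \<le> f x then f x * f y / norm (x - y) else 0) \<partial>lborel)
     \<le> (\<integral>\<^sup>+y. ennreal (F * F) * ennreal (indicator (ball x r) y / norm (x - y)) + (ennreal (F * s) * ennreal (f y powr (6/5))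
         + ennreal (F / s ^ 5) * ennreal (indicator (- ball x r) y / norm (x - y) ^ 6)) \<partial>lborel)"
  proof (rule nn_integral_mono)
    fix y
    have "(if f y \<le> f x then f x * f y / norm (x - y) else 0)
      \<le> F * F * (indicator (ball x r) y / norm (x - y)) + (F * s * f y powr (6/5) + F / s ^ 5 * (indicator (- ball x r) y / norm (x - y) ^ 6))"
    proof (cases "f y \<le> f x")
      case le: True
      show ?thesis
      proof (cases "y \<in> ball x r")
        case True
        have "f x * f y / norm (x - y) \<le> F * F / norm (x - y)"
          using le F f[of y] by (intro divide_right_mono mult_mono) (auto simp: F_def)
        then show ?thesis using True le F rs by (simp add: add_increasing2)
      next
        case out: False
        have "f y * (1 / norm (x - y)) \<le> s * f y powr (6/5) + (1 / norm (x - y)) ^ 6 / s ^ 5"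
          by (rule weighted_young) (use f rs in auto)
        from mult_left_mono[OF this, of F] show ?thesis
          using le out F by (simp add: F_def power_divide field_simps)
      qed
    next
      case False
      then show ?thesis using F rs by auto
    qed
    then show "ennreal (if f y \<le> f x then f x * f y / norm (x - y) else 0)
      \<le> ennreal (F * F) * ennreal (indicator (ball x r) y / norm (x - y)) + (ennreal (F * s) * ennreal (f y powr (6/5))
         + ennreal (F / s ^ 5) * ennreal (indicator (- ball x r) y / norm (x - y) ^ 6))"
      using F rs by (simp add: ennreal_mult'[symmetric] ennreal_plus[symmetric] ennreal_leI del: ennreal_plus)
  qed
  also have "\<dots> = ennreal (F * F) * (\<integral>\<^sup>+y. ennreal (indicator (ball x r) y / norm (x - y)) \<partial>lborel)
      + (ennreal (F * s) * (\<integral>\<^sup>+y. ennreal (f y powr (6/5)) \<partial>lborel)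
      + ennreal (F / s ^ 5) * (\<integral>\<^sup>+y. ennreal (indicator (- ball x r) y / norm (x - y) ^ 6) \<partial>lborel))"
    by (simp add: nn_integral_add nn_integral_cmult)
  also have "\<dots> \<le> ennreal (F * F) * ennreal (22 * r\<^sup>2) + (ennreal (F * s) * 1 + ennreal (F / s ^ 5) * ennreal (74 / r ^ 3))"
    by (intro add_mono mult_left_mono kernel_near kernel_far le1 rs) auto
  also have "\<dots> = ennreal (F * F * (22 * r\<^sup>2) + (F * s + F / s ^ 5 * (74 / r ^ 3)))"
    using F rs by (simp add: ennreal_mult'[symmetric] ennreal_plus[symmetric] del: ennreal_plus)
  also have "F * F * (22 * r\<^sup>2) + (F * s + F / s ^ 5 * (74 / r ^ 3)) = 97 * F powr (6/5)"
  proof -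
    have 1: "F * F * r\<^sup>2 = F powr (6/5)"
    proof -
      have "F * F * r\<^sup>2 = F powr 1 * F powr 1 * F powr (- 4/5)"
        using F powr_realpow[of r 2] rs by (simp add: r_def powr_powr)
      also have "\<dots> = F powr (6/5)" by (simp only: powr_add[symmetric]) simp
      finally show ?thesis .
    qed
    have 2: "F * s = F powr (6/5)"
      using F powr_add[of F 1 "1/5"] by (simp add: s_def)
    have "s ^ 5 = F"
      using F powr_realpow[of s 5] rs by (simp add: s_def powr_powr)
    moreover have "1 / r ^ 3 = F powr (6/5)"
    proof -
      have "r ^ 3 = r powr 3" using rs powr_realpow[of r 3] by simp
      also have "\<dots> = F powr (- (6/5))" by (simp add: r_def powr_powr)
      finally show ?thesis using F by (simp add: powr_minus_divide)
    qed
    moreover have "F / s ^ 5 * (74 / r ^ 3) = 74 * (F / s ^ 5) * (1 / r ^ 3)" by simp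
    ultimately have 3: "F / s ^ 5 * (74 / r ^ 3) = 74 * F powr (6/5)" using F by simp
    show ?thesis using 1 2 3 by simp
  qed
  finally show ?thesis by (simp add: F_def)
qed

text \<open>By symmetry of the kernel, twice the part where \<open>f y \<le> f x\<close> dominates the whole double integral. This
  replaces interpolation or maximal functions: the exponent \<open>6/5 = 1 + 1/5\<close> comes out of the inner
  estimate exactly.\<close>

lemma HLS_diagonal:
  fixes f :: "real ^ 3 \<Rightarrow> real"
  assumes [measurable]: "f \<in> borel_measurable borel" and f: "\<And>x. 0 \<le> f x"
    and le1: "(\<integral>\<^sup>+x. ennreal (f x powr (6/5)) \<partial>lborel) \<le> 1"
  shows "(\<integral>\<^sup>+x. \<integral>\<^sup>+y. ennreal (f x * f y / norm (x - y)) \<partial>lborel \<partial>lborel) \<le> 194"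
proof -
  define A where "A x y = ennreal (if f y \<le> f x then f x * f y / norm (x - y) else 0)" for x y
  have [measurable]: "(\<lambda>(x, y). A x y) \<in> borel_measurable (borel \<Otimes>\<^sub>M borel)"
    "(\<lambda>(x, y). A y x) \<in> borel_measurable (borel \<Otimes>\<^sub>M borel)"
    unfolding A_def by measurable
  have "(\<integral>\<^sup>+x. \<integral>\<^sup>+y. ennreal (f x * f y / norm (x - y)) \<partial>lborel \<partial>lborel) \<le> (\<integral>\<^sup>+x. \<integral>\<^sup>+y. A x y + A y x \<partial>lborel \<partial>lborel)"
    unfolding A_def by (intro nn_integral_mono) (auto simp: norm_minus_commute mult_ac)
  also have "\<dots> = (\<integral>\<^sup>+x. \<integral>\<^sup>+y. A x y \<partial>lborel \<partial>lborel) + (\<integral>\<^sup>+x. \<integral>\<^sup>+y. A y x \<partial>lborel \<partial>lborel)"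
    by (simp add: nn_integral_add)
  also have "(\<integral>\<^sup>+x. \<integral>\<^sup>+y. A y x \<partial>lborel \<partial>lborel) = (\<integral>\<^sup>+x. \<integral>\<^sup>+y. A x y \<partial>lborel \<partial>lborel)"
    by (rule nn_integral_swap) measurable
  also have "(\<integral>\<^sup>+x. \<integral>\<^sup>+y. A x y \<partial>lborel \<partial>lborel) \<le> (\<integral>\<^sup>+x. ennreal (97 * f x powr (6/5)) \<partial>lborel)"
    unfolding A_def by (intro nn_integral_mono HLS_inner f le1) measurable
  also have "\<dots> = 97 * (\<integral>\<^sup>+x. ennreal (f x powr (6/5)) \<partial>lborel)"
    by (simp add: ennreal_mult nn_integral_cmult)
  also have "\<dots> \<le> 97 * 1" using le1 by (rule mult_left_mono) simp
  finally have "(\<integral>\<^sup>+x. \<integral>\<^sup>+y. ennreal (f x * f y / norm (x - y)) \<partial>lborel \<partial>lborel) \<le> 97 + 97"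
    by (simp add: add_mono)
  then show ?thesis by simp
qed

lemma powr_average_le:
  fixes a b q :: real
  assumes "0 \<le> a" "0 \<le> b" "0 < q"
  shows "((a + b) / 2) powr q \<le> a powr q + b powr q"
proof -
  have "((a + b) / 2) powr q \<le> (max a b) powr q" using assms by (intro powr_mono2) auto
  also have "\<dots> \<le> a powr q + b powr q" by (auto simp: max_def)
  finally show ?thesis .
qed

text \<open>Apply the diagonal case to a multiple of \<open>\<bar>f\<bar> + \<bar>g\<bar>\<close>; the divisor \<open>4\<close> keeps this function
  normalised.\<close>

lemma HLS:
  fixes f g :: "real ^ 3 \<Rightarrow> real"
  assumes [measurable]: "f \<in> borel_measurable borel" "g \<in> borel_measurable borel"
    and f: "(\<integral>\<^sup>+x. ennreal (\<bar>f x\<bar> powr (6/5)) \<partial>lborel) \<le> 1"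
    and g: "(\<integral>\<^sup>+x. ennreal (\<bar>g x\<bar> powr (6/5)) \<partial>lborel) \<le> 1"
  shows "(\<integral>\<^sup>+x. \<integral>\<^sup>+y. ennreal (\<bar>f y\<bar> * \<bar>g x\<bar> / norm (x - y)) \<partial>lborel \<partial>lborel) \<le> 3104"
proof -
  define h where "h x = (\<bar>f x\<bar> + \<bar>g x\<bar>) / 4" for x
  have [measurable]: "h \<in> borel_measurable borel" unfolding h_def by measurable
  have h: "h x powr (6/5) \<le> 1/2 * (\<bar>f x\<bar> powr (6/5) + \<bar>g x\<bar> powr (6/5))" for x
  proof -
    have "h x powr (6/5) = (1/2) powr (6/5) * ((\<bar>f x\<bar> + \<bar>g x\<bar>) / 2) powr (6/5)"
      by (simp add: h_def powr_mult[symmetric])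
    also have "\<dots> \<le> (1/2) powr 1 * (\<bar>f x\<bar> powr (6/5) + \<bar>g x\<bar> powr (6/5))"
      by (intro mult_mono powr_average_le powr_mono') auto
    finally show ?thesis by simp
  qed
  have "(\<integral>\<^sup>+x. ennreal (h x powr (6/5)) \<partial>lborel) \<le> (\<integral>\<^sup>+x. ennreal (1/2) * (ennreal (\<bar>f x\<bar> powr (6/5)) + ennreal (\<bar>g x\<bar> powr (6/5))) \<partial>lborel)"
  proof (rule nn_integral_mono)
    fix x
    have "ennreal (h x powr (6/5)) \<le> ennreal (1/2 * (\<bar>f x\<bar> powr (6/5) + \<bar>g x\<bar> powr (6/5)))"
      by (rule ennreal_leI[OF h])
    also have "\<dots> = ennreal (1/2) * (ennreal (\<bar>f x\<bar> powr (6/5)) + ennreal (\<bar>g x\<bar> powr (6/5)))"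
      by (subst ennreal_mult) auto
    finally show "ennreal (h x powr (6/5)) \<le> ennreal (1/2) * (ennreal (\<bar>f x\<bar> powr (6/5)) + ennreal (\<bar>g x\<bar> powr (6/5)))" .
  qed
  also have "\<dots> = ennreal (1/2) * ((\<integral>\<^sup>+x. ennreal (\<bar>f x\<bar> powr (6/5)) \<partial>lborel) + (\<integral>\<^sup>+x. ennreal (\<bar>g x\<bar> powr (6/5)) \<partial>lborel))"
    by (simp add: nn_integral_add nn_integral_cmult)
  also have "\<dots> \<le> ennreal (1/2) * (1 + 1)" by (intro mult_left_mono add_mono f g) auto
  also have "\<dots> = ennreal (1/2) * ennreal 2" by simp
  also have "\<dots> = 1" by (subst ennreal_mult[symmetric]) auto
  finally have hh: "(\<integral>\<^sup>+x. \<integral>\<^sup>+y. ennreal (h x * h y / norm (x - y)) \<partial>lborel \<partial>lborel) \<le> 194"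
    by (intro HLS_diagonal) (auto simp: h_def)
  have "(\<integral>\<^sup>+x. \<integral>\<^sup>+y. ennreal (\<bar>f y\<bar> * \<bar>g x\<bar> / norm (x - y)) \<partial>lborel \<partial>lborel)
     \<le> (\<integral>\<^sup>+x. \<integral>\<^sup>+y. 16 * ennreal (h x * h y / norm (x - y)) \<partial>lborel \<partial>lborel)"
  proof (intro nn_integral_mono)
    fix x y
    have "\<bar>f y\<bar> * \<bar>g x\<bar> \<le> (4 * h y) * (4 * h x)" by (intro mult_mono) (auto simp: h_def)
    then have "\<bar>f y\<bar> * \<bar>g x\<bar> / norm (x - y) \<le> 16 * (h x * h y / norm (x - y))"
      by (simp add: divide_right_mono mult_ac)
    then have "ennreal (\<bar>f y\<bar> * \<bar>g x\<bar> / norm (x - y)) \<le> ennreal (16 * (h x * h y / norm (x - y)))"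
      by (rule ennreal_leI)
    also have "\<dots> = 16 * ennreal (h x * h y / norm (x - y))" by (subst ennreal_mult') auto
    finally show "ennreal (\<bar>f y\<bar> * \<bar>g x\<bar> / norm (x - y)) \<le> 16 * ennreal (h x * h y / norm (x - y))" .
  qed
  also have "\<dots> = 16 * (\<integral>\<^sup>+x. \<integral>\<^sup>+y. ennreal (h x * h y / norm (x - y)) \<partial>lborel \<partial>lborel)"
    by (simp add: nn_integral_cmult)
  also have "\<dots> \<le> 16 * 194" using hh by (rule mult_left_mono) simp
  finally show ?thesis by simp
qed

section \<open>Lebesgue spaces\<close>

definition mass :: "real \<Rightarrow> (real ^ 3 \<Rightarrow> 'b::euclidean_space) \<Rightarrow> real" where
  "mass q f = (LINT x|lebesgue. norm (f x) powr q)"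

lemma mass_nonneg: "0 \<le> mass q f"
  unfolding mass_def by (intro integral_nonneg_AE AE_I2) simp

lemma in_L_measurable: "in_L q f \<Longrightarrow> f \<in> borel_measurable lebesgue"
  by (simp add: in_L_def)

lemma in_L_nn_integral: "in_L q f \<Longrightarrow> (\<integral>\<^sup>+x. ennreal (norm (f x) powr q) \<partial>lebesgue) = ennreal (mass q f)"
  unfolding mass_def in_L_def by (intro nn_integral_eq_integral) auto

lemma in_L_I:
  assumes "f \<in> borel_measurable lebesgue" "(\<integral>\<^sup>+x. ennreal (norm (f x) powr q) \<partial>lebesgue) \<le> ennreal C"
  shows "in_L q f" and "0 \<le> C \<Longrightarrow> mass q f \<le> C"
proof -
  have [measurable]: "(\<lambda>x. norm (f x) powr q) \<in> borel_measurable lebesgue" using assms(1) by measurable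
  have "(\<integral>\<^sup>+x. ennreal (norm (norm (f x) powr q)) \<partial>lebesgue) < \<infinity>"
    using le_less_trans[OF assms(2), of \<infinity>] by simp
  then have "integrable lebesgue (\<lambda>x. norm (f x) powr q)" by (intro integrableI_bounded) auto
  then show L: "in_L q f" using assms(1) by (simp add: in_L_def)
  show "mass q f \<le> C" if "0 \<le> C"
    using assms(2) in_L_nn_integral[OF L] that by simp
qed

lemma in_L_dominated:
  fixes f :: "real ^ 3 \<Rightarrow> 'b::euclidean_space"
  assumes "f \<in> borel_measurable lebesgue" "integrable lebesgue w" "\<And>x. norm (f x) powr q \<le> w x"
  shows "in_L q f" "mass q f \<le> (LINT x|lebesgue. w x)"
proof -
  show "in_L q f" unfolding in_L_def
  proof (intro conjI)
    show "integrable lebesgue (\<lambda>x. norm (f x) powr q)"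
      by (rule Bochner_Integration.integrable_bound[OF assms(2)])
         (use assms(1,3) in \<open>auto intro: order_trans[OF _ abs_ge_self]\<close>)
  qed (rule assms)
  then show "mass q f \<le> (LINT x|lebesgue. w x)"
    unfolding mass_def using assms by (intro integral_mono) (auto simp: in_L_def)
qed

lemma in_L_lin:
  fixes f g :: "real ^ 3 \<Rightarrow> 'b::euclidean_space"
  assumes f: "in_L q f" and g: "in_L q g" and q: "0 < q"
  shows "in_L q (\<lambda>x. f x + r *\<^sub>R g x)"
proof (rule in_L_dominated(1))
  show "integrable lebesgue (\<lambda>x. 2 powr q * (norm (f x) powr q + \<bar>r\<bar> powr q * norm (g x) powr q))"
    using f g by (auto simp: in_L_def)
  show "(\<lambda>x. f x + r *\<^sub>R g x) \<in> borel_measurable lebesgue"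
    using f g by (auto simp: in_L_def)
  fix x
  have "norm (f x + r *\<^sub>R g x) powr q \<le> (norm (f x) + norm (r *\<^sub>R g x)) powr q"
    using q by (intro powr_mono2 norm_triangle_ineq) auto
  also have "\<dots> = 2 powr q * ((norm (f x) + norm (r *\<^sub>R g x)) / 2) powr q"
    by (subst powr_mult[symmetric]) (auto simp: add_divide_distrib)
  also have "\<dots> \<le> 2 powr q * (norm (f x) powr q + norm (r *\<^sub>R g x) powr q)"
    using q by (intro mult_left_mono powr_average_le) auto
  also have "norm (r *\<^sub>R g x) powr q = \<bar>r\<bar> powr q * norm (g x) powr q" by (simp add: powr_mult)
  finally show "norm (f x + r *\<^sub>R g x) powr q \<le> 2 powr q * (norm (f x) powr q + \<bar>r\<bar> powr q * norm (g x) powr q)" .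
qed

lemma in_L_scale:
  fixes f :: "real ^ 3 \<Rightarrow> 'b::euclidean_space"
  assumes "in_L q f"
  shows "in_L q (\<lambda>x. r *\<^sub>R f x)" "mass q (\<lambda>x. r *\<^sub>R f x) = \<bar>r\<bar> powr q * mass q f"
  using assms by (auto simp: in_L_def mass_def powr_mult)

lemma in_L_lin_real:
  fixes f g :: "real ^ 3 \<Rightarrow> real"
  assumes "in_L q f" "in_L q g" "0 < q"
  shows "in_L q (\<lambda>x. f x + r * g x)"
  using in_L_lin[OF assms, of r] by simp

lemma in_L_scale_real:
  fixes f :: "real ^ 3 \<Rightarrow> real"
  assumes "in_L q f"
  shows "in_L q (\<lambda>x. r * f x)" "mass q (\<lambda>x. r * f x) = \<bar>r\<bar> powr q * mass q f"
  using in_L_scale[OF assms, of r] by auto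

lemma in_L_normalise:
  fixes f :: "real ^ 3 \<Rightarrow> real"
  assumes "in_L q f" "0 < q"
  obtains c where "c > 0" "in_L q (\<lambda>x. c * f x)" "mass q (\<lambda>x. c * f x) \<le> 1"
proof
  define c where "c = (mass q f + 1) powr (- (1 / q))"
  have m: "mass q f + 1 > 0" using mass_nonneg[of q f] by linarith
  then show "c > 0" by (simp add: c_def)
  show "in_L q (\<lambda>x. c * f x)" using assms in_L_scale_real by blast
  have "c powr q = 1 / (mass q f + 1)"
  proof -
    have "c powr q = (mass q f + 1) powr (- 1)" using assms by (simp add: c_def powr_powr)
    then show ?thesis using m by (simp add: powr_minus_divide)
  qed
  then have "c powr q * mass q f = 1 - c powr q" using m by (simp add: field_simps)
  then show "mass q (\<lambda>x. c * f x) \<le> 1"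
    using in_L_scale_real(2)[OF assms(1), of c] \<open>c > 0\<close> by simp
qed

section \<open>Bounded forms on the dual Sobolev space\<close>

text \<open>The interaction energies for all \<open>a \<ge> 0\<close> are symmetric bilinear forms on \<open>L\<^sup>6\<^sup>/\<^sup>5\<close>, the dual of
  the space \<open>L\<^sup>6\<close> of the Sobolev inequality; only these properties enter the estimates
  of the functional and of its derivative.\<close>

definition bounded_form :: "((real ^ 3 \<Rightarrow> real) \<Rightarrow> (real ^ 3 \<Rightarrow> real) \<Rightarrow> real) \<Rightarrow> real \<Rightarrow> bool" where
  "bounded_form T C \<longleftrightarrow>
     (\<forall>f g. in_L (6/5) f \<longrightarrow> in_L (6/5) g \<longrightarrow> T f g = T g f) \<and>
     (\<forall>f g h r. in_L (6/5) f \<longrightarrow> in_L (6/5) g \<longrightarrow> in_L (6/5) h \<longrightarrow> T f (\<lambda>x. g x + r * h x) = T f g + r * T f h) \<and>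
     (\<forall>f g. in_L (6/5) f \<longrightarrow> in_L (6/5) g \<longrightarrow> mass (6/5) f \<le> 1 \<longrightarrow> mass (6/5) g \<le> 1 \<longrightarrow> \<bar>T f g\<bar> \<le> C)"

definition newton_form :: "(real ^ 3 \<Rightarrow> real) \<Rightarrow> (real ^ 3 \<Rightarrow> real) \<Rightarrow> real" where
  "newton_form f g = (LINT x|lebesgue. (LINT y|lebesgue. f y / norm (x - y)) * g x)"

lemma newton_integrable_normalised:
  fixes f g :: "real ^ 3 \<Rightarrow> real"
  assumes [measurable]: "f \<in> borel_measurable borel" "g \<in> borel_measurable borel"
    and f: "(\<integral>\<^sup>+x. ennreal (\<bar>f x\<bar> powr (6/5)) \<partial>lborel) \<le> 1"
    and g: "(\<integral>\<^sup>+x. ennreal (\<bar>g x\<bar> powr (6/5)) \<partial>lborel) \<le> 1"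
  shows "integrable (lborel \<Otimes>\<^sub>M lborel) (\<lambda>(x, y). f y * g x / norm (x - y))"
    and "\<bar>integral\<^sup>L (lborel \<Otimes>\<^sub>M lborel) (\<lambda>(x, y). f y * g x / norm (x - y))\<bar> \<le> 3104"
proof -
  let ?H = "\<lambda>(x, y). f y * g x / norm (x - y)"
  have m: "?H \<in> borel_measurable (lborel \<Otimes>\<^sub>M lborel)" by measurable
  have "(\<integral>\<^sup>+p. ennreal (norm (?H p)) \<partial>(lborel \<Otimes>\<^sub>M lborel)) = (\<integral>\<^sup>+x. \<integral>\<^sup>+y. ennreal (norm (?H (x, y))) \<partial>lborel \<partial>lborel)"
    by (rule lborel.nn_integral_fst[symmetric]) measurable
  also have "\<dots> \<le> 3104" using HLS[OF assms] by (simp add: abs_mult)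
  finally have b: "(\<integral>\<^sup>+p. ennreal (norm (?H p)) \<partial>(lborel \<Otimes>\<^sub>M lborel)) \<le> 3104" .
  show i: "integrable (lborel \<Otimes>\<^sub>M lborel) ?H"
    using m le_less_trans[OF b, of \<infinity>] by (intro integrableI_bounded) auto
  have "ennreal (norm (integral\<^sup>L (lborel \<Otimes>\<^sub>M lborel) ?H)) \<le> ennreal 3104"
    using order_trans[OF integral_norm_bound_ennreal[OF i] b] by simp
  then show "\<bar>integral\<^sup>L (lborel \<Otimes>\<^sub>M lborel) ?H\<bar> \<le> 3104" by (subst (asm) ennreal_le_iff) auto
qed

lemma real_representative:
  fixes f :: "real ^ 3 \<Rightarrow> real"
  assumes "in_L q f"
  obtains f' where "f' \<in> borel_measurable borel" "AE x in lborel. f x = f' x"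
    "(\<integral>\<^sup>+x. ennreal (\<bar>f' x\<bar> powr q) \<partial>lborel) = ennreal (mass q f)"
proof -
  obtain f' where f': "f' \<in> borel_measurable borel" "AE x in lborel. f x = f' x"
    using completion_ex_borel_measurable_real[OF in_L_measurable[OF assms]] by auto
  have "(\<integral>\<^sup>+x. ennreal (\<bar>f' x\<bar> powr q) \<partial>lborel) = (\<integral>\<^sup>+x. ennreal (norm (f x) powr q) \<partial>lebesgue)"
    unfolding nn_integral_completion using f'(2) by (intro nn_integral_cong_AE) auto
  then show ?thesis using f' in_L_nn_integral[OF assms] by (intro that) auto
qed

text \<open>Fubini's theorem concerns the product of two Borel measures, so it is applied to Borel measurable
  representatives of the two Lebesgue measurable functions.\<close>

lemma newton_form_borel:
  fixes f g :: "real ^ 3 \<Rightarrow> real"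
  assumes f: "in_L (6/5) f" and g: "in_L (6/5) g"
    and f' [measurable]: "f' \<in> borel_measurable borel" and ff: "AE x in lborel. f x = f' x"
    and mf: "(\<integral>\<^sup>+x. ennreal (\<bar>f' x\<bar> powr (6/5)) \<partial>lborel) = ennreal (mass (6/5) f)"
    and g' [measurable]: "g' \<in> borel_measurable borel" and gg: "AE x in lborel. g x = g' x"
    and mg: "(\<integral>\<^sup>+x. ennreal (\<bar>g' x\<bar> powr (6/5)) \<partial>lborel) = ennreal (mass (6/5) g)"
  shows "integrable (lborel \<Otimes>\<^sub>M lborel) (\<lambda>(x, y). f' y * g' x / norm (x - y))"
    and "integrable lebesgue (\<lambda>x. (LINT y|lebesgue. f y / norm (x - y)) * g x)"
    and "newton_form f g = integral\<^sup>L (lborel \<Otimes>\<^sub>M lborel) (\<lambda>(x, y). f' y * g' x / norm (x - y))"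
proof -
  let ?H = "\<lambda>(x, y). f' y * g' x / norm (x - y)"
  obtain c where c: "c > 0" "in_L (6/5) (\<lambda>x. c * f x)" "mass (6/5) (\<lambda>x. c * f x) \<le> 1"
    using in_L_normalise[OF f] by auto
  obtain d where d: "d > 0" "in_L (6/5) (\<lambda>x. d * g x)" "mass (6/5) (\<lambda>x. d * g x) \<le> 1"
    using in_L_normalise[OF g] by auto
  have scale: "(\<integral>\<^sup>+x. ennreal (\<bar>c * k' x\<bar> powr (6/5)) \<partial>lborel) \<le> 1"
    if "in_L (6/5) (\<lambda>x. c * k x)" "mass (6/5) (\<lambda>x. c * k x) \<le> 1" "AE x in lborel. k x = k' x" for c k k'
  proof -
    have "(\<integral>\<^sup>+x. ennreal (\<bar>c * k' x\<bar> powr (6/5)) \<partial>lborel) = (\<integral>\<^sup>+x. ennreal (norm (c * k x) powr (6/5)) \<partial>lebesgue)"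
      unfolding nn_integral_completion using that(3) by (intro nn_integral_cong_AE) auto
    then show ?thesis using in_L_nn_integral[OF that(1)] that(2) by simp
  qed
  have "integrable (lborel \<Otimes>\<^sub>M lborel) (\<lambda>(x, y). (c * f' y) * (d * g' x) / norm (x - y))"
    by (rule newton_integrable_normalised) (use scale[OF c(2,3) ff] scale[OF d(2,3) gg] in auto)
  then have "integrable (lborel \<Otimes>\<^sub>M lborel) (\<lambda>p. (1 / (c * d)) * (case p of (x, y) \<Rightarrow> (c * f' y) * (d * g' x) / norm (x - y)))"
    by (rule integrable_mult_right)
  moreover have "(\<lambda>p. (1 / (c * d)) * (case p of (x, y) \<Rightarrow> (c * f' y) * (d * g' x) / norm (x - y))) = ?H"
    using c d by (auto simp: fun_eq_iff)
  ultimately show i: "integrable (lborel \<Otimes>\<^sub>M lborel) ?H" by simp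
  have ph: "(LINT y|lebesgue. f y / norm (x - y)) = (LINT y|lborel. f' y / norm (x - y))" for x
  proof -
    have "(LINT y|lebesgue. f y / norm (x - y)) = (LINT y|lebesgue. f' y / norm (x - y))"
    proof (rule integral_cong_AE)
      show "AE y in lebesgue. f y / norm (x - y) = f' y / norm (x - y)"
        using AE_completion[OF ff] by eventually_elim simp
      have "(\<lambda>y. norm (x - y)) \<in> borel_measurable lebesgue" "f' \<in> borel_measurable lebesgue"
        by (auto intro!: measurable_completion)
      then show "(\<lambda>y. f y / norm (x - y)) \<in> borel_measurable lebesgue" "(\<lambda>y. f' y / norm (x - y)) \<in> borel_measurable lebesgue"
        using in_L_measurable[OF f] by (auto intro!: borel_measurable_divide)
    qed
    also have "\<dots> = (LINT y|lborel. f' y / norm (x - y))" by (rule integral_completion) measurable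
    finally show ?thesis .
  qed
  have phm [measurable]: "(\<lambda>x. LINT y|lborel. f' y / norm (x - y)) \<in> borel_measurable borel" by measurable
  have phl: "(\<lambda>x. LINT y|lborel. f' y / norm (x - y)) \<in> borel_measurable lebesgue" "g' \<in> borel_measurable lebesgue"
    by (auto intro!: measurable_completion)
  have ae: "AE x in lebesgue. (LINT y|lebesgue. f y / norm (x - y)) * g x = (LINT y|lborel. f' y / norm (x - y)) * g' x"
    using AE_completion[OF gg] by eventually_elim (simp add: ph)
  have fst: "(LINT y|lborel. ?H (x, y)) = (LINT y|lborel. f' y / norm (x - y)) * g' x" for x
  proof -
    have "(LINT y|lborel. ?H (x, y)) = (LINT y|lborel. f' y / norm (x - y) * g' x)"
      by (intro Bochner_Integration.integral_cong) auto
    also have "\<dots> = (LINT y|lborel. f' y / norm (x - y)) * g' x" by (rule integral_mult_left_zero)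
    finally show ?thesis .
  qed
  have "integrable lborel (\<lambda>x. (LINT y|lborel. f' y / norm (x - y)) * g' x)"
    using lborel_pair.integrable_fst'[OF i] unfolding fst .
  then have "integrable lebesgue (\<lambda>x. (LINT y|lborel. f' y / norm (x - y)) * g' x)"
    by (simp add: integrable_completion)
  then show "integrable lebesgue (\<lambda>x. (LINT y|lebesgue. f y / norm (x - y)) * g x)"
    by (rule integrable_cong_AE_imp) (use phl in_L_measurable[OF g] ae in \<open>auto simp: ph intro!: borel_measurable_times\<close>)
  have "newton_form f g = (LINT x|lebesgue. (LINT y|lborel. f' y / norm (x - y)) * g' x)"
    unfolding newton_form_def using phl in_L_measurable[OF g] ae
    by (intro integral_cong_AE) (auto simp: ph intro!: borel_measurable_times)
  also have "\<dots> = (LINT x|lborel. (LINT y|lborel. f' y / norm (x - y)) * g' x)"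
    by (rule integral_completion) measurable
  also have "\<dots> = integral\<^sup>L (lborel \<Otimes>\<^sub>M lborel) ?H"
    using lborel_pair.integral_fst'[OF i] unfolding fst .
  finally show "newton_form f g = integral\<^sup>L (lborel \<Otimes>\<^sub>M lborel) ?H" .
qed

lemma newton_form_bounded: "bounded_form newton_form 3104"
  unfolding bounded_form_def
proof (intro conjI allI impI)
  fix f g h :: "real ^ 3 \<Rightarrow> real" and r assume f: "in_L (6/5) f" and g: "in_L (6/5) g"
  obtain f' where f': "f' \<in> borel_measurable borel" "AE x in lborel. f x = f' x"
    "(\<integral>\<^sup>+x. ennreal (\<bar>f' x\<bar> powr (6/5)) \<partial>lborel) = ennreal (mass (6/5) f)"
    using real_representative[OF f] by auto
  obtain g' where g': "g' \<in> borel_measurable borel" "AE x in lborel. g x = g' x"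
    "(\<integral>\<^sup>+x. ennreal (\<bar>g' x\<bar> powr (6/5)) \<partial>lborel) = ennreal (mass (6/5) g)"
    using real_representative[OF g] by auto
  note fg = newton_form_borel[OF f g f' g'] and gf = newton_form_borel[OF g f g' f']
  show "newton_form f g = newton_form g f"
  proof -
    have "newton_form f g = (LINT x|lborel. LINT y|lborel. f' y * g' x / norm (x - y))"
      using lborel_pair.integral_fst'[OF fg(1)] fg(3) by simp
    also have "\<dots> = (LINT y|lborel. LINT x|lborel. f' y * g' x / norm (x - y))"
      using fg(1) by (intro lborel_pair.Fubini_integral[symmetric]) simp
    also have "\<dots> = (LINT y|lborel. LINT x|lborel. g' x * f' y / norm (y - x))"
      by (simp add: norm_minus_commute mult.commute)
    also have "\<dots> = newton_form g f"
      using lborel_pair.integral_fst'[OF gf(1)] gf(3) by simp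
    finally show ?thesis .
  qed
  show "newton_form f (\<lambda>x. g x + r * h x) = newton_form f g + r * newton_form f h" if h: "in_L (6/5) h"
  proof -
    obtain h' where h': "h' \<in> borel_measurable borel" "AE x in lborel. h x = h' x"
      "(\<integral>\<^sup>+x. ennreal (\<bar>h' x\<bar> powr (6/5)) \<partial>lborel) = ennreal (mass (6/5) h)"
      using real_representative[OF h] by auto
    have e: "(LINT y|lebesgue. f y / norm (x - y)) * (g x + r * h x)
      = (LINT y|lebesgue. f y / norm (x - y)) * g x + r * ((LINT y|lebesgue. f y / norm (x - y)) * h x)" for x
      by (simp add: algebra_simps)
    show ?thesis unfolding newton_form_def e
      using fg(2) newton_form_borel(2)[OF f h f' h'] by simp
  qed
  show "\<bar>newton_form f g\<bar> \<le> 3104" if "mass (6/5) f \<le> 1" "mass (6/5) g \<le> 1"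
    unfolding fg(3) by (rule newton_integrable_normalised(2)) (use f' g' that in auto)
qed

section \<open>The Riesz representation theorem\<close>

lemma quadratic_nonneg_imp_zero:
  fixes x b :: real
  assumes q: "\<And>t. 0 \<le> 2 * t * x + t\<^sup>2 * b" and b: "0 \<le> b"
  shows "x = 0"
proof -
  define t where "t = - x / (b + 1)"
  have x: "x = - (b + 1) * t" using b by (simp add: t_def field_simps)
  have "2 * t * x + t\<^sup>2 * b = - (b + 2) * t\<^sup>2" unfolding x by (simp add: power2_eq_square algebra_simps)
  with q[of t] b have "t\<^sup>2 = 0" by (auto simp: zero_le_mult_iff)
  then show ?thesis by (simp add: x)
qed

text \<open>The representing vector is the minimiser of \<open>B v v - 2 L v\<close>; by the parallelogram law, a fast
  minimising sequence is a fast Cauchy sequence. Completeness is asked for only along such sequences.\<close>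

lemma riesz_representation:
  fixes V :: "('x \<Rightarrow> real) set" and B :: "('x \<Rightarrow> real) \<Rightarrow> ('x \<Rightarrow> real) \<Rightarrow> real" and L :: "('x \<Rightarrow> real) \<Rightarrow> real"
  assumes V0: "V \<noteq> {}" and V: "\<And>u v r. u \<in> V \<Longrightarrow> v \<in> V \<Longrightarrow> (\<lambda>x. u x + r * v x) \<in> V"
    and sym: "\<And>u v. u \<in> V \<Longrightarrow> v \<in> V \<Longrightarrow> B u v = B v u"
    and lin: "\<And>u v w r. u \<in> V \<Longrightarrow> v \<in> V \<Longrightarrow> w \<in> V \<Longrightarrow> B u (\<lambda>x. v x + r * w x) = B u v + r * B u w"
    and pos: "\<And>u. u \<in> V \<Longrightarrow> 0 \<le> B u u"
    and L: "\<And>u v r. u \<in> V \<Longrightarrow> v \<in> V \<Longrightarrow> L (\<lambda>x. u x + r * v x) = L u + r * L v"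
    and bound: "\<And>u. u \<in> V \<Longrightarrow> 2 * L u \<le> C + B u u"
    and complete: "\<And>s. (\<And>k. s k \<in> V) \<Longrightarrow>
        (\<And>k. B (\<lambda>x. s (Suc k) x + (-1) * s k x) (\<lambda>x. s (Suc k) x + (-1) * s k x) \<le> (1/16) ^ k) \<Longrightarrow>
        \<exists>v\<in>V. (\<lambda>k. B (\<lambda>x. s k x + (-1) * v x) (\<lambda>x. s k x + (-1) * v x)) \<longlonglongrightarrow> 0"
  shows "\<exists>v\<in>V. \<forall>w\<in>V. B v w = L w"
proof -
  have B2: "B (\<lambda>x. u x + r * w x) (\<lambda>x. u x + r * w x) = B u u + 2 * r * B u w + r\<^sup>2 * B w w"
    if "u \<in> V" "w \<in> V" for u w r
    using that V by (simp add: lin sym[of "\<lambda>x. u x + r * w x"] sym[of w u] power2_eq_square algebra_simps)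
  have cs: "(B u w)\<^sup>2 \<le> B u u * B w w" if u: "u \<in> V" and w: "w \<in> V" for u w
  proof -
    have p: "0 \<le> B u u + 2 * r * B u w + r\<^sup>2 * B w w" for r
      using pos[OF V[OF u w, of r]] B2[OF u w, of r] by simp
    show ?thesis
    proof (cases "B w w = 0")
      case True
      have "B u w = 0"
      proof (rule ccontr)
        assume nz: "B u w \<noteq> 0"
        show False using p[of "- (B u u + 1) / (2 * B u w)"] True nz by (simp add: field_simps)
      qed
      then show ?thesis using pos[OF u] True by simp
    next
      case False
      then have "B w w > 0" using pos[OF w] by simp
      then show ?thesis using p[of "- B u w / B w w"]
        by (simp add: power2_eq_square field_simps)
    qed
  qed
  define J where "J v = B v v - 2 * L v" for v
  have Jlin: "J (\<lambda>x. u x + r * w x) = J u + 2 * r * (B u w - L w) + r\<^sup>2 * B w w" if "u \<in> V" "w \<in> V" for u w r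
    using that by (simp add: J_def B2 L algebra_simps)
  have bdd: "bdd_below (J ` V)"
  proof (rule bdd_belowI2)
    show "- C \<le> J v" if "v \<in> V" for v using bound[OF that] by (simp add: J_def)
  qed
  define m where "m = Inf (J ` V)"
  have m: "m \<le> J v" if "v \<in> V" for v unfolding m_def using bdd that by (intro cInf_lower) auto
  have "\<exists>v\<in>V. J v < m + (1/16) ^ k / 4" for k
    using cInf_lessD[of "J ` V" "m + (1/16) ^ k / 4"] V0 by (auto simp: m_def)
  then obtain s where s: "\<And>k. s k \<in> V" "\<And>k. J (s k) < m + (1/16) ^ k / 4" by metis
  have "B (\<lambda>x. s (Suc k) x + (-1) * s k x) (\<lambda>x. s (Suc k) x + (-1) * s k x) \<le> (1/16) ^ k" for k
  proof -
    define d where "d = (\<lambda>x. s (Suc k) x + (-1) * s k x)"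
    have d: "d \<in> V" unfolding d_def by (rule V[OF s(1) s(1)])
    have "(\<lambda>x. s k x + 1 * d x) = s (Suc k)" by (simp add: d_def)
    then have "J (s (Suc k)) = J (s k) + 2 * (B (s k) d - L d) + B d d"
      using Jlin[OF s(1) d, of k 1] by simp
    moreover have "m \<le> J (s k) + (B (s k) d - L d) + B d d / 4"
      using m[OF V[OF s(1) d, of k "1/2"]] Jlin[OF s(1) d, of k "1/2"] by (simp add: power2_eq_square)
    moreover have "(1/16::real) ^ Suc k \<le> (1/16) ^ k" by simp
    moreover have "D \<le> e" if "j' = j + 2 * y + D" "m \<le> j + y + D / 4" "e' \<le> e" "j < m + e / 4" "j' < m + e' / 4"
      for j j' y D e e' :: real using that by linarith
    ultimately have "B d d \<le> (1/16) ^ k" using s(2)[of k] s(2)[of "Suc k"] by blast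
    then show ?thesis by (simp add: d_def)
  qed
  from complete[OF s(1) this] obtain v where v: "v \<in> V"
    and lim: "(\<lambda>k. B (\<lambda>x. s k x + (-1) * v x) (\<lambda>x. s k x + (-1) * v x)) \<longlonglongrightarrow> 0" by blast
  have "B v w = L w" if w: "w \<in> V" for w
  proof -
    have conv: "(\<lambda>k. B (s k) w) \<longlonglongrightarrow> B v w"
    proof -
      have "(\<lambda>k. (B (s k) w - B v w)\<^sup>2) \<longlonglongrightarrow> 0"
      proof (rule tendsto_sandwich[OF _ _ tendsto_const])
        show "(\<lambda>k. B (\<lambda>x. s k x + (-1) * v x) (\<lambda>x. s k x + (-1) * v x) * B w w) \<longlonglongrightarrow> 0"
          using tendsto_mult_right[OF lim, of "B w w"] by simp
        have "(B (s k) w - B v w)\<^sup>2 \<le> B (\<lambda>x. s k x + (-1) * v x) (\<lambda>x. s k x + (-1) * v x) * B w w" for k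
        proof -
          have e: "(\<lambda>x. s k x + (-1) * v x) \<in> V" by (rule V[OF s(1) v])
          have "B (\<lambda>x. s k x + (-1) * v x) w = B (s k) w - B v w"
            using lin[OF w s(1)[of k] v, of "-1"] sym[OF w e] sym[OF w s(1)[of k]] sym[OF w v] by simp
          then show ?thesis using cs[OF e w] by simp
        qed
        then show "\<forall>\<^sub>F k in sequentially. (B (s k) w - B v w)\<^sup>2 \<le> B (\<lambda>x. s k x + (-1) * v x) (\<lambda>x. s k x + (-1) * v x) * B w w"
          by simp
      qed simp
      then have "(\<lambda>k. B (s k) w - B v w) \<longlonglongrightarrow> 0" by simp
      then show ?thesis by (simp add: LIM_zero_iff)
    qed
    have "0 \<le> 2 * t * (B v w - L w) + t\<^sup>2 * B w w" for t
    proof (rule LIMSEQ_le[rotated])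
      show "(\<lambda>k. 2 * t * (B (s k) w - L w) + t\<^sup>2 * B w w) \<longlonglongrightarrow> 2 * t * (B v w - L w) + t\<^sup>2 * B w w"
        by (intro tendsto_intros conv)
      have "- ((1/16) ^ k / 4) \<le> 2 * t * (B (s k) w - L w) + t\<^sup>2 * B w w" for k
        using m[OF V[OF s(1) w, of k t]] Jlin[OF s(1) w, of k t] s(2)[of k] by simp
      then show "\<exists>N. \<forall>k\<ge>N. - ((1/16) ^ k / 4) \<le> 2 * t * (B (s k) w - L w) + t\<^sup>2 * B w w" by blast
      have "(\<lambda>k. - ((1/16::real) ^ k / 4)) \<longlonglongrightarrow> - (0 / 4)"
        by (intro tendsto_intros LIMSEQ_realpow_zero) auto
      then show "(\<lambda>k. - ((1/16::real) ^ k / 4)) \<longlonglongrightarrow> 0" by simp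
    qed
    then have "B v w - L w = 0" using pos[OF w] by (rule quadratic_nonneg_imp_zero)
    then show ?thesis by simp
  qed
  with v show ?thesis by blast
qed

section \<open>Completeness of Lebesgue spaces\<close>

text \<open>If the increments \<open>d\<^sub>k\<close> are as small as \<open>4\<^sup>-\<^sup>k\<close> in \<open>L\<^sup>n\<close>, then \<open>S = (\<Sum>k. (2\<^sup>k \<bar>d\<^sub>k\<bar>)\<^sup>n)\<close> is integrable,
  and the pointwise bound \<open>\<bar>d\<^sub>k\<bar>\<^sup>n \<le> 2\<^sup>-\<^sup>k\<^sup>n S\<close> gives convergence almost everywhere and in norm.\<close>

lemma Ln_complete:
  fixes f :: "nat \<Rightarrow> real ^ 3 \<Rightarrow> 'b::euclidean_space"
  assumes m: "\<And>k. f k \<in> borel_measurable lebesgue" and n: "n > 0"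
    and d: "\<And>k. (\<integral>\<^sup>+x. ennreal (norm (f (Suc k) x - f k x) ^ n) \<partial>lebesgue) \<le> ennreal (A * (1/4) ^ (k * n))"
  shows "\<exists>F. F \<in> borel_measurable lebesgue \<and> (\<lambda>k. \<integral>\<^sup>+x. ennreal (norm (f k x - F x) ^ n) \<partial>lebesgue) \<longlonglongrightarrow> 0"
proof -
  define S where "S x = (\<Sum>k. ennreal ((2 ^ k * norm (f (Suc k) x - f k x)) ^ n))" for x
  define F where "F x = f 0 x + (\<Sum>k. f (Suc k) x - f k x)" for x
  note m [measurable]
  have dm: "(\<lambda>x. f (Suc k) x - f k x) \<in> borel_measurable lebesgue" for k
    using m by (intro borel_measurable_diff)
  have Fm: "F \<in> borel_measurable lebesgue"
    unfolding F_def using m dm by (intro borel_measurable_add borel_measurable_suminf)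
  have nm: "(\<lambda>x. ennreal ((2 ^ k * norm (f (Suc k) x - f k x)) ^ n)) \<in> borel_measurable lebesgue" for k
    using dm[of k] by measurable
  have Sm: "S \<in> borel_measurable lebesgue" unfolding S_def using nm by (rule borel_measurable_suminf_order)
  have "integral\<^sup>N lebesgue S = (\<Sum>k. \<integral>\<^sup>+x. ennreal ((2 ^ k * norm (f (Suc k) x - f k x)) ^ n) \<partial>lebesgue)"
    unfolding S_def by (rule nn_integral_suminf[OF nm])
  also have "\<dots> \<le> (\<Sum>k. ennreal (\<bar>A\<bar> * (1/2) ^ k))"
  proof (rule suminf_le)
    fix k
    have "(\<integral>\<^sup>+x. ennreal ((2 ^ k * norm (f (Suc k) x - f k x)) ^ n) \<partial>lebesgue)
      = (\<integral>\<^sup>+x. ennreal ((2 ^ k) ^ n) * ennreal (norm (f (Suc k) x - f k x) ^ n) \<partial>lebesgue)"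
      by (simp add: power_mult_distrib ennreal_mult)
    also have "\<dots> = ennreal ((2 ^ k) ^ n) * (\<integral>\<^sup>+x. ennreal (norm (f (Suc k) x - f k x) ^ n) \<partial>lebesgue)"
      by (intro nn_integral_cmult) measurable
    also have "\<dots> \<le> ennreal ((2 ^ k) ^ n) * ennreal (A * (1/4) ^ (k * n))"
      by (intro mult_left_mono d) simp
    also have "\<dots> \<le> ennreal ((2 ^ k) ^ n) * ennreal (\<bar>A\<bar> * (1/4) ^ (k * n))"
      by (intro mult_left_mono ennreal_leI mult_right_mono) auto
    also have "\<dots> = ennreal (\<bar>A\<bar> * (1/2) ^ (k * n))"
    proof -
      have "((2::real) ^ k) ^ n * (\<bar>A\<bar> * (1/4) ^ (k * n)) = \<bar>A\<bar> * (2 * (1/4)) ^ (k * n)"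
        unfolding power_mult_distrib by (simp add: power_mult)
      then show ?thesis by (subst ennreal_mult[symmetric]) auto
    qed
    also have "\<dots> \<le> ennreal (\<bar>A\<bar> * (1/2) ^ k)"
      using n by (intro ennreal_leI mult_left_mono power_decreasing) auto
    finally show "(\<integral>\<^sup>+x. ennreal ((2 ^ k * norm (f (Suc k) x - f k x)) ^ n) \<partial>lebesgue) \<le> ennreal (\<bar>A\<bar> * (1/2) ^ k)" .
  qed auto
  also have "\<dots> = ennreal (\<bar>A\<bar> * (1 / (1 - 1/2)))"
  proof (rule suminf_ennreal_eq)
    show "(\<lambda>k. \<bar>A\<bar> * (1/2) ^ k) sums (\<bar>A\<bar> * (1 / (1 - 1/2)))" by (intro sums_mult geometric_sums) simp
  qed simp
  finally have Sfin: "integral\<^sup>N lebesgue S \<le> ennreal (2 * \<bar>A\<bar>)" by (simp add: mult.commute)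
  have pt: "ennreal (norm (f k x - F x) ^ n) \<le> ennreal ((2 * (1/2) ^ k) ^ n) * S x" for k x
  proof (cases "S x")
    case (real s)
    have term_le: "(2 ^ j * norm (f (Suc j) x - f j x)) ^ n \<le> s" for j
    proof -
      have "ennreal ((2 ^ j * norm (f (Suc j) x - f j x)) ^ n) = (\<Sum>i\<in>{j}. ennreal ((2 ^ i * norm (f (Suc i) x - f i x)) ^ n))" by simp
      also have "\<dots> \<le> S x" unfolding S_def by (rule sum_le_suminf) auto
      finally show ?thesis using real by simp
    qed
    define \<sigma> where "\<sigma> = root n s"
    have \<sigma>: "\<sigma> \<ge> 0" "\<sigma> ^ n = s" using real n by (auto simp: \<sigma>_def)
    have dj: "norm (f (Suc j) x - f j x) \<le> \<sigma> * (1/2) ^ j" for j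
    proof -
      have "2 ^ j * norm (f (Suc j) x - f j x) \<le> \<sigma>"
        using term_le[of j] \<sigma> n power_le_imp_le_base[of _ "n - 1" \<sigma>] by (simp del: power_Suc add: Suc_diff_1)
      then show ?thesis by (simp add: power_divide field_simps)
    qed
    have gs: "(\<lambda>j. \<sigma> * (1/2) ^ (j + k)) sums (\<sigma> * (1/2) ^ k * (1 / (1 - 1/2)))" for k
      using sums_mult[OF geometric_sums[of "1/2::real"], of "\<sigma> * (1/2) ^ k"] by (simp add: power_add mult_ac)
    have sn: "summable (\<lambda>j. norm (f (Suc j) x - f j x))"
      by (rule summable_comparison_test'[OF sums_summable[OF gs[of 0]], of 0]) (use dj in simp)
    have sd: "summable (\<lambda>j. f (Suc j) x - f j x)" using sn by (rule summable_norm_cancel)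
    have tel: "(\<Sum>j<k. f (Suc j) x - f j x) = f k x - f 0 x"
      by (induction k) auto
    have "F x - f k x = (\<Sum>j. f (Suc (j + k)) x - f (j + k) x)"
      unfolding F_def using suminf_split_initial_segment[OF sd, of k] tel by simp
    also have "norm \<dots> \<le> (\<Sum>j. norm (f (Suc (j + k)) x - f (j + k) x))"
      using summable_ignore_initial_segment[OF sn, of k] by (rule summable_norm)
    also have "\<dots> \<le> (\<Sum>j. \<sigma> * (1/2) ^ (j + k))"
      using summable_ignore_initial_segment[OF sn, of k] sums_summable[OF gs] dj by (intro suminf_le) auto
    also have "\<dots> = 2 * (1/2) ^ k * \<sigma>" using gs[of k] by (simp add: sums_iff)
    finally have "norm (f k x - F x) ^ n \<le> (2 * (1/2) ^ k * \<sigma>) ^ n"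
      by (intro power_mono) (auto simp: norm_minus_commute)
    also have "\<dots> = (2 * (1/2) ^ k) ^ n * s" using \<sigma> by (simp add: power_mult_distrib)
    finally have "norm (f k x - F x) ^ n \<le> (2 * (1/2) ^ k) ^ n * s" .
    from ennreal_leI[OF this] show ?thesis using real by (simp add: ennreal_mult)
  qed (simp add: ennreal_mult_top)
  have bound: "(\<integral>\<^sup>+x. ennreal (norm (f k x - F x) ^ n) \<partial>lebesgue) \<le> ennreal (2 ^ n * (2 * \<bar>A\<bar>) * (1/2) ^ k)" for k
  proof -
    have "(\<integral>\<^sup>+x. ennreal (norm (f k x - F x) ^ n) \<partial>lebesgue) \<le> (\<integral>\<^sup>+x. ennreal ((2 * (1/2) ^ k) ^ n) * S x \<partial>lebesgue)"
      by (intro nn_integral_mono pt)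
    also have "\<dots> = ennreal ((2 * (1/2) ^ k) ^ n) * integral\<^sup>N lebesgue S" by (rule nn_integral_cmult[OF Sm])
    also have "\<dots> \<le> ennreal (2 ^ n * (1/2) ^ k) * ennreal (2 * \<bar>A\<bar>)"
    proof (intro mult_mono Sfin ennreal_leI)
      have "((1/2::real) ^ k) ^ n \<le> ((1/2) ^ k) ^ 1"
        using n by (intro power_decreasing) (auto simp: power_le_one)
      then show "(2 * (1/2::real) ^ k) ^ n \<le> 2 ^ n * (1/2) ^ k"
        unfolding power_mult_distrib by (intro mult_left_mono) auto
    qed auto
    also have "\<dots> = ennreal (2 ^ n * (2 * \<bar>A\<bar>) * (1/2) ^ k)"
      by (subst ennreal_mult[symmetric]) (auto simp: mult_ac)
    finally show ?thesis .
  qed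
  have "(\<lambda>k. ennreal (2 ^ n * (2 * \<bar>A\<bar>) * (1/2) ^ k)) \<longlonglongrightarrow> ennreal (2 ^ n * (2 * \<bar>A\<bar>) * 0)"
    by (intro tendsto_ennrealI tendsto_mult tendsto_const LIMSEQ_realpow_zero) auto
  then have l: "(\<lambda>k. ennreal (2 ^ n * (2 * \<bar>A\<bar>) * (1/2) ^ k)) \<longlonglongrightarrow> 0"
    by (simp only: mult_zero_right ennreal_0)
  have "(\<lambda>k. \<integral>\<^sup>+x. ennreal (norm (f k x - F x) ^ n) \<partial>lebesgue) \<longlonglongrightarrow> 0"
    by (rule tendsto_sandwich[OF always_eventually[OF allI] always_eventually[OF allI] tendsto_const l])
       (rule zero_le, rule bound)
  with Fm show ?thesis by blast
qed

section \<open>Square integrable functions\<close>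

lemma mass_2: "mass 2 f = (LINT x|lebesgue. f x \<bullet> f x)"
  unfolding mass_def by (intro Bochner_Integration.integral_cong) (simp_all add: power2_norm_eq_inner)

lemma in_L_cong_AE:
  assumes "in_L q f" "g \<in> borel_measurable lebesgue" "AE x in lebesgue. f x = g x"
  shows "in_L q g"
  unfolding in_L_def
proof (intro conjI)
  show "integrable lebesgue (\<lambda>x. norm (g x) powr q)"
  proof (rule integrable_cong_AE_imp)
    show "integrable lebesgue (\<lambda>x. norm (f x) powr q)" using assms(1) by (simp add: in_L_def)
    show "(\<lambda>x. norm (g x) powr q) \<in> borel_measurable lebesgue" using assms(2) by measurable
    show "AE x in lebesgue. norm (f x) powr q = norm (g x) powr q"
      using assms(3) by eventually_elim simp
  qed
qed (rule assms)

lemma integrable_inner: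
  fixes f g :: "real ^ 3 \<Rightarrow> 'b::euclidean_space"
  assumes "in_L 2 f" "in_L 2 g"
  shows "integrable lebesgue (\<lambda>x. f x \<bullet> g x)"
proof (rule Bochner_Integration.integrable_bound)
  show "integrable lebesgue (\<lambda>x. norm (f x) powr 2 + norm (g x) powr 2)"
    using assms by (auto simp: in_L_def)
  show "(\<lambda>x. f x \<bullet> g x) \<in> borel_measurable lebesgue"
    using assms by (auto simp: in_L_def intro: borel_measurable_inner)
  show "AE x in lebesgue. norm (f x \<bullet> g x) \<le> norm (norm (f x) powr 2 + norm (g x) powr 2)"
  proof (rule AE_I2)
    fix x
    have "\<bar>f x \<bullet> g x\<bar> \<le> norm (f x) * norm (g x)" by (rule Cauchy_Schwarz_ineq2)
    also have "\<dots> \<le> (norm (f x))\<^sup>2 + (norm (g x))\<^sup>2"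
      using sum_squares_bound[of "norm (f x)" "norm (g x)"] mult_nonneg_nonneg[OF norm_ge_zero norm_ge_zero, of "f x" "g x"]
      unfolding mult.assoc by linarith
    finally show "norm (f x \<bullet> g x) \<le> norm (norm (f x) powr 2 + norm (g x) powr 2)" by simp
  qed
qed

lemma in_L_locally_integrable:
  fixes f :: "real ^ 3 \<Rightarrow> 'b::euclidean_space"
  assumes f: "in_L q f" and q: "1 \<le> q"
  shows "locally_integrable f"
  unfolding locally_integrable_def
proof (intro allI impI)
  fix S :: "(real ^ 3) set" assume S: "compact S"
  have Sm: "S \<in> sets lebesgue" "emeasure lebesgue S < \<infinity>"
    using emeasure_bounded_finite[OF compact_imp_bounded[OF S]] borel_compact[OF S] by auto
  have "integrable lebesgue (\<lambda>x. indicator S x *\<^sub>R f x)"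
  proof (rule Bochner_Integration.integrable_bound)
    show "integrable lebesgue (\<lambda>x. indicator S x + norm (f x) powr q)"
      using f Sm by (intro Bochner_Integration.integrable_add integrable_real_indicator) (auto simp: in_L_def)
    show "(\<lambda>x. indicator S x *\<^sub>R f x) \<in> borel_measurable lebesgue"
      using in_L_measurable[OF f] Sm by (intro borel_measurable_scaleR borel_measurable_indicator)
    show "AE x in lebesgue. norm (indicator S x *\<^sub>R f x) \<le> norm (indicator S x + norm (f x) powr q)"
    proof (rule AE_I2)
      fix x
      have "norm (f x) \<le> 1 + norm (f x) powr q"
      proof (cases "norm (f x) \<le> 1")
        case False
        then have "norm (f x) powr 1 \<le> norm (f x) powr q" using q by (intro powr_mono) auto
        then show ?thesis using False by simp
      qed (simp add: add_increasing2)
      then show "norm (indicator S x *\<^sub>R f x) \<le> norm (indicator S x + norm (f x) powr q)"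
        by (auto simp: indicator_def)
    qed
  qed
  then show "f absolutely_integrable_on S" by (simp add: set_integrable_def)
qed

lemma locally_integrable_lin:
  fixes f g :: "real ^ 3 \<Rightarrow> 'b::euclidean_space"
  assumes "locally_integrable f" "locally_integrable g"
  shows "locally_integrable (\<lambda>x. f x + r *\<^sub>R g x)"
  using assms unfolding locally_integrable_def
  by (intro allI impI set_integral_add set_integrable_scaleR_right) auto

section \<open>Weak derivatives\<close>

lemma has_weak_gradient_lin:
  assumes u: "has_weak_gradient u g" and v: "has_weak_gradient v h"
  shows "has_weak_gradient (\<lambda>x. u x + r * v x) (\<lambda>x. g x + r *\<^sub>R h x)"
  unfolding has_weak_gradient_def
proof (intro conjI allI impI)
  note U = has_weak_gradientD[OF u] and V = has_weak_gradientD[OF v]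
  show "locally_integrable (\<lambda>x. u x + r * v x)"
    using locally_integrable_lin[OF U(1) V(1), of r] by simp
  show "locally_integrable (\<lambda>x. g x + r *\<^sub>R h x)" by (rule locally_integrable_lin[OF U(2) V(2)])
  fix \<psi> i assume t: "test_function \<psi>"
  note pt = test_function_partial_deriv[OF t, of i]
  note iu = integrable_times_test_function[OF U(1) pt] and iv = integrable_times_test_function[OF V(1) pt]
  note ig = integrable_times_test_function[OF locally_integrable_component[OF U(2), of i] t]
    and ih = integrable_times_test_function[OF locally_integrable_component[OF V(2), of i] t]
  have "(LINT x|lebesgue. (u x + r * v x) * partial_deriv i \<psi> x)
     = (LINT x|lebesgue. u x * partial_deriv i \<psi> x + r * (v x * partial_deriv i \<psi> x))"
    by (simp add: algebra_simps)
  also have "\<dots> = (LINT x|lebesgue. u x * partial_deriv i \<psi> x) + r * (LINT x|lebesgue. v x * partial_deriv i \<psi> x)"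
    using iu iv by simp
  also have "\<dots> = - ((LINT x|lebesgue. (g x $ i) * \<psi> x) + r * (LINT x|lebesgue. (h x $ i) * \<psi> x))"
    unfolding U(3)[OF t] V(3)[OF t] by simp
  also have "(LINT x|lebesgue. (g x $ i) * \<psi> x) + r * (LINT x|lebesgue. (h x $ i) * \<psi> x)
     = (LINT x|lebesgue. (g x $ i) * \<psi> x + r * ((h x $ i) * \<psi> x))"
    using ig ih by simp
  also have "\<dots> = (LINT x|lebesgue. ((g x + r *\<^sub>R h x) $ i) * \<psi> x)"
    by (simp add: algebra_simps)
  finally show "(LINT x|lebesgue. (u x + r * v x) * partial_deriv i \<psi> x)
     = - (LINT x|lebesgue. ((g x + r *\<^sub>R h x) $ i) * \<psi> x)" .
qed

lemma has_weak_laplacian_lin: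
  assumes u: "has_weak_laplacian u g" and v: "has_weak_laplacian v h"
  shows "has_weak_laplacian (\<lambda>x. u x + r * v x) (\<lambda>x. g x + r * h x)"
  unfolding has_weak_laplacian_def
proof (intro conjI allI impI)
  note U = has_weak_laplacianD[OF u] and V = has_weak_laplacianD[OF v]
  show "locally_integrable (\<lambda>x. u x + r * v x)"
    using locally_integrable_lin[OF U(1) V(1), of r] by simp
  show "locally_integrable (\<lambda>x. g x + r * h x)" using locally_integrable_lin[OF U(2) V(2), of r] by simp
  fix \<psi> assume t: "test_function \<psi>"
  note iu = laplacian_integral[OF U(1) t] and iv = laplacian_integral[OF V(1) t]
  note ig = integrable_times_test_function[OF U(2) t] and ih = integrable_times_test_function[OF V(2) t]
  have "(LINT x|lebesgue. (u x + r * v x) * laplacian \<psi> x)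
     = (LINT x|lebesgue. u x * laplacian \<psi> x + r * (v x * laplacian \<psi> x))"
    by (simp add: algebra_simps)
  also have "\<dots> = (LINT x|lebesgue. g x * \<psi> x) + r * (LINT x|lebesgue. h x * \<psi> x)"
    using iu iv U(3)[OF t] V(3)[OF t] by simp
  also have "\<dots> = (LINT x|lebesgue. g x * \<psi> x + r * (h x * \<psi> x))"
    using ig ih by simp
  also have "\<dots> = (LINT x|lebesgue. (g x + r * h x) * \<psi> x)"
    by (simp add: algebra_simps)
  finally show "(LINT x|lebesgue. (u x + r * v x) * laplacian \<psi> x) = (LINT x|lebesgue. (g x + r * h x) * \<psi> x)" .
qed

text \<open>By uniqueness up to null sets, the selected weak derivative is square integrable as soon as
  some weak derivative is.\<close>

definition has_L2_gradient :: "(real ^ 3 \<Rightarrow> real) \<Rightarrow> bool" where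
  "has_L2_gradient u \<longleftrightarrow> has_weak_gradient u (weak_gradient u) \<and> in_L 2 (weak_gradient u)"

definition has_L2_laplacian :: "(real ^ 3 \<Rightarrow> real) \<Rightarrow> bool" where
  "has_L2_laplacian u \<longleftrightarrow> has_weak_laplacian u (weak_laplacian u) \<and> in_L 2 (weak_laplacian u)"

lemma has_L2_gradientI:
  assumes "has_weak_gradient u g" "in_L 2 g" shows "has_L2_gradient u"
proof -
  have w: "has_weak_gradient u (weak_gradient u)"
    unfolding weak_gradient_def by (rule someI[where P = "has_weak_gradient u", OF assms(1)])
  then have "in_L 2 (weak_gradient u)"
    using has_weak_gradientD(2)[OF w] weak_gradient_unique[OF assms(1) w]
    by (intro in_L_cong_AE[OF assms(2)] locally_integrable_measurable)
  with w show ?thesis by (simp add: has_L2_gradient_def)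
qed

lemma has_L2_laplacianI:
  assumes "has_weak_laplacian u g" "in_L 2 g" shows "has_L2_laplacian u"
proof -
  have w: "has_weak_laplacian u (weak_laplacian u)"
    unfolding weak_laplacian_def by (rule someI[where P = "has_weak_laplacian u", OF assms(1)])
  then have "in_L 2 (weak_laplacian u)"
    using has_weak_laplacianD(2)[OF w] weak_laplacian_unique[OF assms(1) w]
    by (intro in_L_cong_AE[OF assms(2)] locally_integrable_measurable)
  with w show ?thesis by (simp add: has_L2_laplacian_def)
qed

lemma L2_gradient_lin:
  assumes "has_L2_gradient u" "has_L2_gradient v"
  shows "has_L2_gradient (\<lambda>x. u x + r * v x)"
    and "AE x in lebesgue. weak_gradient (\<lambda>x. u x + r * v x) x = weak_gradient u x + r *\<^sub>R weak_gradient v x"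
proof -
  have l: "has_weak_gradient (\<lambda>x. u x + r * v x) (\<lambda>x. weak_gradient u x + r *\<^sub>R weak_gradient v x)"
    using assms by (intro has_weak_gradient_lin) (auto simp: has_L2_gradient_def)
  show L: "has_L2_gradient (\<lambda>x. u x + r * v x)"
    using assms by (intro has_L2_gradientI[OF l] in_L_lin) (auto simp: has_L2_gradient_def)
  show "AE x in lebesgue. weak_gradient (\<lambda>x. u x + r * v x) x = weak_gradient u x + r *\<^sub>R weak_gradient v x"
    using L l by (intro weak_gradient_unique) (auto simp: has_L2_gradient_def)
qed

lemma L2_laplacian_lin:
  assumes "has_L2_laplacian u" "has_L2_laplacian v"
  shows "has_L2_laplacian (\<lambda>x. u x + r * v x)"
    and "AE x in lebesgue. weak_laplacian (\<lambda>x. u x + r * v x) x = weak_laplacian u x + r * weak_laplacian v x"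
proof -
  have l: "has_weak_laplacian (\<lambda>x. u x + r * v x) (\<lambda>x. weak_laplacian u x + r * weak_laplacian v x)"
    using assms by (intro has_weak_laplacian_lin) (auto simp: has_L2_laplacian_def)
  show L: "has_L2_laplacian (\<lambda>x. u x + r * v x)"
    using assms by (intro has_L2_laplacianI[OF l] in_L_lin_real) (auto simp: has_L2_laplacian_def)
  show "AE x in lebesgue. weak_laplacian (\<lambda>x. u x + r * v x) x = weak_laplacian u x + r * weak_laplacian v x"
    using L l by (intro weak_laplacian_unique) (auto simp: has_L2_laplacian_def)
qed

lemma integral_inner_lin:
  fixes f g h k :: "real ^ 3 \<Rightarrow> 'b::euclidean_space"
  assumes "in_L 2 f" "in_L 2 g" "in_L 2 h" "k \<in> borel_measurable lebesgue"
    and "AE x in lebesgue. k x = g x + r *\<^sub>R h x"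
  shows "(LINT x|lebesgue. f x \<bullet> k x) = (LINT x|lebesgue. f x \<bullet> g x) + r * (LINT x|lebesgue. f x \<bullet> h x)"
proof -
  have m: "f \<in> borel_measurable lebesgue" "g \<in> borel_measurable lebesgue" "h \<in> borel_measurable lebesgue"
    using assms by (auto dest: in_L_measurable)
  have "(LINT x|lebesgue. f x \<bullet> k x) = (LINT x|lebesgue. f x \<bullet> g x + r * (f x \<bullet> h x))"
  proof (rule integral_cong_AE)
    show "AE x in lebesgue. f x \<bullet> k x = f x \<bullet> g x + r * (f x \<bullet> h x)"
      using assms(5) by eventually_elim (simp add: inner_add_right)
  qed (use m assms(4) in \<open>auto intro!: borel_measurable_inner borel_measurable_add borel_measurable_times\<close>)
  also have "\<dots> = (LINT x|lebesgue. f x \<bullet> g x) + r * (LINT x|lebesgue. f x \<bullet> h x)"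
    using integrable_inner[OF assms(1,2)] integrable_inner[OF assms(1,3)] by simp
  finally show ?thesis .
qed

definition dirichlet :: "(real ^ 3 \<Rightarrow> real) \<Rightarrow> (real ^ 3 \<Rightarrow> real) \<Rightarrow> real" where
  "dirichlet u v = (LINT x|lebesgue. weak_gradient u x \<bullet> weak_gradient v x)"

lemma dirichlet_lin:
  assumes "has_L2_gradient u" "has_L2_gradient v" "has_L2_gradient w"
  shows "dirichlet u (\<lambda>x. v x + r * w x) = dirichlet u v + r * dirichlet u w"
  unfolding dirichlet_def using assms L2_gradient_lin[OF assms(2,3), of r]
  by (intro integral_inner_lin) (auto simp: has_L2_gradient_def dest: in_L_measurable)

lemma dirichlet_commute: "dirichlet u v = dirichlet v u"
  by (simp add: dirichlet_def inner_commute)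

lemma dirichlet_self: "dirichlet u u = mass 2 (weak_gradient u)"
  by (simp add: dirichlet_def mass_2)

lemma Sobolev_L6:
  assumes g: "has_L2_gradient u" and u: "in_L 2 u \<or> in_L 6 u"
  shows "in_L 6 u" and "mass 6 u \<le> 4096 * (dirichlet u u) ^ 3"
proof -
  have w: "has_weak_gradient u (weak_gradient u)" "in_L 2 (weak_gradient u)"
    using g by (auto simp: has_L2_gradient_def)
  have m: "u \<in> borel_measurable lebesgue" using has_weak_gradientD(1)[OF w(1)] by (rule locally_integrable_measurable)
  have 6: "norm (u x) powr 6 = u x ^ 6" for x by simp
  have "(\<integral>\<^sup>+x. ennreal (u x ^ 2) \<partial>lebesgue) < \<infinity> \<or> (\<integral>\<^sup>+x. ennreal (u x ^ 6) \<partial>lebesgue) < \<infinity>"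
    using u in_L_nn_integral[of 2 u] in_L_nn_integral[of 6 u] by auto
  from Sobolev_inequality[OF w(1) this]
  have "(\<integral>\<^sup>+x. ennreal (norm (u x) powr 6) \<partial>lebesgue) \<le> 4096 * ennreal (mass 2 (weak_gradient u)) ^ 3"
    using in_L_nn_integral[OF w(2)] by simp
  also have "\<dots> = ennreal (4096 * (dirichlet u u) ^ 3)"
    by (simp add: dirichlet_self ennreal_power mass_nonneg ennreal_mult)
  finally have b: "(\<integral>\<^sup>+x. ennreal (norm (u x) powr 6) \<partial>lebesgue) \<le> ennreal (4096 * (dirichlet u u) ^ 3)" .
  show "in_L 6 u" "mass 6 u \<le> 4096 * (dirichlet u u) ^ 3"
    using in_L_I[OF m b] by (auto simp: dirichlet_self mass_nonneg)
qed

section \<open>The operator \<open>- \<Delta> + a\<^sup>2 \<Delta>\<^sup>2\<close>\<close>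

lemma D_space_iff: "\<phi> \<in> D_space \<longleftrightarrow> in_L 6 \<phi> \<and> has_L2_gradient \<phi> \<and> has_L2_laplacian \<phi>"
proof
  assume "\<phi> \<in> D_space"
  then obtain g h where "in_L 6 \<phi>" "has_weak_gradient \<phi> g" "in_L 2 g" "has_weak_laplacian \<phi> h" "in_L 2 h"
    by (auto simp: D_space_def D12_def)
  then show "in_L 6 \<phi> \<and> has_L2_gradient \<phi> \<and> has_L2_laplacian \<phi>"
    by (auto intro: has_L2_gradientI has_L2_laplacianI)
qed (auto simp: D_space_def D12_def has_L2_gradient_def has_L2_laplacian_def)

lemma D_space_lin:
  assumes "u \<in> D_space" "v \<in> D_space" shows "(\<lambda>x. u x + r * v x) \<in> D_space"
  using assms by (auto simp: D_space_iff intro: in_L_lin_real L2_gradient_lin(1) L2_laplacian_lin(1))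

lemma in_L_zero: "in_L q (\<lambda>x. 0 :: 'b::euclidean_space)"
  by (simp add: in_L_def)

lemma locally_integrable_zero: "locally_integrable (\<lambda>x. 0 :: 'b::euclidean_space)"
  by (simp add: locally_integrable_def)

lemma D_space_zero: "(\<lambda>x. 0) \<in> D_space"
proof -
  have g: "has_weak_gradient (\<lambda>x. 0) (\<lambda>x. 0)" and l: "has_weak_laplacian (\<lambda>x. 0) (\<lambda>x. 0)"
    by (simp_all add: has_weak_gradient_def has_weak_laplacian_def locally_integrable_zero)
  show ?thesis unfolding D_space_iff
    using has_L2_gradientI[OF g in_L_zero] has_L2_laplacianI[OF l in_L_zero] in_L_zero by blast
qed

definition D_form :: "real \<Rightarrow> (real ^ 3 \<Rightarrow> real) \<Rightarrow> (real ^ 3 \<Rightarrow> real) \<Rightarrow> real" where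
  "D_form a \<phi> \<psi> = dirichlet \<phi> \<psi> + a\<^sup>2 * (LINT x|lebesgue. weak_laplacian \<phi> x * weak_laplacian \<psi> x)"

lemma D_form_commute: "D_form a u v = D_form a v u"
  by (simp add: D_form_def dirichlet_commute mult.commute)

lemma D_form_self: "D_form a u u = mass 2 (weak_gradient u) + a\<^sup>2 * mass 2 (weak_laplacian u)"
  by (simp add: D_form_def dirichlet_self mass_2)

lemma D_form_nonneg: "0 \<le> D_form a u u"
  by (simp add: D_form_self mass_nonneg)

lemma dirichlet_le_D_form: "dirichlet u u \<le> D_form a u u"
  by (simp add: D_form_self dirichlet_self mass_nonneg)

lemma D_form_lin:
  assumes "u \<in> D_space" "v \<in> D_space" "w \<in> D_space"
  shows "D_form a u (\<lambda>x. v x + r * w x) = D_form a u v + r * D_form a u w"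
proof -
  have "(LINT x|lebesgue. weak_laplacian u x \<bullet> weak_laplacian (\<lambda>x. v x + r * w x) x)
      = (LINT x|lebesgue. weak_laplacian u x \<bullet> weak_laplacian v x) + r * (LINT x|lebesgue. weak_laplacian u x \<bullet> weak_laplacian w x)"
    using assms L2_laplacian_lin[of v w r]
    by (intro integral_inner_lin) (auto simp: D_space_iff has_L2_laplacian_def dest: in_L_measurable)
  then show ?thesis
    using assms by (simp add: D_form_def dirichlet_lin D_space_iff algebra_simps)
qed

lemma duality_bound:
  assumes f: "in_L (6/5) f" and g: "in_L 6 g"
  shows "integrable lebesgue (\<lambda>x. f x * g x)"
    and "0 < s \<Longrightarrow> \<bar>LINT x|lebesgue. f x * g x\<bar> \<le> s * mass (6/5) f + mass 6 g / s ^ 5"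
proof -
  have pt: "\<bar>f x * g x\<bar> \<le> s * norm (f x) powr (6/5) + norm (g x) powr 6 / s ^ 5" if "0 < s" for x s
    using weighted_young[of "\<bar>f x\<bar>" "\<bar>g x\<bar>" s] that by (simp add: abs_mult)
  have i: "integrable lebesgue (\<lambda>x. s * norm (f x) powr (6/5) + norm (g x) powr 6 / s ^ 5)" for s
    using f g by (intro Bochner_Integration.integrable_add integrable_mult_right integrable_divide) (auto simp: in_L_def)
  show ifg: "integrable lebesgue (\<lambda>x. f x * g x)"
    by (rule Bochner_Integration.integrable_bound[OF i[of 1]])
       (use in_L_measurable[OF f] in_L_measurable[OF g] pt[of 1] in \<open>auto intro!: borel_measurable_times intro: order_trans[OF _ abs_ge_self]\<close>)
  show "\<bar>LINT x|lebesgue. f x * g x\<bar> \<le> s * mass (6/5) f + mass 6 g / s ^ 5" if "0 < s"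
  proof -
    have "\<bar>LINT x|lebesgue. f x * g x\<bar> \<le> (LINT x|lebesgue. \<bar>f x * g x\<bar>)" by (rule integral_abs_bound)
    also have "\<dots> \<le> (LINT x|lebesgue. s * norm (f x) powr (6/5) + norm (g x) powr 6 / s ^ 5)"
      using pt[OF that] ifg i by (intro integral_mono integrable_abs)
    also have "\<dots> = s * mass (6/5) f + mass 6 g / s ^ 5"
      using f g by (simp add: mass_def in_L_def)
    finally show ?thesis .
  qed
qed

text \<open>The constant that arises from the inequality between arithmetic and geometric means in
  \<open>source_bound\<close>.\<close>

definition D_bound :: "real \<Rightarrow> real" where
  "D_bound M = 16 * pi\<^sup>2 * (M + 4096)\<^sup>2 + 1"

text \<open>By the Sobolev inequality, \<open>\<psi> \<mapsto> \<integral> f \<psi>\<close> is bounded with respect to the Dirichlet norm; the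
  scaling parameter of Young's inequality is the square root of \<open>1 + \<bar>\<nabla> \<psi>\<bar>\<^sup>2\<close>.\<close>

lemma source_bound:
  assumes f: "in_L (6/5) f" and \<psi>: "\<psi> \<in> D_space"
  shows "2 * \<bar>4 * pi * (LINT x|lebesgue. f x * \<psi> x)\<bar> \<le> D_bound (mass (6/5) f) + D_form a \<psi> \<psi>"
proof -
  have \<psi>6: "in_L 6 \<psi>" "mass 6 \<psi> \<le> 4096 * (dirichlet \<psi> \<psi>) ^ 3"
    using \<psi> Sobolev_L6(2)[of \<psi>] by (auto simp: D_space_iff)
  define b where "b = dirichlet \<psi> \<psi>"
  define M where "M = mass (6/5) f"
  have b: "0 \<le> b" "b \<le> D_form a \<psi> \<psi>" and M: "0 \<le> M"
    using dirichlet_le_D_form by (auto simp: b_def M_def dirichlet_self mass_nonneg)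
  define s where "s = sqrt (b + 1)"
  have s: "s > 0" "s\<^sup>2 = b + 1" using b by (auto simp: s_def)
  have "mass 6 \<psi> / s ^ 5 \<le> 4096 * s"
  proof -
    have "b ^ 3 \<le> (s\<^sup>2) ^ 3" using b s by (intro power_mono) auto
    also have "\<dots> = s * s ^ 5" by (simp add: eval_nat_numeral)
    finally have "mass 6 \<psi> \<le> 4096 * s * s ^ 5" using \<psi>6 by (simp add: b_def)
    then show ?thesis using s by (simp add: divide_le_eq)
  qed
  then have "\<bar>LINT x|lebesgue. f x * \<psi> x\<bar> \<le> s * M + 4096 * s"
    using duality_bound(2)[OF f \<psi>6(1) s(1)] by (simp add: M_def)
  then have "(8 * pi) * \<bar>LINT x|lebesgue. f x * \<psi> x\<bar> \<le> (8 * pi) * (s * M + 4096 * s)"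
    by (rule mult_left_mono) simp
  then have "2 * (4 * pi * \<bar>LINT x|lebesgue. f x * \<psi> x\<bar>) \<le> 2 * (4 * pi * (M + 4096) * s)"
    by (simp add: algebra_simps)
  also have "\<dots> \<le> (4 * pi * (M + 4096))\<^sup>2 + s\<^sup>2"
    using sum_squares_bound[of "4 * pi * (M + 4096)" s] by (simp add: mult_ac)
  also have "\<dots> = D_bound M + b" using s by (simp add: D_bound_def power_mult_distrib)
  finally show ?thesis using b by (simp add: abs_mult M_def)
qed

text \<open>Convergence in some \<open>L\<^sup>n\<close> suffices to pass to the limit in the weak formulations, as
  \<open>\<bar>t\<bar> \<le> e + \<bar>t\<bar>\<^sup>n / e\<^sup>n\<^sup>-\<^sup>1\<close> and test functions have bounded support.\<close>

lemma tendsto_integral_test: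
  fixes f :: "nat \<Rightarrow> real ^ 3 \<Rightarrow> real"
  assumes f: "\<And>k. locally_integrable (f k)" and F: "locally_integrable F"
    and lim: "(\<lambda>k. \<integral>\<^sup>+x. ennreal (\<bar>f k x - F x\<bar> ^ Suc n) \<partial>lebesgue) \<longlonglongrightarrow> 0"
    and \<psi>: "test_function \<psi>"
  shows "(\<lambda>k. LINT x|lebesgue. f k x * \<psi> x) \<longlonglongrightarrow> (LINT x|lebesgue. F x * \<psi> x)"
proof -
  obtain a b M where M: "\<And>x. \<bar>\<psi> x\<bar> \<le> M * indicator (cbox a b) x" "0 \<le> M" "\<psi> \<in> borel_measurable lebesgue"
    using test_function_bounded_support[OF \<psi>] by metis
  define V where "V = measure lebesgue (cbox a b)"
  have V: "emeasure lebesgue (cbox a b) = ennreal V" "0 \<le> V"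
    by (auto simp: V_def emeasure_eq_ennreal_measure emeasure_lborel_cbox_eq)
  note i = integrable_times_test_function[OF f \<psi>] integrable_times_test_function[OF F \<psi>]
  have key: "\<bar>(LINT x|lebesgue. f k x * \<psi> x) - (LINT x|lebesgue. F x * \<psi> x)\<bar> \<le> M * (e * V + e)"
    if e: "e > 0" and le: "(\<integral>\<^sup>+x. ennreal (\<bar>f k x - F x\<bar> ^ Suc n) \<partial>lebesgue) \<le> ennreal (e * e ^ n)" for k e
  proof -
    have m: "(\<lambda>x. \<bar>f k x - F x\<bar> ^ Suc n) \<in> borel_measurable lebesgue"
      using f F by (intro borel_measurable_power borel_measurable_abs borel_measurable_diff locally_integrable_measurable)
    have "(\<integral>\<^sup>+x. ennreal (norm (\<bar>f k x - F x\<bar> ^ Suc n)) \<partial>lebesgue) < \<infinity>"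
      using le_less_trans[OF le, of \<infinity>] by (simp add: abs_mult power_abs)
    then have ip: "integrable lebesgue (\<lambda>x. \<bar>f k x - F x\<bar> ^ Suc n)"
      using m by (intro integrableI_bounded)
    have "ennreal (LINT x|lebesgue. \<bar>f k x - F x\<bar> ^ Suc n) \<le> ennreal (e * e ^ n)"
      using le by (subst (asm) nn_integral_eq_integral[OF ip]) auto
    then have le': "(LINT x|lebesgue. \<bar>f k x - F x\<bar> ^ Suc n) \<le> e * e ^ n"
      using e by (subst (asm) ennreal_le_iff) auto
    have pt: "\<bar>f k x * \<psi> x - F x * \<psi> x\<bar> \<le> M * (e * indicator (cbox a b) x + \<bar>f k x - F x\<bar> ^ Suc n / e ^ n)" for x
    proof -
      define t where "t = \<bar>f k x - F x\<bar>"
      have t: "t \<le> e + t ^ Suc n / e ^ n"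
      proof (cases "t \<le> e")
        case False
        then have "e ^ n \<le> t ^ n" using e by (intro power_mono) auto
        then have "t * e ^ n \<le> t * t ^ n" using False e by (intro mult_left_mono) auto
        then have "t \<le> t ^ Suc n / e ^ n" using e by (simp add: pos_le_divide_eq)
        then show ?thesis using e by simp
      qed (use e in \<open>simp add: t_def add_increasing2\<close>)
      have "\<bar>f k x * \<psi> x - F x * \<psi> x\<bar> = t * \<bar>\<psi> x\<bar>" by (simp add: t_def abs_mult flip: left_diff_distrib)
      also have "\<dots> \<le> t * (M * indicator (cbox a b) x)" using M(1) by (intro mult_left_mono) (auto simp: t_def)
      also have "\<dots> \<le> M * (e * indicator (cbox a b) x + t ^ Suc n / e ^ n)"
      proof (cases "x \<in> cbox a b")
        case True
        then show ?thesis using mult_right_mono[OF t M(2)] by (simp add: mult.commute)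
      next
        case False
        have "0 \<le> t" by (simp add: t_def)
        then show ?thesis using False M(2) e by (simp add: mult_nonneg_nonneg)
      qed
      finally show ?thesis by (simp add: t_def)
    qed
    have ind: "integrable lebesgue (indicator (cbox a b) :: _ \<Rightarrow> real)"
      using V by (intro integrable_real_indicator) auto
    have "\<bar>(LINT x|lebesgue. f k x * \<psi> x) - (LINT x|lebesgue. F x * \<psi> x)\<bar> = \<bar>LINT x|lebesgue. f k x * \<psi> x - F x * \<psi> x\<bar>"
      using i by simp
    also have "\<dots> \<le> (LINT x|lebesgue. \<bar>f k x * \<psi> x - F x * \<psi> x\<bar>)" by (rule integral_abs_bound)
    also have "\<dots> \<le> (LINT x|lebesgue. M * (e * indicator (cbox a b) x + \<bar>f k x - F x\<bar> ^ Suc n / e ^ n))"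
      using i ip ind pt by (intro integral_mono integrable_abs Bochner_Integration.integrable_diff
        integrable_mult_right Bochner_Integration.integrable_add integrable_divide)
    also have "\<dots> = M * (e * V + (LINT x|lebesgue. \<bar>f k x - F x\<bar> ^ Suc n) / e ^ n)"
      using ip ind by (simp add: V_def del: power_Suc)
    also have "\<dots> \<le> M * (e * V + e)"
      using le' e M(2) by (intro mult_left_mono add_left_mono) (auto simp: pos_divide_le_eq)
    finally show ?thesis .
  qed
  show ?thesis
  proof (rule LIMSEQ_I)
    fix r :: real assume r: "r > 0"
    define P where "P = M * (V + 1) + 1"
    define e where "e = r / (2 * P)"
    have p: "P > 0" using M V by (simp add: P_def add_nonneg_pos)
    then have e: "e > 0" using r by (simp add: e_def)
    have "M * (e * V + e) = e * (P - 1)" by (simp add: P_def algebra_simps)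
    also have "\<dots> \<le> e * P" using e by (intro mult_left_mono) auto
    also have "\<dots> < r" using p r by (simp add: e_def)
    finally have lt: "M * (e * V + e) < r" .
    have "0 < ennreal (e * e ^ n)" using e by simp
    from order_tendstoD(2)[OF lim this] obtain N where
      "\<And>k. k \<ge> N \<Longrightarrow> (\<integral>\<^sup>+x. ennreal (\<bar>f k x - F x\<bar> ^ Suc n) \<partial>lebesgue) < ennreal (e * e ^ n)"
      by (auto simp: eventually_sequentially)
    then show "\<exists>N. \<forall>k\<ge>N. norm ((LINT x|lebesgue. f k x * \<psi> x) - (LINT x|lebesgue. F x * \<psi> x)) < r"
      using key[OF e] lt by (intro exI[of _ N]) (auto dest: less_imp_le intro: le_less_trans)
  qed
qed

lemma mass_cong_AE:
  assumes "f \<in> borel_measurable lebesgue" "g \<in> borel_measurable lebesgue" "AE x in lebesgue. f x = g x"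
  shows "mass q f = mass q g"
  unfolding mass_def
proof (rule integral_cong_AE)
  show "AE x in lebesgue. norm (f x) powr q = norm (g x) powr q" using assms(3) by eventually_elim simp
qed (use assms in measurable)

lemma norm_powr_real: "0 < n \<Longrightarrow> norm y powr real n = norm y ^ n"
  by (cases "y = 0") (simp_all add: powr_realpow)

lemma Ln_limit:
  fixes f :: "nat \<Rightarrow> real ^ 3 \<Rightarrow> 'b::euclidean_space"
  assumes n: "0 < n" "q = real n" and f: "\<And>k. in_L q (f k)" and F: "F \<in> borel_measurable lebesgue"
    and lim: "(\<lambda>k. \<integral>\<^sup>+x. ennreal (norm (f k x - F x) ^ n) \<partial>lebesgue) \<longlonglongrightarrow> 0"
  shows "in_L q F" and "(\<lambda>k. mass q (\<lambda>x. f k x - F x)) \<longlonglongrightarrow> 0"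
proof -
  have eq: "norm y powr q = norm y ^ n" for y :: 'b using norm_powr_real[OF n(1)] n(2) by simp
  have m: "(\<lambda>x. f k x - F x) \<in> borel_measurable lebesgue" for k
    using in_L_measurable[OF f] F by (intro borel_measurable_diff)
  have "\<forall>\<^sub>F k in sequentially. (\<integral>\<^sup>+x. ennreal (norm (f k x - F x) ^ n) \<partial>lebesgue) < 1"
    using order_tendstoD(2)[OF lim, of 1] by simp
  then obtain k0 where k0: "(\<integral>\<^sup>+x. ennreal (norm (f k0 x - F x) ^ n) \<partial>lebesgue) < 1"
    using eventually_happens'[OF sequentially_bot] by blast
  have "in_L q (\<lambda>x. f k0 x - F x)"
    by (rule in_L_I(1)[OF m, of _ _ 1]) (use k0 in \<open>simp add: eq less_imp_le\<close>)
  from in_L_lin[OF f[of k0] this, of "-1"] show LF: "in_L q F" using n by simp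
  have L: "in_L q (\<lambda>x. f k x - F x)" for k
    using in_L_lin[OF f[of k] LF, of "-1"] n by simp
  have "(\<lambda>k. ennreal (mass q (\<lambda>x. f k x - F x))) \<longlonglongrightarrow> ennreal 0"
    using lim unfolding in_L_nn_integral[OF L, symmetric] eq by simp
  then show "(\<lambda>k. mass q (\<lambda>x. f k x - F x)) \<longlonglongrightarrow> 0"
    by (rule tendsto_ennrealD) (simp_all add: mass_nonneg)
qed

lemma laplacian_integral_sum:
  assumes "locally_integrable u" "test_function \<psi>"
  shows "(LINT x|lebesgue. u x * laplacian \<psi> x) = (\<Sum>i\<in>UNIV. LINT x|lebesgue. u x * partial_deriv i (partial_deriv i \<psi>) x)"
  unfolding laplacian_def sum_distrib_left
  by (intro Bochner_Integration.integral_sum integrable_times_test_function test_function_partial_deriv assms)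

text \<open>A sequence that is fast Cauchy for the form converges in \<open>L\<^sup>6\<close>, by the Sobolev inequality,
  together with its derivatives in \<open>L\<^sup>2\<close>; the limits of the derivatives are the weak derivatives of the
  limit.\<close>

lemma D_space_complete:
  assumes a: "a \<noteq> 0" and s: "\<And>k. s k \<in> D_space"
    and fast: "\<And>k. D_form a (\<lambda>x. s (Suc k) x + (-1) * s k x) (\<lambda>x. s (Suc k) x + (-1) * s k x) \<le> (1/16) ^ k"
  shows "\<exists>v\<in>D_space. (\<lambda>k. D_form a (\<lambda>x. s k x + (-1) * v x) (\<lambda>x. s k x + (-1) * v x)) \<longlonglongrightarrow> 0"
proof -
  define d where "d k = (\<lambda>x. s (Suc k) x + (-1) * s k x)" for k
  have d: "d k \<in> D_space" for k unfolding d_def by (rule D_space_lin[OF s s])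
  have sp: "in_L 6 (s k)" "has_L2_gradient (s k)" "has_L2_laplacian (s k)" for k
    using s by (auto simp: D_space_iff)
  have spm: "s k \<in> borel_measurable lebesgue" "weak_gradient (s k) \<in> borel_measurable lebesgue"
    "weak_laplacian (s k) \<in> borel_measurable lebesgue" for k
    using sp[of k] by (auto simp: has_L2_gradient_def has_L2_laplacian_def dest: in_L_measurable)
  have dp: "in_L 6 (d k)" "in_L 2 (weak_gradient (d k))" "in_L 2 (weak_laplacian (d k))" for k
    using d[of k] by (auto simp: D_space_iff has_L2_gradient_def has_L2_laplacian_def)
  have f: "mass 2 (weak_gradient (d k)) + a\<^sup>2 * mass 2 (weak_laplacian (d k)) \<le> (1/16) ^ k" for k
    using fast[of k] unfolding d_def[symmetric] D_form_self .
  have p4: "(1/16::real) ^ k = (1/4) ^ (k * 2)" for k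
    by (simp add: mult.commute[of k] power_mult power2_eq_square)
  have fg: "mass 2 (weak_gradient (d k)) \<le> 1 * (1/4) ^ (k * 2)" for k
    using f[of k] mass_nonneg[of 2 "weak_laplacian (d k)"] unfolding p4 by (smt (verit) mult_nonneg_nonneg zero_le_power2)
  have fl: "mass 2 (weak_laplacian (d k)) \<le> (1 / a\<^sup>2) * (1/4) ^ (k * 2)" for k
  proof -
    have "a\<^sup>2 * mass 2 (weak_laplacian (d k)) \<le> (1/4) ^ (k * 2)"
      using f[of k] mass_nonneg[of 2 "weak_gradient (d k)"] unfolding p4 by linarith
    then show ?thesis using a by (simp add: field_simps)
  qed
  have f6: "mass 6 (d k) \<le> 4096 * (1/4) ^ (k * 6)" for k
  proof -
    have "mass 6 (d k) \<le> 4096 * (mass 2 (weak_gradient (d k))) ^ 3"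
      using Sobolev_L6(2)[of "d k"] d[of k] by (auto simp: D_space_iff dirichlet_self)
    also have "\<dots> \<le> 4096 * ((1/4) ^ (k * 2)) ^ 3"
      using fg[of k] by (intro mult_left_mono power_mono) (auto simp: mass_nonneg)
    also have "((1/4::real) ^ (k * 2)) ^ 3 = (1/4) ^ (k * 6)"
      unfolding power_mult[symmetric] mult.assoc by simp
    finally show ?thesis .
  qed
  have "\<exists>F. F \<in> borel_measurable lebesgue \<and> (\<lambda>k. \<integral>\<^sup>+x. ennreal (norm (s k x - F x) ^ 6) \<partial>lebesgue) \<longlonglongrightarrow> 0"
  proof (rule Ln_complete[where A = 4096])
    show "(\<integral>\<^sup>+x. ennreal (norm (s (Suc k) x - s k x) ^ 6) \<partial>lebesgue) \<le> ennreal (4096 * (1/4) ^ (k * 6))" for k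
      using f6[of k] in_L_nn_integral[OF dp(1), of k] by (simp add: d_def ennreal_leI)
  qed (use spm in auto)
  then obtain \<phi> where \<phi>: "\<phi> \<in> borel_measurable lebesgue" "(\<lambda>k. \<integral>\<^sup>+x. ennreal (norm (s k x - \<phi> x) ^ 6) \<partial>lebesgue) \<longlonglongrightarrow> 0"
    by blast
  have "\<exists>F. F \<in> borel_measurable lebesgue \<and> (\<lambda>k. \<integral>\<^sup>+x. ennreal (norm (weak_gradient (s k) x - F x) ^ 2) \<partial>lebesgue) \<longlonglongrightarrow> 0"
  proof (rule Ln_complete[where A = 1])
    fix k
    have "AE x in lebesgue. weak_gradient (d k) x = weak_gradient (s (Suc k)) x + (-1) *\<^sub>R weak_gradient (s k) x"
      unfolding d_def by (rule L2_gradient_lin(2)[OF sp(2) sp(2)])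
    then have "(\<integral>\<^sup>+x. ennreal (norm (weak_gradient (s (Suc k)) x - weak_gradient (s k) x) ^ 2) \<partial>lebesgue)
       = (\<integral>\<^sup>+x. ennreal (norm (weak_gradient (d k) x) powr 2) \<partial>lebesgue)"
      by (intro nn_integral_cong_AE, eventually_elim) simp
    then show "(\<integral>\<^sup>+x. ennreal (norm (weak_gradient (s (Suc k)) x - weak_gradient (s k) x) ^ 2) \<partial>lebesgue) \<le> ennreal (1 * (1/4) ^ (k * 2))"
      using fg[of k] in_L_nn_integral[OF dp(2), of k] by (simp add: ennreal_leI)
  qed (use spm in auto)
  then obtain g where g: "g \<in> borel_measurable lebesgue" "(\<lambda>k. \<integral>\<^sup>+x. ennreal (norm (weak_gradient (s k) x - g x) ^ 2) \<partial>lebesgue) \<longlonglongrightarrow> 0"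
    by blast
  have "\<exists>F. F \<in> borel_measurable lebesgue \<and> (\<lambda>k. \<integral>\<^sup>+x. ennreal (norm (weak_laplacian (s k) x - F x) ^ 2) \<partial>lebesgue) \<longlonglongrightarrow> 0"
  proof (rule Ln_complete[where A = "1 / a\<^sup>2"])
    fix k
    have "AE x in lebesgue. weak_laplacian (d k) x = weak_laplacian (s (Suc k)) x + (-1) * weak_laplacian (s k) x"
      unfolding d_def by (rule L2_laplacian_lin(2)[OF sp(3) sp(3)])
    then have "(\<integral>\<^sup>+x. ennreal (norm (weak_laplacian (s (Suc k)) x - weak_laplacian (s k) x) ^ 2) \<partial>lebesgue)
       = (\<integral>\<^sup>+x. ennreal (norm (weak_laplacian (d k) x) powr 2) \<partial>lebesgue)"
      by (intro nn_integral_cong_AE, eventually_elim) simp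
    then show "(\<integral>\<^sup>+x. ennreal (norm (weak_laplacian (s (Suc k)) x - weak_laplacian (s k) x) ^ 2) \<partial>lebesgue) \<le> ennreal ((1 / a\<^sup>2) * (1/4) ^ (k * 2))"
      using fl[of k] in_L_nn_integral[OF dp(3), of k] by (simp add: ennreal_leI)
  qed (use spm in auto)
  then obtain h where h: "h \<in> borel_measurable lebesgue" "(\<lambda>k. \<integral>\<^sup>+x. ennreal (norm (weak_laplacian (s k) x - h x) ^ 2) \<partial>lebesgue) \<longlonglongrightarrow> 0"
    by blast
  have sL2: "in_L 2 (weak_gradient (s k))" "in_L 2 (weak_laplacian (s k))" for k
    using sp[of k] by (auto simp: has_L2_gradient_def has_L2_laplacian_def)
  have L\<phi>: "in_L 6 \<phi>" using Ln_limit(1)[of 6 6 s \<phi>] sp \<phi> by simp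
  have Lg: "in_L 2 g" and cg: "(\<lambda>k. mass 2 (\<lambda>x. weak_gradient (s k) x - g x)) \<longlonglongrightarrow> 0"
    using Ln_limit[of 2 2 "\<lambda>k. weak_gradient (s k)" g] sL2 g by simp_all
  have Lh: "in_L 2 h" and ch: "(\<lambda>k. mass 2 (\<lambda>x. weak_laplacian (s k) x - h x)) \<longlonglongrightarrow> 0"
    using Ln_limit[of 2 2 "\<lambda>k. weak_laplacian (s k)" h] sL2 h by simp_all
  have l\<phi>: "locally_integrable \<phi>" and lg: "locally_integrable g" and lh: "locally_integrable h"
    and ls: "\<And>k. locally_integrable (s k)" "\<And>k. locally_integrable (weak_gradient (s k))" "\<And>k. locally_integrable (weak_laplacian (s k))"
    using L\<phi> Lg Lh sp(1) sL2
    by (auto intro: in_L_locally_integrable[where q = 6] in_L_locally_integrable[where q = 2])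
  have conv: "(\<lambda>k. LINT x|lebesgue. s k x * \<psi> x) \<longlonglongrightarrow> (LINT x|lebesgue. \<phi> x * \<psi> x)" if "test_function \<psi>" for \<psi>
    by (rule tendsto_integral_test[where n = 5, OF ls(1) l\<phi> _ that]) (use \<phi>(2) in simp)
  have wg: "has_weak_gradient \<phi> g"
    unfolding has_weak_gradient_def
  proof (intro conjI allI impI l\<phi> lg)
    fix \<psi> i assume t: "test_function \<psi>"
    have "(\<lambda>k. LINT x|lebesgue. (weak_gradient (s k) x $ i) * \<psi> x) \<longlonglongrightarrow> (LINT x|lebesgue. (g x $ i) * \<psi> x)"
    proof (rule tendsto_integral_test[where n = 1, OF _ _ _ t])
      show "(\<lambda>k. \<integral>\<^sup>+x. ennreal (\<bar>weak_gradient (s k) x $ i - g x $ i\<bar> ^ Suc 1) \<partial>lebesgue) \<longlonglongrightarrow> 0"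
      proof (rule tendsto_sandwich[OF always_eventually[OF allI] always_eventually[OF allI] tendsto_const g(2)])
        show "(\<integral>\<^sup>+x. ennreal (\<bar>weak_gradient (s k) x $ i - g x $ i\<bar> ^ Suc 1) \<partial>lebesgue)
          \<le> (\<integral>\<^sup>+x. ennreal (norm (weak_gradient (s k) x - g x) ^ 2) \<partial>lebesgue)" for k
        proof (intro nn_integral_mono ennreal_leI)
          fix x
          have "\<bar>(weak_gradient (s k) x - g x) $ i\<bar> ^ 2 \<le> norm (weak_gradient (s k) x - g x) ^ 2"
            by (intro power_mono component_le_norm_cart) simp
          then show "\<bar>weak_gradient (s k) x $ i - g x $ i\<bar> ^ Suc 1 \<le> norm (weak_gradient (s k) x - g x) ^ 2"
            by (simp add: numeral_2_eq_2)
        qed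
      qed simp
    qed (use ls lg in \<open>auto intro: locally_integrable_component\<close>)
    note lim = tendsto_minus[OF this]
    have e: "(LINT x|lebesgue. s k x * partial_deriv i \<psi> x) = - (LINT x|lebesgue. (weak_gradient (s k) x $ i) * \<psi> x)" for k
      using sp(2)[of k] has_weak_gradientD(3)[OF _ t] by (auto simp: has_L2_gradient_def)
    have "(\<lambda>k. LINT x|lebesgue. s k x * partial_deriv i \<psi> x) \<longlonglongrightarrow> - (LINT x|lebesgue. (g x $ i) * \<psi> x)"
      unfolding e by (rule lim)
    from LIMSEQ_unique[OF conv[OF test_function_partial_deriv[OF t]] this]
    show "(LINT x|lebesgue. \<phi> x * partial_deriv i \<psi> x) = - (LINT x|lebesgue. (g x $ i) * \<psi> x)" .
  qed
  have wl: "has_weak_laplacian \<phi> h"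
    unfolding has_weak_laplacian_def
  proof (intro conjI allI impI l\<phi> lh)
    fix \<psi> assume t: "test_function \<psi>"
    have e: "(LINT x|lebesgue. s k x * laplacian \<psi> x) = (LINT x|lebesgue. weak_laplacian (s k) x * \<psi> x)" for k
      using sp(3)[of k] has_weak_laplacianD(3)[OF _ t] by (auto simp: has_L2_laplacian_def)
    have "(\<lambda>k. LINT x|lebesgue. weak_laplacian (s k) x * \<psi> x) \<longlonglongrightarrow> (LINT x|lebesgue. h x * \<psi> x)"
      by (rule tendsto_integral_test[where n = 1, OF ls(3) lh _ t]) (use h(2) in \<open>simp add: numeral_2_eq_2\<close>)
    moreover have "(\<lambda>k. LINT x|lebesgue. s k x * laplacian \<psi> x) \<longlonglongrightarrow> (LINT x|lebesgue. \<phi> x * laplacian \<psi> x)"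
      unfolding laplacian_integral_sum[OF ls(1) t] laplacian_integral_sum[OF l\<phi> t]
      by (intro tendsto_sum conv test_function_partial_deriv t)
    ultimately show "(LINT x|lebesgue. \<phi> x * laplacian \<psi> x) = (LINT x|lebesgue. h x * \<psi> x)"
      unfolding e using LIMSEQ_unique by blast
  qed
  have \<phi>D: "\<phi> \<in> D_space"
    using L\<phi> has_L2_gradientI[OF wg Lg] has_L2_laplacianI[OF wl Lh] by (simp add: D_space_iff)
  have \<phi>p: "has_L2_gradient \<phi>" "has_L2_laplacian \<phi>" using \<phi>D by (auto simp: D_space_iff)
  have "D_form a (\<lambda>x. s k x + (-1) * \<phi> x) (\<lambda>x. s k x + (-1) * \<phi> x)
     = mass 2 (\<lambda>x. weak_gradient (s k) x - g x) + a\<^sup>2 * mass 2 (\<lambda>x. weak_laplacian (s k) x - h x)" for k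
  proof -
    have 1: "mass 2 (weak_gradient (\<lambda>x. s k x + (-1) * \<phi> x)) = mass 2 (\<lambda>x. weak_gradient (s k) x - g x)"
    proof (rule mass_cong_AE)
      have "AE x in lebesgue. weak_gradient \<phi> x = g x"
        using \<phi>p(1) wg by (intro weak_gradient_unique) (auto simp: has_L2_gradient_def)
      with L2_gradient_lin(2)[OF sp(2)[of k] \<phi>p(1), of "-1"]
      show "AE x in lebesgue. weak_gradient (\<lambda>x. s k x + (-1) * \<phi> x) x = weak_gradient (s k) x - g x"
        by eventually_elim simp
      show "weak_gradient (\<lambda>x. s k x + (-1) * \<phi> x) \<in> borel_measurable lebesgue"
        using L2_gradient_lin(1)[OF sp(2)[of k] \<phi>p(1), of "-1"] by (auto simp: has_L2_gradient_def dest: in_L_measurable)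
    qed (use spm g in \<open>auto intro: borel_measurable_diff\<close>)
    have 2: "mass 2 (weak_laplacian (\<lambda>x. s k x + (-1) * \<phi> x)) = mass 2 (\<lambda>x. weak_laplacian (s k) x - h x)"
    proof (rule mass_cong_AE)
      have "AE x in lebesgue. weak_laplacian \<phi> x = h x"
        using \<phi>p(2) wl by (intro weak_laplacian_unique) (auto simp: has_L2_laplacian_def)
      with L2_laplacian_lin(2)[OF sp(3)[of k] \<phi>p(2), of "-1"]
      show "AE x in lebesgue. weak_laplacian (\<lambda>x. s k x + (-1) * \<phi> x) x = weak_laplacian (s k) x - h x"
        by eventually_elim simp
      show "weak_laplacian (\<lambda>x. s k x + (-1) * \<phi> x) \<in> borel_measurable lebesgue"
        using L2_laplacian_lin(1)[OF sp(3)[of k] \<phi>p(2), of "-1"] by (auto simp: has_L2_laplacian_def dest: in_L_measurable)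
    qed (use spm h in \<open>auto intro: borel_measurable_diff\<close>)
    show ?thesis by (simp only: D_form_self 1 2)
  qed
  moreover have "(\<lambda>k. mass 2 (\<lambda>x. weak_gradient (s k) x - g x) + a\<^sup>2 * mass 2 (\<lambda>x. weak_laplacian (s k) x - h x)) \<longlonglongrightarrow> 0 + a\<^sup>2 * 0"
    by (intro tendsto_intros cg ch)
  ultimately show ?thesis using \<phi>D by (intro bexI[of _ \<phi>]) simp_all
qed

text \<open>The potential for \<open>a \<noteq> 0\<close> with a general source \<open>f\<close> in place of \<open>Q u\<^sup>2\<close>, so that it can be
  treated as a linear operator.\<close>

definition solution_op :: "real \<Rightarrow> (real ^ 3 \<Rightarrow> real) \<Rightarrow> real ^ 3 \<Rightarrow> real" where
  "solution_op a f = (SOME \<phi>. \<phi> \<in> D_space \<and> (\<forall>\<psi>\<in>D_space. D_form a \<phi> \<psi> = 4 * pi * (LINT x|lebesgue. f x * \<psi> x)))"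

definition bopp_form :: "real \<Rightarrow> (real ^ 3 \<Rightarrow> real) \<Rightarrow> (real ^ 3 \<Rightarrow> real) \<Rightarrow> real" where
  "bopp_form a f g = (LINT x|lebesgue. solution_op a f x * g x)"

lemma solution_op:
  assumes a: "a \<noteq> 0" and f: "in_L (6/5) f"
  shows "solution_op a f \<in> D_space"
    and "\<psi> \<in> D_space \<Longrightarrow> D_form a (solution_op a f) \<psi> = 4 * pi * (LINT x|lebesgue. f x * \<psi> x)"
proof -
  let ?L = "\<lambda>\<psi>. 4 * pi * (LINT x|lebesgue. f x * \<psi> x)"
  have "\<exists>\<phi>\<in>D_space. \<forall>\<psi>\<in>D_space. D_form a \<phi> \<psi> = ?L \<psi>"
  proof (rule riesz_representation[where C = "D_bound (mass (6/5) f)"])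
    show "D_space \<noteq> {}" using D_space_zero by blast
    show "?L (\<lambda>x. u x + r * v x) = ?L u + r * ?L v" if "u \<in> D_space" "v \<in> D_space" for u v r
    proof -
      have "integrable lebesgue (\<lambda>x. f x * u x)" "integrable lebesgue (\<lambda>x. f x * v x)"
        using that f by (auto simp: D_space_iff intro: duality_bound(1))
      moreover have "f x * (u x + r * v x) = f x * u x + r * (f x * v x)" for x by (simp add: algebra_simps)
      ultimately show ?thesis by (simp add: algebra_simps)
    qed
    show "2 * ?L \<psi> \<le> D_bound (mass (6/5) f) + D_form a \<psi> \<psi>" if "\<psi> \<in> D_space" for \<psi>
      using source_bound[OF f that, of a] abs_ge_self[of "?L \<psi>"] by linarith
    show "\<exists>v\<in>D_space. (\<lambda>k. D_form a (\<lambda>x. s k x + (-1) * v x) (\<lambda>x. s k x + (-1) * v x)) \<longlonglongrightarrow> 0"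
      if "\<And>k. s k \<in> D_space"
        "\<And>k. D_form a (\<lambda>x. s (Suc k) x + (-1) * s k x) (\<lambda>x. s (Suc k) x + (-1) * s k x) \<le> (1/16) ^ k" for s
      by (rule D_space_complete[OF a that])
  qed (auto intro: D_space_lin D_form_commute D_form_lin D_form_nonneg)
  then have "\<exists>\<phi>. \<phi> \<in> D_space \<and> (\<forall>\<psi>\<in>D_space. D_form a \<phi> \<psi> = ?L \<psi>)" by blast
  from someI_ex[OF this] show "solution_op a f \<in> D_space"
    "\<psi> \<in> D_space \<Longrightarrow> D_form a (solution_op a f) \<psi> = ?L \<psi>"
    unfolding solution_op_def by auto
qed

text \<open>Testing the equation for \<open>g\<close> with the solution for \<open>f\<close> gives \<open>4 \<pi> T(f, g) = D(\<phi>\<^sub>g, \<phi>\<^sub>f)\<close>; hence the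
  form is symmetric, and it is bounded because \<open>D(\<phi>\<^sub>f, \<phi>\<^sub>f)\<close> is, for normalised \<open>f\<close>.\<close>

lemma bopp_form_bounded:
  assumes a: "a \<noteq> 0" shows "bounded_form (bopp_form a) (D_bound 1)"
proof -
  have eq: "D_form a (solution_op a g) (solution_op a f) = 4 * pi * bopp_form a f g"
    if "in_L (6/5) f" "in_L (6/5) g" for f g
    using solution_op(2)[OF a that(2) solution_op(1)[OF a that(1)]] by (simp add: bopp_form_def mult.commute)
  show ?thesis unfolding bounded_form_def
  proof (intro conjI allI impI)
    fix f g h :: "real ^ 3 \<Rightarrow> real" and r assume f: "in_L (6/5) f" and g: "in_L (6/5) g"
    note sf = solution_op[OF a f] and sg = solution_op[OF a g]
    show "bopp_form a f g = bopp_form a g f"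
      using eq[OF f g] eq[OF g f] D_form_commute[of a "solution_op a g" "solution_op a f"] by simp
    show "bopp_form a f (\<lambda>x. g x + r * h x) = bopp_form a f g + r * bopp_form a f h" if h: "in_L (6/5) h"
    proof -
      have s6: "in_L 6 (solution_op a f)" using sf(1) by (simp add: D_space_iff)
      have "bopp_form a f (\<lambda>x. g x + r * h x) = (LINT x|lebesgue. g x * solution_op a f x + r * (h x * solution_op a f x))"
        by (simp add: bopp_form_def algebra_simps)
      also have "\<dots> = (LINT x|lebesgue. g x * solution_op a f x) + r * (LINT x|lebesgue. h x * solution_op a f x)"
        using duality_bound(1)[OF g s6] duality_bound(1)[OF h s6] by simp
      finally show ?thesis by (simp add: bopp_form_def mult.commute)
    qed
    show "\<bar>bopp_form a f g\<bar> \<le> D_bound 1" if m: "mass (6/5) f \<le> 1" "mass (6/5) g \<le> 1"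
    proof -
      have b: "D_form a (solution_op a k) (solution_op a k) \<le> D_bound 1" if k: "in_L (6/5) k" "mass (6/5) k \<le> 1" for k
      proof -
        have "D_form a (solution_op a k) (solution_op a k) \<le> D_bound (mass (6/5) k)"
          using source_bound[OF k(1) solution_op(1)[OF a k(1)], of a] solution_op(2)[OF a k(1) solution_op(1)[OF a k(1)]]
          by (simp add: abs_if split: if_splits)
        also have "\<dots> \<le> D_bound 1"
          using k mass_nonneg[of "6/5" k] unfolding D_bound_def by (intro add_mono mult_left_mono power_mono) auto
        finally show ?thesis .
      qed
      have exp: "D_form a (\<lambda>x. solution_op a g x + r * solution_op a f x) (\<lambda>x. solution_op a g x + r * solution_op a f x)
        = D_form a (solution_op a g) (solution_op a g) + 2 * r * D_form a (solution_op a g) (solution_op a f) + r * r * D_form a (solution_op a f) (solution_op a f)" for r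
      proof -
        let ?W = "\<lambda>x. solution_op a g x + r * solution_op a f x"
        have "D_form a ?W ?W = D_form a ?W (solution_op a g) + r * D_form a ?W (solution_op a f)"
          by (rule D_form_lin[OF D_space_lin[OF sg(1) sf(1)] sg(1) sf(1)])
        also have "D_form a ?W (solution_op a g) = D_form a (solution_op a g) (solution_op a g) + r * D_form a (solution_op a g) (solution_op a f)"
          unfolding D_form_commute[of a ?W] by (rule D_form_lin[OF sg(1) sg(1) sf(1)])
        also have "D_form a ?W (solution_op a f) = D_form a (solution_op a g) (solution_op a f) + r * D_form a (solution_op a f) (solution_op a f)"
          unfolding D_form_commute[of a ?W] D_form_commute[of a "solution_op a g" "solution_op a f"]
          by (rule D_form_lin[OF sf(1) sg(1) sf(1)])
        finally show ?thesis by (simp add: distrib_left mult.assoc)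
      qed
      have "\<bar>D_form a (solution_op a g) (solution_op a f)\<bar> \<le> D_bound 1"
        using exp[of 1] exp[of "-1"] D_form_nonneg[of a "\<lambda>x. solution_op a g x + 1 * solution_op a f x"]
          D_form_nonneg[of a "\<lambda>x. solution_op a g x + (-1) * solution_op a f x"] b[OF f m(1)] b[OF g m(2)]
        unfolding abs_le_iff by linarith
      then have "4 * pi * \<bar>bopp_form a f g\<bar> \<le> D_bound 1" by (simp add: eq[OF f g] abs_mult)
      moreover have "1 * \<bar>bopp_form a f g\<bar> \<le> 4 * pi * \<bar>bopp_form a f g\<bar>"
        using pi_gt3 by (intro mult_right_mono) auto
      ultimately show ?thesis by simp
    qed
  qed
qed

section \<open>The interaction energy\<close>

definition interaction :: "real \<Rightarrow> (real ^ 3 \<Rightarrow> real) \<Rightarrow> (real ^ 3 \<Rightarrow> real) \<Rightarrow> real" where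
  "interaction a = (if a = 0 then newton_form else bopp_form a)"

lemma interaction_bounded: "\<exists>C. bounded_form (interaction a) C"
  using newton_form_bounded bopp_form_bounded[of a] by (auto simp: interaction_def)

lemma interaction_potential:
  "(LINT x|lebesgue. Q x * potential Q a u x * w x) = interaction a (\<lambda>x. Q x * (u x)\<^sup>2) (\<lambda>x. Q x * w x)"
proof (cases "a = 0")
  case True
  then show ?thesis by (simp add: interaction_def newton_form_def potential_def mult_ac)
next
  case False
  have "potential Q a u = solution_op a (\<lambda>x. Q x * (u x)\<^sup>2)"
    using False unfolding potential_def solution_op_def potential_weak_solution_def D_form_def dirichlet_def by simp
  then show ?thesis using False by (simp add: interaction_def bopp_form_def mult_ac)
qed

section \<open>The space \<open>H\<^sup>1\<close>\<close>

lemma H1_iff: "u \<in> H1 \<longleftrightarrow> in_L 2 u \<and> has_L2_gradient u"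
proof
  assume "u \<in> H1"
  then obtain g where "in_L 2 u" "has_weak_gradient u g" "in_L 2 g" by (auto simp: H1_def)
  then show "in_L 2 u \<and> has_L2_gradient u" by (auto intro: has_L2_gradientI)
qed (auto simp: H1_def has_L2_gradient_def)

definition H1_inner :: "(real ^ 3 \<Rightarrow> real) \<Rightarrow> (real ^ 3 \<Rightarrow> real) \<Rightarrow> real" where
  "H1_inner u v = dirichlet u v + (LINT x|lebesgue. u x * v x)"

lemma Lnorm_2_square: "(Lnorm 2 f)\<^sup>2 = mass 2 f"
proof -
  have "(Lnorm 2 f)\<^sup>2 = (mass 2 f powr (1/2))\<^sup>2" by (simp add: Lnorm_def mass_def)
  also have "\<dots> = mass 2 f" using mass_nonneg[of 2 f] by (simp add: powr_half_sqrt)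
  finally show ?thesis .
qed

lemma H1_norm_square: "(H1_norm u)\<^sup>2 = H1_inner u u"
  using mass_nonneg[of 2 u] mass_nonneg[of 2 "weak_gradient u"]
  by (simp add: H1_norm_def H1_inner_def dirichlet_self Lnorm_2_square mass_2)

lemma H1_norm_nonneg: "0 \<le> H1_norm u"
  by (simp add: H1_norm_def)

lemma H1_lin: "u \<in> H1 \<Longrightarrow> v \<in> H1 \<Longrightarrow> (\<lambda>x. u x + r * v x) \<in> H1"
  by (auto simp: H1_iff intro: in_L_lin_real L2_gradient_lin(1))

lemma H1_zero: "(\<lambda>x. 0) \<in> H1"
  using D_space_zero in_L_zero by (auto simp: H1_iff D_space_iff)

lemma H1_scale: "u \<in> H1 \<Longrightarrow> (\<lambda>x. r * u x) \<in> H1"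
  using H1_lin[OF H1_zero, of u r] by simp

lemma H1_inner_commute: "H1_inner u v = H1_inner v u"
  by (simp add: H1_inner_def dirichlet_commute mult.commute)

lemma H1_inner_lin:
  assumes "u \<in> H1" "v \<in> H1" "w \<in> H1"
  shows "H1_inner u (\<lambda>x. v x + r * w x) = H1_inner u v + r * H1_inner u w"
proof -
  have "(LINT x|lebesgue. u x \<bullet> (v x + r * w x)) = (LINT x|lebesgue. u x \<bullet> v x) + r * (LINT x|lebesgue. u x \<bullet> w x)"
    using assms by (intro integral_inner_lin) (auto simp: H1_iff dest!: in_L_measurable intro!: borel_measurable_add borel_measurable_times)
  then show ?thesis using assms by (simp add: H1_inner_def dirichlet_lin H1_iff algebra_simps)
qed

lemma H1_inner_scale:
  assumes "u \<in> H1" "w \<in> H1"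
  shows "H1_inner u (\<lambda>x. r * w x) = r * H1_inner u w"
proof -
  have "H1_inner u (\<lambda>x. 0) = 0" using H1_inner_lin[OF assms(1) H1_zero H1_zero, of 1] by simp
  then show ?thesis using H1_inner_lin[OF assms(1) H1_zero assms(2), of r] by simp
qed

lemma H1_norm_scale: "u \<in> H1 \<Longrightarrow> H1_norm (\<lambda>x. r * u x) = \<bar>r\<bar> * H1_norm u"
proof -
  assume u: "u \<in> H1"
  have "(H1_norm (\<lambda>x. r * u x))\<^sup>2 = (\<bar>r\<bar> * H1_norm u)\<^sup>2"
  proof -
    have "H1_inner (\<lambda>x. r * u x) (\<lambda>x. r * u x) = r * H1_inner (\<lambda>x. r * u x) u"
      by (rule H1_inner_scale[OF H1_scale[OF u] u])
    also have "H1_inner (\<lambda>x. r * u x) u = r * H1_inner u u"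
      unfolding H1_inner_commute[of "\<lambda>x. r * u x" u] by (rule H1_inner_scale[OF u u])
    finally show ?thesis
      by (simp only: H1_norm_square power_mult_distrib power2_abs) (simp add: power2_eq_square)
  qed
  then show ?thesis by (simp add: H1_norm_nonneg power2_eq_iff_nonneg)
qed

text \<open>All multilinear estimates are proved on the unit ball, where Young's inequality can replace
  Hoelder's, and are then extended by homogeneity.\<close>

lemma H1_normalise:
  assumes "u \<in> H1" "H1_norm u \<le> t" "0 < t"
  shows "(\<lambda>x. (1 / t) * u x) \<in> H1" "H1_norm (\<lambda>x. (1 / t) * u x) \<le> 1"
proof -
  show "(\<lambda>x. (1 / t) * u x) \<in> H1" by (rule H1_scale[OF assms(1)])
  show "H1_norm (\<lambda>x. (1 / t) * u x) \<le> 1"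
    unfolding H1_norm_scale[OF assms(1)] using assms by (simp add: field_simps)
qed

lemma H1_inner_add_square:
  assumes "u \<in> H1" "v \<in> H1"
  shows "H1_inner (\<lambda>x. u x + r * v x) (\<lambda>x. u x + r * v x) = H1_inner u u + 2 * r * H1_inner u v + r\<^sup>2 * H1_inner v v"
proof -
  let ?w = "\<lambda>x. u x + r * v x"
  have "H1_inner ?w ?w = H1_inner ?w u + r * H1_inner ?w v" by (rule H1_inner_lin[OF H1_lin[OF assms] assms])
  also have "H1_inner ?w u = H1_inner u u + r * H1_inner u v"
    unfolding H1_inner_commute[of ?w] by (rule H1_inner_lin[OF assms(1) assms])
  also have "H1_inner ?w v = H1_inner u v + r * H1_inner v v"
    unfolding H1_inner_commute[of ?w] H1_inner_commute[of u v] by (rule H1_inner_lin[OF assms(2) assms])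
  finally show ?thesis by (simp add: power2_eq_square algebra_simps)
qed

lemma H1_inner_le_1:
  assumes "u \<in> H1" "v \<in> H1" "H1_norm u \<le> 1" "H1_norm v \<le> 1"
  shows "\<bar>H1_inner u v\<bar> \<le> 1"
proof -
  have n: "H1_inner u u \<le> 1" "H1_inner v v \<le> 1"
    using assms by (auto simp: H1_norm_square[symmetric] H1_norm_nonneg power_le_one)
  have "0 \<le> H1_inner (\<lambda>x. u x + r * v x) (\<lambda>x. u x + r * v x)" for r
    by (simp flip: H1_norm_square)
  from this[of 1] this[of "-1"] show ?thesis
    using n H1_inner_add_square[OF assms(1,2), of 1] H1_inner_add_square[OF assms(1,2), of "-1"]
    unfolding abs_le_iff by simp
qed

lemma H1_mass:
  assumes "u \<in> H1"
  shows "in_L 2 u" "in_L 6 u" "mass 2 u \<le> (H1_norm u)\<^sup>2" "mass 6 u \<le> 4096 * (H1_norm u) ^ 6"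
proof -
  show 2: "in_L 2 u" using assms by (simp add: H1_iff)
  have g: "has_L2_gradient u" using assms by (simp add: H1_iff)
  show "in_L 6 u" by (rule Sobolev_L6(1)[OF g]) (use 2 in simp)
  show "mass 2 u \<le> (H1_norm u)\<^sup>2"
    by (simp add: H1_norm_square H1_inner_def dirichlet_self mass_2[of u] mass_nonneg)
  have "dirichlet u u \<le> (H1_norm u)\<^sup>2"
    using mass_nonneg[of 2 u] by (simp add: H1_norm_square H1_inner_def mass_2[of u])
  then have "(dirichlet u u) ^ 3 \<le> ((H1_norm u)\<^sup>2) ^ 3"
    by (intro power_mono) (auto simp: dirichlet_self mass_nonneg)
  also have "\<dots> = (H1_norm u) ^ 6" by (simp flip: power_mult)
  finally show "mass 6 u \<le> 4096 * (H1_norm u) ^ 6"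
    using Sobolev_L6(2)[OF g] 2 by simp
qed

lemma H1_mass_le_1:
  assumes "u \<in> H1" "H1_norm u \<le> 1"
  shows "mass 2 u \<le> 1" "mass 6 u \<le> 4096"
proof -
  have "(H1_norm u)\<^sup>2 \<le> 1" "(H1_norm u) ^ 6 \<le> 1"
    using assms by (auto intro: power_le_one simp: H1_norm_nonneg)
  then show "mass 2 u \<le> 1" "mass 6 u \<le> 4096" using H1_mass(3,4)[OF assms(1)] by auto
qed

section \<open>Elementary inequalities\<close>

text \<open>Each factor is at most the corresponding power of the maximum of \<open>A, B, C\<close>.\<close>

lemma powr_product_le:
  fixes A B C :: real
  assumes "0 \<le> A" "0 \<le> B" "0 \<le> C" "0 < a" "0 < b" "0 < c" "a + b + c = 1"
  shows "A powr a * B powr b * C powr c \<le> A + B + C"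
proof -
  define m where "m = max A (max B C)"
  have m: "A \<le> m" "B \<le> m" "C \<le> m" "0 \<le> m" "m \<le> A + B + C" using assms by (auto simp: m_def max_def)
  have "A powr a * B powr b * C powr c \<le> m powr a * m powr b * m powr c"
    using assms m by (intro mult_mono powr_mono2 mult_nonneg_nonneg) auto
  also have "\<dots> = m powr (a + b + c)" by (simp add: powr_add)
  also have "\<dots> = m" using assms(7) m by simp
  finally show ?thesis using m by simp
qed

lemma monomial_le:
  fixes u w :: real
  assumes "i + j = 6" shows "\<bar>u\<bar> ^ i * \<bar>w\<bar> ^ j \<le> u ^ 6 + w ^ 6"
proof -
  define m where "m = max \<bar>u\<bar> \<bar>w\<bar>"
  have "\<bar>u\<bar> ^ i * \<bar>w\<bar> ^ j \<le> m ^ i * m ^ j"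
    by (intro mult_mono power_mono) (auto simp: m_def)
  also have "\<dots> = m ^ 6" using assms by (simp flip: power_add)
  also have "\<dots> \<le> u ^ 6 + w ^ 6" by (auto simp: m_def max_def)
  finally show ?thesis .
qed

lemma sixth_power_taylor:
  fixes u w t :: real
  assumes "0 \<le> t" "t \<le> 1"
  shows "\<bar>(u + t * w) ^ 6 - u ^ 6 - 6 * (u ^ 5 * (t * w))\<bar> \<le> t\<^sup>2 * (57 * (u ^ 6 + w ^ 6))"
proof -
  define m where "m = u ^ 6 + w ^ 6"
  have m0: "0 \<le> m" by (simp add: m_def)
  have mono: "\<bar>c * (u ^ i * w ^ j)\<bar> \<le> c0 * m" if "i + j = 6" "\<bar>c\<bar> \<le> c0" for i j c c0
    unfolding abs_mult power_abs using monomial_le[OF that(1), of u w] that(2)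
    by (intro mult_mono) (auto simp: m_def power_abs)
  have t: "\<bar>20 * t\<bar> \<le> 20" "\<bar>15 * t\<^sup>2\<bar> \<le> 15" "\<bar>6 * t ^ 3\<bar> \<le> 6" "\<bar>t ^ 4\<bar> \<le> 1"
    using assms power_le_one[of t 2] power_le_one[of t 3] power_le_one[of t 4] by auto
  have "(u + t * w) ^ 6 - u ^ 6 - 6 * (u ^ 5 * (t * w))
     = t\<^sup>2 * (15 * (u ^ 4 * w ^ 2) + (20 * t) * (u ^ 3 * w ^ 3) + (15 * t\<^sup>2) * (u ^ 2 * w ^ 4)
         + (6 * t ^ 3) * (u ^ 1 * w ^ 5) + t ^ 4 * (u ^ 0 * w ^ 6))"
    by (simp add: eval_nat_numeral algebra_simps)
  also have "\<bar>\<dots>\<bar> \<le> t\<^sup>2 * (15 * m + 20 * m + 15 * m + 6 * m + 1 * m)"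
  proof -
    have "\<bar>15 * (u ^ 4 * w ^ 2) + (20 * t) * (u ^ 3 * w ^ 3) + (15 * t\<^sup>2) * (u ^ 2 * w ^ 4)
         + (6 * t ^ 3) * (u ^ 1 * w ^ 5) + t ^ 4 * (u ^ 0 * w ^ 6)\<bar> \<le> 15 * m + 20 * m + 15 * m + 6 * m + 1 * m"
    proof (intro order_trans[OF abs_triangle_ineq] add_mono)
      show "\<bar>15 * (u ^ 4 * w ^ 2)\<bar> \<le> 15 * m" by (rule mono) auto
    qed (rule mono, simp, rule t)+
    then show ?thesis unfolding abs_mult[of "t\<^sup>2"] by (intro mult_mono) auto
  qed
  finally show ?thesis by (simp add: m_def)
qed

text \<open>With \<open>s = x + y\<close>, both \<open>x/s\<close> and \<open>y/s\<close> lie in \<open>[0, 1]\<close>, where \<open>t \<le> t\<^sup>p\<close>.\<close>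

lemma powr_subadditive:
  fixes x y :: real
  assumes "0 \<le> x" "0 \<le> y" "0 < p" "p < 1"
  shows "(x + y) powr p \<le> x powr p + y powr p"
proof (cases "x + y = 0")
  case False
  then have s: "x + y > 0" using assms by linarith
  have *: "z / (x + y) * (x + y) powr p \<le> z powr p" if z: "0 \<le> z" "z \<le> x + y" for z
  proof (cases "z = 0")
    case False
    have "(z / (x + y)) powr 1 \<le> (z / (x + y)) powr p"
      using z s assms False by (intro powr_mono') auto
    then have "z / (x + y) * (x + y) powr p \<le> (z / (x + y)) powr p * (x + y) powr p"
      using z s by (intro mult_right_mono) auto
    also have "\<dots> = z powr p" using z s by (simp add: powr_mult[symmetric])
    finally show ?thesis .
  qed simp
  have "(x + y) powr p = x / (x + y) * (x + y) powr p + y / (x + y) * (x + y) powr p"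
  proof -
    have "x / (x + y) * (x + y) powr p + y / (x + y) * (x + y) powr p = (x + y) / (x + y) * (x + y) powr p"
      by (simp only: add_divide_distrib distrib_right)
    then show ?thesis using s by simp
  qed
  also have "\<dots> \<le> x powr p + y powr p" using assms by (intro add_mono *) auto
  finally show ?thesis .
qed (use assms in simp)

definition spow :: "real \<Rightarrow> real \<Rightarrow> real" where
  "spow p s = \<bar>s\<bar> powr (p - 1) * s"

lemma abs_spow: "0 < p \<Longrightarrow> \<bar>spow p s\<bar> = \<bar>s\<bar> powr p"
proof (cases "s = 0")
  case False
  then have "\<bar>s\<bar> powr (p - 1) * \<bar>s\<bar> powr 1 = \<bar>s\<bar> powr p" unfolding powr_add[symmetric] by simp
  then show ?thesis using False by (simp add: spow_def abs_mult)
qed (simp add: spow_def)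

lemma spow_self: "0 < p \<Longrightarrow> spow p s * s = \<bar>s\<bar> powr (p + 1)"
proof (cases "s = 0")
  case False
  have "spow p s * s = \<bar>s\<bar> powr (p - 1) * \<bar>s\<bar> powr 2"
    by (simp add: spow_def power2_eq_square)
  also have "\<dots> = \<bar>s\<bar> powr (p + 1)" unfolding powr_add[symmetric] by (simp add: add.commute)
  finally show ?thesis .
qed (simp add: spow_def)

lemma spow_nonneg: "0 \<le> s \<Longrightarrow> 0 < p \<Longrightarrow> spow p s = s powr p"
  using abs_spow[of p s] by (simp add: spow_def abs_mult)

lemma spow_minus: "spow p (- s) = - spow p s"
  by (simp add: spow_def)

text \<open>For arguments of equal sign this is subadditivity of \<open>t\<^sup>p\<close>; for opposite signs both \<open>\<bar>x\<bar>\<close> and \<open>\<bar>y\<bar>\<close>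
  are at most \<open>\<bar>x - y\<bar>\<close>, which costs the factor \<open>2\<close>.\<close>

lemma spow_hoelder:
  assumes p: "0 < p" "p < 1"
  shows "\<bar>spow p x - spow p y\<bar> \<le> 2 * \<bar>x - y\<bar> powr p"
proof -
  have pos: "\<bar>spow p x - spow p y\<bar> \<le> 2 * \<bar>x - y\<bar> powr p" if "0 \<le> y" "y \<le> x" for x y
  proof -
    have "x powr p \<le> y powr p + (x - y) powr p"
      using powr_subadditive[of y "x - y" p] that p by simp
    moreover have "y powr p \<le> x powr p" using that p by (intro powr_mono2) auto
    ultimately show ?thesis using that p by (simp add: spow_nonneg)
  qed
  have neg: "\<bar>spow p x - spow p y\<bar> \<le> 2 * \<bar>x - y\<bar> powr p" if "y \<le> 0" "0 \<le> x" for x y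
  proof -
    have "\<bar>spow p x - spow p y\<bar> \<le> \<bar>x\<bar> powr p + \<bar>y\<bar> powr p"
      using abs_triangle_ineq4[of "spow p x" "spow p y"] p by (simp add: abs_spow)
    also have "\<dots> \<le> \<bar>x - y\<bar> powr p + \<bar>x - y\<bar> powr p"
      using that p by (intro add_mono powr_mono2) auto
    finally show ?thesis by simp
  qed
  consider "0 \<le> y" "y \<le> x" | "0 \<le> x" "x \<le> y" | "y \<le> 0" "0 \<le> x" | "x \<le> 0" "0 \<le> y"
    | "x \<le> 0" "y \<le> x" | "y \<le> 0" "x \<le> y" by linarith
  then show ?thesis
  proof cases
    case 2 then show ?thesis using pos[of x y] by (simp add: abs_minus_commute)
  next
    case 4 then show ?thesis using neg[of x y] by (simp add: abs_minus_commute)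
  next
    case 5 then show ?thesis using pos[of "-x" "-y"] by (simp add: spow_minus abs_minus_commute)
  next
    case 6 then show ?thesis using pos[of "-y" "-x"] by (simp add: spow_minus abs_minus_commute)
  qed (use pos neg in auto)
qed

lemma abs_powr_derivative:
  assumes p: "0 < p"
  shows "((\<lambda>s. \<bar>s\<bar> powr (p + 1)) has_real_derivative (p + 1) * spow p s) (at s)"
proof -
  have pos: "((\<lambda>s. \<bar>s\<bar> powr (p + 1)) has_real_derivative (p + 1) * spow p s) (at s)" if "s > 0" for s
  proof -
    have "((\<lambda>s. s powr (p + 1)) has_real_derivative (p + 1) * spow p s) (at s)"
      using that p by (auto intro!: derivative_eq_intros simp: spow_nonneg)
    moreover have "eventually (\<lambda>x. x > 0) (nhds s)"
      using that by (simp add: eventually_nhds) (metis greaterThan_iff open_greaterThan)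
    ultimately show ?thesis
      by (subst DERIV_cong_ev[OF refl _ refl, where g = "\<lambda>s. s powr (p + 1)"]) (auto elim!: eventually_mono)
  qed
  consider "s > 0" | "s < 0" | "s = 0" by linarith
  then show ?thesis
  proof cases
    case 2
    have "((\<lambda>s. \<bar>- s\<bar> powr (p + 1)) has_real_derivative ((p + 1) * spow p (- s)) * (- 1)) (at s)"
      by (rule DERIV_chain2[OF pos]) (use 2 in \<open>auto intro!: derivative_eq_intros\<close>)
    then show ?thesis by (simp add: spow_minus)
  next
    case 3
    have "((\<lambda>h. \<bar>h\<bar> powr p) \<longlongrightarrow> \<bar>0\<bar> powr p) (at (0::real))"
      using p by (intro tendsto_powr' tendsto_rabs tendsto_ident_at tendsto_const) auto
    then have "((\<lambda>h. spow p h) \<longlongrightarrow> 0) (at 0)"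
      using p by (intro tendsto_rabs_zero_cancel[where f = "spow p"]) (simp add: abs_spow)
    then have "((\<lambda>h. \<bar>h\<bar> powr (p + 1) / h) \<longlongrightarrow> 0) (at 0)"
      by (rule Lim_transform_eventually) (auto simp: eventually_at_filter spow_self[OF p, symmetric])
    then show ?thesis using 3 by (simp add: DERIV_def spow_def)
  qed (rule pos)
qed

text \<open>The mean value theorem, with the derivative \<open>(p + 1) spow p\<close> being Hoelder continuous of
  exponent \<open>p\<close>.\<close>

lemma abs_powr_taylor:
  assumes p: "0 < p" "p < 1"
  shows "\<bar>\<bar>x + y\<bar> powr (p + 1) - \<bar>x\<bar> powr (p + 1) - (p + 1) * (spow p x * y)\<bar> \<le> 4 * (\<bar>y\<bar> powr p * \<bar>y\<bar>)"
proof (cases "y = 0")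
  case False
  have "\<exists>z. \<bar>z - x\<bar> \<le> \<bar>y\<bar> \<and> \<bar>x + y\<bar> powr (p + 1) - \<bar>x\<bar> powr (p + 1) = y * ((p + 1) * spow p z)"
  proof (cases "y > 0")
    case True
    then obtain z where "x < z" "z < x + y" "\<bar>x + y\<bar> powr (p + 1) - \<bar>x\<bar> powr (p + 1) = (x + y - x) * ((p + 1) * spow p z)"
      using MVT2[of x "x + y" "\<lambda>s. \<bar>s\<bar> powr (p + 1)" "\<lambda>s. (p + 1) * spow p s"] abs_powr_derivative[OF p(1)] by auto
    then show ?thesis by (intro exI[of _ z]) auto
  next
    case neg: False
    then obtain z where "x + y < z" "z < x" "\<bar>x\<bar> powr (p + 1) - \<bar>x + y\<bar> powr (p + 1) = (x - (x + y)) * ((p + 1) * spow p z)"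
      using False MVT2[of "x + y" x "\<lambda>s. \<bar>s\<bar> powr (p + 1)" "\<lambda>s. (p + 1) * spow p s"] abs_powr_derivative[OF p(1)] by auto
    then show ?thesis by (intro exI[of _ z]) auto
  qed
  then obtain z where z: "\<bar>z - x\<bar> \<le> \<bar>y\<bar>"
    "\<bar>x + y\<bar> powr (p + 1) - \<bar>x\<bar> powr (p + 1) = y * ((p + 1) * spow p z)" by blast
  have "\<bar>x + y\<bar> powr (p + 1) - \<bar>x\<bar> powr (p + 1) - (p + 1) * (spow p x * y) = (p + 1) * (y * (spow p z - spow p x))"
    unfolding z(2) by (simp add: algebra_simps)
  also have "\<bar>\<dots>\<bar> = (p + 1) * (\<bar>y\<bar> * \<bar>spow p z - spow p x\<bar>)" using p by (simp add: abs_mult)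
  also have "\<dots> \<le> 2 * (\<bar>y\<bar> * (2 * \<bar>y\<bar> powr p))"
  proof (intro mult_mono)
    have "\<bar>spow p z - spow p x\<bar> \<le> 2 * \<bar>z - x\<bar> powr p" by (rule spow_hoelder[OF p])
    also have "\<dots> \<le> 2 * \<bar>y\<bar> powr p" using z p by (intro mult_left_mono powr_mono2) auto
    finally show "\<bar>spow p z - spow p x\<bar> \<le> 2 * \<bar>y\<bar> powr p" .
  qed (use p in auto)
  finally show ?thesis by (simp add: mult_ac)
qed simp

section \<open>Bounds for the terms of the functional\<close>

lemma dominated_integral:
  fixes F w :: "real ^ 3 \<Rightarrow> real"
  assumes "F \<in> borel_measurable lebesgue" "integrable lebesgue w" "\<And>x. \<bar>F x\<bar> \<le> w x"
  shows "integrable lebesgue F" "\<bar>LINT x|lebesgue. F x\<bar> \<le> (LINT x|lebesgue. w x)"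
proof -
  show i: "integrable lebesgue F"
    by (rule Bochner_Integration.integrable_bound[OF assms(2,1)])
       (use assms(3) in \<open>auto intro: order_trans[OF _ abs_ge_self]\<close>)
  have "\<bar>LINT x|lebesgue. F x\<bar> \<le> (LINT x|lebesgue. \<bar>F x\<bar>)" by (rule integral_abs_bound)
  also have "\<dots> \<le> (LINT x|lebesgue. w x)" using i assms by (intro integral_mono integrable_abs)
  finally show "\<bar>LINT x|lebesgue. F x\<bar> \<le> (LINT x|lebesgue. w x)" .
qed

lemma critical_bound:
  assumes "in_L 6 u" "in_L 6 v" "F \<in> borel_measurable lebesgue" "\<And>x. \<bar>F x\<bar> \<le> c * (u x ^ 6 + v x ^ 6)"
  shows "integrable lebesgue F" "\<bar>LINT x|lebesgue. F x\<bar> \<le> c * (mass 6 u + mass 6 v)"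
proof -
  have 6: "norm (y :: real) powr 6 = y ^ 6" for y by simp
  have i: "integrable lebesgue (\<lambda>x. u x ^ 6)" "integrable lebesgue (\<lambda>x. v x ^ 6)"
    using assms(1,2) unfolding in_L_def 6 by auto
  then have "integrable lebesgue (\<lambda>x. c * (u x ^ 6 + v x ^ 6))" by auto
  from dominated_integral[OF assms(3) this assms(4)] i
  show "integrable lebesgue F" "\<bar>LINT x|lebesgue. F x\<bar> \<le> c * (mass 6 u + mass 6 v)"
    unfolding mass_def 6 by auto
qed

text \<open>The exponent \<open>2/(1-p)\<close> is the one for which \<open>K \<bar>x\<bar>\<^sup>p \<bar>y\<bar>\<close> is integrable for \<open>x, y\<close> in \<open>L\<^sup>2\<close>.\<close>

lemma sublinear_bound:
  assumes p: "0 < p" "p < 1" and K: "in_L (2 / (1 - p)) K" and x: "in_L 2 x" and y: "in_L 2 y"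
    and F: "F \<in> borel_measurable lebesgue" "\<And>z. \<bar>F z\<bar> \<le> c * (\<bar>K z\<bar> * (\<bar>x z\<bar> powr p * \<bar>y z\<bar>))" and c: "0 \<le> c"
  shows "integrable lebesgue F" "\<bar>LINT z|lebesgue. F z\<bar> \<le> c * (mass (2 / (1 - p)) K + mass 2 x + mass 2 y)"
proof -
  have pt: "\<bar>k\<bar> * (\<bar>s\<bar> powr p * \<bar>t\<bar>) \<le> norm k powr (2 / (1 - p)) + norm s powr 2 + norm t powr 2" for k s t :: real
  proof -
    have e: "2 / (1 - p) * ((1 - p) / 2) = 1" using p by simp
    have "(norm k powr (2 / (1 - p))) powr ((1 - p) / 2) = \<bar>k\<bar>" unfolding powr_powr e by simp
    moreover have "(norm s powr 2) powr (p / 2) = \<bar>s\<bar> powr p" by (simp only: powr_powr) simp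
    moreover have "(norm t powr 2) powr (1 / 2) = \<bar>t\<bar>" by (simp only: powr_powr) simp
    moreover have "(1 - p) / 2 + p / 2 + 1 / 2 = 1" by (simp add: field_simps)
    ultimately show ?thesis
      using powr_product_le[of "norm k powr (2 / (1 - p))" "norm s powr 2" "norm t powr 2" "(1 - p) / 2" "p / 2" "1 / 2"] p
      by (simp add: mult.assoc)
  qed
  have i: "integrable lebesgue (\<lambda>z. norm (K z) powr (2 / (1 - p)))" "integrable lebesgue (\<lambda>z. norm (x z) powr 2)"
     "integrable lebesgue (\<lambda>z. norm (y z) powr 2)"
    using K x y by (auto simp: in_L_def)
  have iw: "integrable lebesgue (\<lambda>z. c * (norm (K z) powr (2 / (1 - p)) + norm (x z) powr 2 + norm (y z) powr 2))"
    by (intro integrable_mult_right Bochner_Integration.integrable_add i)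
  have "\<bar>F z\<bar> \<le> c * (norm (K z) powr (2 / (1 - p)) + norm (x z) powr 2 + norm (y z) powr 2)" for z
    using F(2)[of z] mult_left_mono[OF pt c, of "K z" "x z" "y z"] by linarith
  from dominated_integral[OF F(1) iw this]
  have "integrable lebesgue F"
    and b: "\<bar>LINT z|lebesgue. F z\<bar> \<le> (LINT z|lebesgue. c * (norm (K z) powr (2 / (1 - p)) + norm (x z) powr 2 + norm (y z) powr 2))"
    by auto
  then show "integrable lebesgue F" by simp
  have "(LINT z|lebesgue. c * (norm (K z) powr (2 / (1 - p)) + norm (x z) powr 2 + norm (y z) powr 2))
     = c * (mass (2 / (1 - p)) K + mass 2 x + mass 2 y)"
    unfolding mass_def integral_mult_right_zero
    by (simp only: Bochner_Integration.integral_add[OF i(1,2)] Bochner_Integration.integral_add[OF Bochner_Integration.integrable_add[OF i(1,2)] i(3)])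
  with b show "\<bar>LINT z|lebesgue. F z\<bar> \<le> c * (mass (2 / (1 - p)) K + mass 2 x + mass 2 y)" by (simp only:)
qed

text \<open>Cut \<open>Q\<close> at a level. The part \<open>q\<close> above the level is in \<open>L\<^sup>2\<close>: if \<open>Q\<close> is in \<open>L\<^sup>s\<close> with \<open>s \<ge> 2\<close>, then
  \<open>q\<^sup>2 \<le> \<bar>Q\<bar>\<^sup>s\<close> for the level one, and if \<open>Q\<close> is essentially bounded, then \<open>q\<close> vanishes almost everywhere
  for a suitable level.\<close>

lemma coefficient_split:
  fixes Q :: "real ^ 3 \<Rightarrow> real"
  assumes "(\<exists>s\<ge>2. in_L s Q) \<or> in_L_infty Q"
  obtains C and q :: "real ^ 3 \<Rightarrow> real" where "0 \<le> C" "q \<in> borel_measurable lebesgue" "\<And>x. 0 \<le> q x" "integrable lebesgue (\<lambda>x. (q x)\<^sup>2)"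
    "\<And>x. \<bar>Q x\<bar> \<le> C + q x" "Q \<in> borel_measurable lebesgue"
  using assms
proof
  assume "\<exists>s\<ge>2. in_L s Q"
  then obtain s where s: "2 \<le> s" "in_L s Q" by blast
  have m [measurable]: "Q \<in> borel_measurable lebesgue" using s(2) by (rule in_L_measurable)
  define q where "q x = (if 1 < norm (Q x) then norm (Q x) else 0)" for x
  have qm: "q \<in> borel_measurable lebesgue" unfolding q_def by measurable
  have "integrable lebesgue (\<lambda>x. (q x)\<^sup>2)"
  proof (rule dominated_integral(1))
    show "integrable lebesgue (\<lambda>x. norm (Q x) powr s)" using s by (simp add: in_L_def)
    show "\<bar>(q x)\<^sup>2\<bar> \<le> norm (Q x) powr s" for x
    proof (cases "1 < \<bar>Q x\<bar>")
      case True
      then have "\<bar>Q x\<bar> powr 2 \<le> \<bar>Q x\<bar> powr s" using s by (intro powr_mono) auto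
      then show ?thesis using True by (simp add: q_def)
    qed (simp add: q_def)
  qed (use qm in measurable)
  then show ?thesis using m qm by (intro that[of 1 q]) (auto simp: q_def)
next
  assume "in_L_infty Q"
  then obtain C where m [measurable]: "Q \<in> borel_measurable lebesgue" and C: "AE x in lebesgue. norm (Q x) \<le> C"
    by (auto simp: in_L_infty_def)
  define q where "q x = (if \<bar>C\<bar> < norm (Q x) then norm (Q x) else 0)" for x
  have qm: "q \<in> borel_measurable lebesgue" unfolding q_def by measurable
  have "AE x in lebesgue. (q x)\<^sup>2 = 0" using C by eventually_elim (auto simp: q_def)
  then have "integrable lebesgue (\<lambda>x. (q x)\<^sup>2)"
    using qm by (intro integrable_cong_AE_imp[OF integrable_zero]) (auto elim: eventually_mono)
  then show ?thesis using m qm by (intro that[of "\<bar>C\<bar>" q]) (auto simp: q_def)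
qed

text \<open>With \<open>z = u\<^sup>2 + v\<^sup>2\<close>, the bounded part of \<open>Q\<close> contributes \<open>z\<^sup>6\<^sup>/\<^sup>5 \<le> z + z\<^sup>3\<close> and the part \<open>q\<close> in \<open>L\<^sup>2\<close>
  contributes \<open>(q z)\<^sup>6\<^sup>/\<^sup>5 \<le> q\<^sup>2 + 2 z\<^sup>3\<close>. By the Sobolev inequality, \<open>z\<close> and \<open>z\<^sup>3\<close> are integrable.\<close>

lemma source_in_L65:
  fixes Q :: "real ^ 3 \<Rightarrow> real"
  assumes Q: "(\<exists>s\<ge>2. in_L s Q) \<or> in_L_infty Q"
  shows "\<exists>M\<ge>0. \<forall>u\<in>H1. \<forall>v\<in>H1. in_L (6/5) (\<lambda>x. Q x * (u x * v x)) \<and>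
     (H1_norm u \<le> 1 \<longrightarrow> H1_norm v \<le> 1 \<longrightarrow> mass (6/5) (\<lambda>x. Q x * (u x * v x)) \<le> M)"
proof -
  obtain C q where C: "0 \<le> C" and q: "q \<in> borel_measurable lebesgue" "\<And>x. 0 \<le> q x" "integrable lebesgue (\<lambda>x. (q x)\<^sup>2)"
    and Qb: "\<And>x. \<bar>Q x\<bar> \<le> C + q x" and Qm: "Q \<in> borel_measurable lebesgue"
    using coefficient_split[OF Q] by metis
  define A where "A = 2 powr (6/5) * (C powr (6/5) + 1)"
  have A: "0 \<le> A" by (simp add: A_def)
  have pt: "norm (Q x * (s * t)) powr (6/5) \<le> A * ((q x)\<^sup>2 + norm s powr 2 + norm t powr 2 + 8 * (norm s powr 6 + norm t powr 6))"
    for x s t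
  proof -
    define z where "z = s\<^sup>2 + t\<^sup>2"
    have z: "0 \<le> z" by (simp add: z_def)
    have "\<bar>s * t\<bar> \<le> z" using sum_squares_bound[of "\<bar>s\<bar>" "\<bar>t\<bar>"] mult_nonneg_nonneg[OF abs_ge_zero abs_ge_zero, of s t]
      unfolding z_def power2_abs abs_mult mult.assoc by linarith
    then have "norm (Q x * (s * t)) powr (6/5) \<le> ((C + q x) * z) powr (6/5)"
      unfolding real_norm_def abs_mult[of "Q x"] using Qb[of x] q(2)[of x] C by (intro powr_mono2 mult_mono) auto
    also have "\<dots> = 2 powr (6/5) * ((C * z + q x * z) / 2) powr (6/5)"
      by (subst powr_mult[symmetric]) (auto simp: algebra_simps add_divide_distrib)
    also have "\<dots> \<le> 2 powr (6/5) * ((C * z) powr (6/5) + (q x * z) powr (6/5))"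
      using C q(2)[of x] z by (intro mult_left_mono powr_average_le) auto
    also have "\<dots> \<le> 2 powr (6/5) * (C powr (6/5) * (z + z ^ 3) + ((q x)\<^sup>2 + z ^ 3 + z ^ 3))"
    proof (intro mult_left_mono add_mono)
      have "z powr (6/5) \<le> z + z ^ 3"
      proof (cases "z \<le> 1")
        case True
        have "z powr (6/5) \<le> z powr 1" using z True by (intro powr_mono') auto
        then show ?thesis using z by (simp add: add_increasing2)
      next
        case False
        then have "z powr (6/5) \<le> z powr 3" by (intro powr_mono) auto
        then show ?thesis using z by (simp add: add_increasing)
      qed
      then show "(C * z) powr (6/5) \<le> C powr (6/5) * (z + z ^ 3)"
        using C z by (simp add: powr_mult mult_left_mono)
      have "(q x * z) powr (6/5) = (q x) powr (6/5) * (z powr (3/5) * z powr (3/5))"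
        using z q(2)[of x] by (simp add: powr_mult flip: powr_add)
      also have "\<dots> = ((q x)\<^sup>2) powr (3/5) * (z ^ 3) powr (1/5) * (z ^ 3) powr (1/5)"
        using z q(2)[of x] by (simp add: powr_powr mult.assoc flip: powr_numeral)
      also have "\<dots> \<le> (q x)\<^sup>2 + z ^ 3 + z ^ 3" using z by (intro powr_product_le) auto
      finally show "(q x * z) powr (6/5) \<le> (q x)\<^sup>2 + z ^ 3 + z ^ 3" .
    qed auto
    also have "\<dots> = 2 powr (6/5) * (C powr (6/5)) * (z + z ^ 3) + 2 powr (6/5) * ((q x)\<^sup>2 + 2 * z ^ 3)"
      by (simp add: algebra_simps)
    also have "\<dots> \<le> 2 powr (6/5) * (C powr (6/5)) * ((q x)\<^sup>2 + z + 2 * z ^ 3) + 2 powr (6/5) * ((q x)\<^sup>2 + z + 2 * z ^ 3)"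
      using z by (intro add_mono mult_left_mono) auto
    also have "\<dots> = A * ((q x)\<^sup>2 + z + 2 * z ^ 3)"
      by (simp add: A_def algebra_simps)
    also have "\<dots> \<le> A * ((q x)\<^sup>2 + norm s powr 2 + norm t powr 2 + 8 * (norm s powr 6 + norm t powr 6))"
    proof (intro mult_left_mono A)
      have "(a + b) ^ 3 \<le> 4 * (a ^ 3 + b ^ 3)" if "0 \<le> a" "0 \<le> b" for a b :: real
      proof -
        have "4 * (a ^ 3 + b ^ 3) - (a + b) ^ 3 = 3 * (a + b) * (a - b)\<^sup>2"
          by (simp add: power2_eq_square power3_eq_cube algebra_simps)
        then show ?thesis using that by (metis add_nonneg_nonneg diff_ge_0_iff_ge mult_nonneg_nonneg zero_le_numeral zero_le_power2)
      qed
      from this[of "s\<^sup>2" "t\<^sup>2"] have "z ^ 3 \<le> 4 * (s ^ 6 + t ^ 6)"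
        by (simp add: z_def flip: power_mult)
      then show "(q x)\<^sup>2 + z + 2 * z ^ 3 \<le> (q x)\<^sup>2 + norm s powr 2 + norm t powr 2 + 8 * (norm s powr 6 + norm t powr 6)"
        by (simp add: z_def)
    qed
    finally show ?thesis .
  qed
  define M where "M = A * ((LINT x|lebesgue. (q x)\<^sup>2) + 1 + 1 + 8 * (4096 + 4096))"
  have "0 \<le> M" unfolding M_def using A by (intro mult_nonneg_nonneg add_nonneg_nonneg integral_nonneg_AE AE_I2) auto
  moreover have "in_L (6/5) (\<lambda>x. Q x * (u x * v x)) \<and>
     (H1_norm u \<le> 1 \<longrightarrow> H1_norm v \<le> 1 \<longrightarrow> mass (6/5) (\<lambda>x. Q x * (u x * v x)) \<le> M)"
    if u: "u \<in> H1" and v: "v \<in> H1" for u v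
  proof -
    note mu = H1_mass[OF u] and mv = H1_mass[OF v]
    have i: "integrable lebesgue (\<lambda>x. norm (u x) powr 2)" "integrable lebesgue (\<lambda>x. norm (v x) powr 2)"
      "integrable lebesgue (\<lambda>x. norm (u x) powr 6)" "integrable lebesgue (\<lambda>x. norm (v x) powr 6)"
      using mu mv by (auto simp: in_L_def)
    define W where "W x = A * ((q x)\<^sup>2 + norm (u x) powr 2 + norm (v x) powr 2 + 8 * (norm (u x) powr 6 + norm (v x) powr 6))" for x
    have iW: "integrable lebesgue W" unfolding W_def
      by (intro integrable_mult_right Bochner_Integration.integrable_add i q(3))
    have Wint: "(LINT x|lebesgue. W x) = A * ((LINT x|lebesgue. (q x)\<^sup>2) + mass 2 u + mass 2 v + 8 * (mass 6 u + mass 6 v))"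
      unfolding W_def mass_def using i q(3) by (simp del: powr_numeral)
    have m: "(\<lambda>x. Q x * (u x * v x)) \<in> borel_measurable lebesgue"
      using Qm in_L_measurable[OF mu(1)] in_L_measurable[OF mv(1)] by (intro borel_measurable_times)
    note L = in_L_dominated[OF m iW, of "6/5"]
    show ?thesis
    proof (intro conjI impI)
      show "in_L (6/5) (\<lambda>x. Q x * (u x * v x))" using pt by (intro L(1)) (simp only: W_def)
      assume "H1_norm u \<le> 1" "H1_norm v \<le> 1"
      then have "(LINT x|lebesgue. W x) \<le> M" unfolding Wint M_def
        using H1_mass_le_1[OF u] H1_mass_le_1[OF v] by (intro mult_left_mono add_mono A order_refl) auto
      moreover have "mass (6/5) (\<lambda>x. Q x * (u x * v x)) \<le> (LINT x|lebesgue. W x)"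
        using pt by (intro L(2)) (simp only: W_def)
      ultimately show "mass (6/5) (\<lambda>x. Q x * (u x * v x)) \<le> M" by simp
    qed
  qed
  ultimately show ?thesis by blast
qed

section \<open>The functional and its derivative\<close>

lemma bounded_formD:
  assumes "bounded_form T C"
  shows "in_L (6/5) f \<Longrightarrow> in_L (6/5) g \<Longrightarrow> T f g = T g f"
    and "in_L (6/5) f \<Longrightarrow> in_L (6/5) g \<Longrightarrow> in_L (6/5) h \<Longrightarrow> T f (\<lambda>x. g x + r * h x) = T f g + r * T f h"
    and "in_L (6/5) f \<Longrightarrow> in_L (6/5) g \<Longrightarrow> mass (6/5) f \<le> 1 \<Longrightarrow> mass (6/5) g \<le> 1 \<Longrightarrow> \<bar>T f g\<bar> \<le> C"
  using assms by (auto simp: bounded_form_def)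

lemma bounded_form_scale:
  assumes T: "bounded_form T C" and f: "in_L (6/5) f" and g: "in_L (6/5) g"
  shows "T (\<lambda>x. r * f x) (\<lambda>x. s * g x) = r * s * T f g"
proof -
  have right: "T h (\<lambda>x. s * k x) = s * T h k" if h: "in_L (6/5) h" and k: "in_L (6/5) k" for h k s
  proof -
    have "T h (\<lambda>x. 0) = 0" using bounded_formD(2)[OF T h in_L_zero in_L_zero, of 1] by simp
    then show ?thesis using bounded_formD(2)[OF T h in_L_zero k, of s] by simp
  qed
  have rf: "in_L (6/5) (\<lambda>x. r * f x)" by (rule in_L_scale_real(1)[OF f])
  have "T (\<lambda>x. r * f x) (\<lambda>x. s * g x) = s * T (\<lambda>x. r * f x) g" by (rule right[OF rf g])
  also have "T (\<lambda>x. r * f x) g = T g (\<lambda>x. r * f x)" by (rule bounded_formD(1)[OF T rf g])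
  also have "\<dots> = r * T g f" by (rule right[OF g f])
  also have "T g f = T f g" by (rule bounded_formD(1)[OF T g f])
  finally show ?thesis by (simp add: mult_ac)
qed

text \<open>The sources \<open>Q u v\<close> have bounded, though not normalised, mass for \<open>u, v\<close> in the unit ball; the
  factor \<open>c\<close> normalises them.\<close>

lemma interaction_source_bound:
  assumes Q: "(\<exists>s\<ge>2. in_L s Q) \<or> in_L_infty Q"
  shows "\<exists>C\<ge>0. \<forall>u\<in>H1. \<forall>v\<in>H1. \<forall>w\<in>H1. \<forall>z\<in>H1.
    H1_norm u \<le> 1 \<longrightarrow> H1_norm v \<le> 1 \<longrightarrow> H1_norm w \<le> 1 \<longrightarrow> H1_norm z \<le> 1 \<longrightarrow>
    \<bar>interaction a (\<lambda>x. Q x * (u x * v x)) (\<lambda>x. Q x * (w x * z x))\<bar> \<le> C"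
proof -
  obtain C0 where C0: "bounded_form (interaction a) C0" using interaction_bounded by blast
  obtain M where M: "M \<ge> 0"
    and src: "\<And>u v. u \<in> H1 \<Longrightarrow> v \<in> H1 \<Longrightarrow> in_L (6/5) (\<lambda>x. Q x * (u x * v x))"
      "\<And>u v. u \<in> H1 \<Longrightarrow> v \<in> H1 \<Longrightarrow> H1_norm u \<le> 1 \<Longrightarrow> H1_norm v \<le> 1 \<Longrightarrow> mass (6/5) (\<lambda>x. Q x * (u x * v x)) \<le> M"
    using source_in_L65[OF Q] by blast
  define c where "c = (M + 1) powr (- (5/6))"
  have c: "c > 0" "c powr (6/5) * M \<le> 1"
  proof -
    show "c > 0" using M by (simp add: c_def)
    have "c powr (6/5) = (M + 1) powr (- 1)" by (simp add: c_def powr_powr)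
    also have "\<dots> = 1 / (M + 1)" using M by (simp add: powr_minus_divide)
    finally have e: "c powr (6/5) = 1 / (M + 1)" .
    show "c powr (6/5) * M \<le> 1" unfolding e using M by simp
  qed
  show ?thesis
  proof (intro exI[of _ "\<bar>C0\<bar> / c\<^sup>2"] conjI ballI impI)
    fix u v w z assume H: "u \<in> H1" "v \<in> H1" "w \<in> H1" "z \<in> H1"
      "H1_norm u \<le> 1" "H1_norm v \<le> 1" "H1_norm w \<le> 1" "H1_norm z \<le> 1"
    let ?f = "\<lambda>x. Q x * (u x * v x)" and ?g = "\<lambda>x. Q x * (w x * z x)"
    have f: "in_L (6/5) ?f" "mass (6/5) ?f \<le> M" and g: "in_L (6/5) ?g" "mass (6/5) ?g \<le> M"
      using src H by auto
    have n: "mass (6/5) (\<lambda>x. c * k x) \<le> 1" if "in_L (6/5) k" "mass (6/5) k \<le> M" for k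
    proof -
      have "mass (6/5) (\<lambda>x. c * k x) = c powr (6/5) * mass (6/5) k"
        using in_L_scale_real(2)[OF that(1), of c] c by simp
      also have "\<dots> \<le> c powr (6/5) * M" using that(2) by (intro mult_left_mono) auto
      finally show ?thesis using c by simp
    qed
    have "\<bar>interaction a (\<lambda>x. c * ?f x) (\<lambda>x. c * ?g x)\<bar> \<le> C0"
      by (rule bounded_formD(3)[OF C0 in_L_scale_real(1)[OF f(1)] in_L_scale_real(1)[OF g(1)] n[OF f] n[OF g]])
    then have "c\<^sup>2 * \<bar>interaction a ?f ?g\<bar> \<le> C0"
      unfolding bounded_form_scale[OF C0 f(1) g(1)] by (simp add: abs_mult power2_eq_square)
    then show "\<bar>interaction a ?f ?g\<bar> \<le> \<bar>C0\<bar> / c\<^sup>2" using c by (simp add: field_simps)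
  qed simp
qed

lemma spow_scale: "0 < s \<Longrightarrow> spow p (s * x) = s powr p * spow p x"
proof -
  assume s: "0 < s"
  have "s powr (p - 1) * s = s powr p" using s powr_add[of s "p - 1" 1] by simp
  then show ?thesis using s by (simp add: spow_def abs_mult powr_mult mult_ac)
qed

lemma spow_measurable:
  assumes [measurable]: "u \<in> borel_measurable M" shows "(\<lambda>x. spow p (u x)) \<in> borel_measurable M"
  unfolding spow_def by measurable

text \<open>The setting for the estimates of one functional. The assumption on \<open>C\<close> does not involve \<open>l\<close>; so the
  same \<open>C\<close> serves all functionals in the limit \<open>l \<rightarrow> 0\<close>.\<close>

locale coupled_energy =
  fixes Q K :: "real ^ 3 \<Rightarrow> real" and p a l C :: real
  assumes p: "0 < p" "p < 1" and K: "in_L (2 / (1 - p)) K" and l: "0 < l" and C: "0 \<le> C"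
    and source: "\<And>u v. u \<in> H1 \<Longrightarrow> v \<in> H1 \<Longrightarrow> in_L (6/5) (\<lambda>x. Q x * (u x * v x))"
    and form_bound: "\<And>u v w z. u \<in> H1 \<Longrightarrow> v \<in> H1 \<Longrightarrow> w \<in> H1 \<Longrightarrow> z \<in> H1 \<Longrightarrow>
        H1_norm u \<le> 1 \<Longrightarrow> H1_norm v \<le> 1 \<Longrightarrow> H1_norm w \<le> 1 \<Longrightarrow> H1_norm z \<le> 1 \<Longrightarrow>
        \<bar>interaction a (\<lambda>x. Q x * (u x * v x)) (\<lambda>x. Q x * (w x * z x))\<bar> \<le> C"
begin

definition MK :: real where "MK = mass (2 / (1 - p)) K + 2"

definition coupling where
  "coupling u v w z = interaction a (\<lambda>x. Q x * (u x * v x)) (\<lambda>x. Q x * (w x * z x))"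

definition energy_differential :: "(real ^ 3 \<Rightarrow> real) \<Rightarrow> (real ^ 3 \<Rightarrow> real) \<Rightarrow> real" where
  "energy_differential u v = H1_inner u v + coupling u u u v - (LINT x|lebesgue. u x ^ 5 * v x)
     - l * (LINT x|lebesgue. K x * (spow p (u x) * v x))"

lemma MK: "0 \<le> MK"
  using mass_nonneg[of "2 / (1 - p)" K] by (simp add: MK_def)

lemma form: "\<exists>C0. bounded_form (interaction a) C0"
  by (rule interaction_bounded)

lemma coupling_lin:
  assumes "u \<in> H1" "v \<in> H1" "w \<in> H1" "z \<in> H1" "z' \<in> H1"
  shows "coupling u v w (\<lambda>x. z x + r * z' x) = coupling u v w z + r * coupling u v w z'"
proof -
  obtain C0 where C0: "bounded_form (interaction a) C0" using form by blast
  have "(\<lambda>x. Q x * (w x * (z x + r * z' x))) = (\<lambda>x. Q x * (w x * z x) + r * (Q x * (w x * z' x)))"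
    by (simp add: algebra_simps)
  then show ?thesis unfolding coupling_def
    using bounded_formD(2)[OF C0 source[OF assms(1,2)] source[OF assms(3,4)] source[OF assms(3,5)], of r] by simp
qed

lemma coupling_scale:
  assumes H: "u \<in> H1" "v \<in> H1" "w \<in> H1" "z \<in> H1"
    and N: "H1_norm u \<le> t1" "H1_norm v \<le> t2" "H1_norm w \<le> t3" "H1_norm z \<le> t4"
    and t: "0 < t1" "0 < t2" "0 < t3" "0 < t4"
  shows "\<bar>coupling u v w z\<bar> \<le> t1 * t2 * t3 * t4 * C"
proof -
  obtain C0 where C0: "bounded_form (interaction a) C0" using form by blast
  note nu = H1_normalise[OF H(1) N(1) t(1)] and nv = H1_normalise[OF H(2) N(2) t(2)]
    and nw = H1_normalise[OF H(3) N(3) t(3)] and nz = H1_normalise[OF H(4) N(4) t(4)]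
  let ?f = "\<lambda>x. Q x * (((1 / t1) * u x) * ((1 / t2) * v x))" and ?g = "\<lambda>x. Q x * (((1 / t3) * w x) * ((1 / t4) * z x))"
  have e: "(\<lambda>x. Q x * (u x * v x)) = (\<lambda>x. (t1 * t2) * ?f x)" "(\<lambda>x. Q x * (w x * z x)) = (\<lambda>x. (t3 * t4) * ?g x)"
    using t by auto
  have "coupling u v w z = (t1 * t2) * (t3 * t4) * interaction a ?f ?g"
    unfolding coupling_def e
    by (rule bounded_form_scale[OF C0 source[OF nu(1) nv(1)] source[OF nw(1) nz(1)]])
  then have "\<bar>coupling u v w z\<bar> = (t1 * t2) * (t3 * t4) * \<bar>interaction a ?f ?g\<bar>"
    using t by (simp add: abs_mult)
  also have "\<dots> \<le> (t1 * t2) * (t3 * t4) * C"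
    using t form_bound[OF nu(1) nv(1) nw(1) nz(1) nu(2) nv(2) nw(2) nz(2)] by (intro mult_left_mono) auto
  finally show ?thesis by (simp add: mult_ac)
qed

lemma inner_scale:
  assumes u: "u \<in> H1" "H1_norm u \<le> s" "0 < s" and v: "v \<in> H1" "H1_norm v \<le> t" "0 < t"
  shows "\<bar>H1_inner u v\<bar> \<le> s * t"
proof -
  note nu = H1_normalise[OF u] and nv = H1_normalise[OF v]
  have "H1_inner (\<lambda>x. (1 / s) * u x) (\<lambda>x. (1 / t) * v x) = (1 / t) * H1_inner (\<lambda>x. (1 / s) * u x) v"
    by (rule H1_inner_scale[OF nu(1) v(1)])
  also have "H1_inner (\<lambda>x. (1 / s) * u x) v = (1 / s) * H1_inner v u"
    unfolding H1_inner_commute[of _ v] by (rule H1_inner_scale[OF v(1) u(1)])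
  finally have "H1_inner (\<lambda>x. (1 / s) * u x) (\<lambda>x. (1 / t) * v x) = (1 / t) * ((1 / s) * H1_inner u v)"
    unfolding H1_inner_commute[of v u] .
  then have "H1_inner u v = s * t * H1_inner (\<lambda>x. (1 / s) * u x) (\<lambda>x. (1 / t) * v x)"
    using u v by simp
  then have "\<bar>H1_inner u v\<bar> = s * t * \<bar>H1_inner (\<lambda>x. (1 / s) * u x) (\<lambda>x. (1 / t) * v x)\<bar>"
    using u v by (simp add: abs_mult)
  also have "\<dots> \<le> s * t * 1"
    using u v by (intro mult_left_mono H1_inner_le_1 nu nv) auto
  finally show ?thesis by simp
qed

lemma critical_term:
  assumes u: "u \<in> H1" and v: "v \<in> H1"
  shows "integrable lebesgue (\<lambda>x. u x ^ 5 * v x)"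
    and "\<bar>LINT x|lebesgue. u x ^ 5 * v x\<bar> \<le> mass 6 u + mass 6 v"
proof -
  have m: "u \<in> borel_measurable lebesgue" "v \<in> borel_measurable lebesgue"
    using H1_mass(1)[OF u] H1_mass(1)[OF v] by (auto dest: in_L_measurable)
  have F: "(\<lambda>x. u x ^ 5 * v x) \<in> borel_measurable lebesgue"
    using m by (intro borel_measurable_times borel_measurable_power)
  have b: "\<bar>u x ^ 5 * v x\<bar> \<le> 1 * (u x ^ 6 + v x ^ 6)" for x
    using monomial_le[of 5 1 "u x" "v x"] by (simp add: abs_mult power_abs)
  note cb = critical_bound[OF H1_mass(2)[OF u] H1_mass(2)[OF v] F b]
  show "integrable lebesgue (\<lambda>x. u x ^ 5 * v x)" by (rule cb(1))
  show "\<bar>LINT x|lebesgue. u x ^ 5 * v x\<bar> \<le> mass 6 u + mass 6 v" using cb(2) by simp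
qed

lemma critical_scale:
  assumes u: "u \<in> H1" "H1_norm u \<le> s" "0 < s" and v: "v \<in> H1" "H1_norm v \<le> t" "0 < t"
  shows "\<bar>LINT x|lebesgue. u x ^ 5 * v x\<bar> \<le> s ^ 5 * t * 8192"
proof -
  note nu = H1_normalise[OF u] and nv = H1_normalise[OF v]
  have "(\<lambda>x. u x ^ 5 * v x) = (\<lambda>x. s ^ 5 * t * (((1 / s) * u x) ^ 5 * ((1 / t) * v x)))"
    using u v by (simp add: power_divide)
  then have "\<bar>LINT x|lebesgue. u x ^ 5 * v x\<bar> = s ^ 5 * t * \<bar>LINT x|lebesgue. ((1 / s) * u x) ^ 5 * ((1 / t) * v x)\<bar>"
    using u v by (simp only: integral_mult_right_zero abs_mult) simp
  also have "\<dots> \<le> s ^ 5 * t * (4096 + 4096)"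
    using critical_term(2)[OF nu(1) nv(1)] H1_mass_le_1(2)[OF nu] H1_mass_le_1(2)[OF nv] u v
    by (intro mult_left_mono) auto
  finally show ?thesis by simp
qed

lemma sublinear_term:
  assumes u: "u \<in> H1" and v: "v \<in> H1"
  shows "integrable lebesgue (\<lambda>x. K x * (spow p (u x) * v x))"
    and "\<bar>LINT x|lebesgue. K x * (spow p (u x) * v x)\<bar> \<le> mass (2 / (1 - p)) K + mass 2 u + mass 2 v"
proof -
  have m: "u \<in> borel_measurable lebesgue" "v \<in> borel_measurable lebesgue"
    using H1_mass(1)[OF u] H1_mass(1)[OF v] by (auto dest: in_L_measurable)
  have F: "(\<lambda>x. K x * (spow p (u x) * v x)) \<in> borel_measurable lebesgue"
    using m in_L_measurable[OF K] by (intro borel_measurable_times spow_measurable)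
  have b: "\<bar>K x * (spow p (u x) * v x)\<bar> \<le> 1 * (\<bar>K x\<bar> * (\<bar>u x\<bar> powr p * \<bar>v x\<bar>))" for x
    using p by (simp add: abs_mult abs_spow)
  note sb = sublinear_bound[OF p K H1_mass(1)[OF u] H1_mass(1)[OF v] F b zero_le_one]
  show "integrable lebesgue (\<lambda>x. K x * (spow p (u x) * v x))" by (rule sb(1))
  show "\<bar>LINT x|lebesgue. K x * (spow p (u x) * v x)\<bar> \<le> mass (2 / (1 - p)) K + mass 2 u + mass 2 v" using sb(2) by simp
qed

lemma sublinear_scale:
  assumes u: "u \<in> H1" "H1_norm u \<le> s" "0 < s" and v: "v \<in> H1" "H1_norm v \<le> t" "0 < t"
  shows "\<bar>LINT x|lebesgue. K x * (spow p (u x) * v x)\<bar> \<le> s powr p * t * MK"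
proof -
  note nu = H1_normalise[OF u] and nv = H1_normalise[OF v]
  have "K x * (spow p (u x) * v x) = s powr p * t * (K x * (spow p ((1 / s) * u x) * ((1 / t) * v x)))" for x
    using spow_scale[OF u(3), of p "(1 / s) * u x"] u v by simp
  then have "\<bar>LINT x|lebesgue. K x * (spow p (u x) * v x)\<bar> = s powr p * t * \<bar>LINT x|lebesgue. K x * (spow p ((1 / s) * u x) * ((1 / t) * v x))\<bar>"
    using u v by (simp only: integral_mult_right_zero abs_mult) simp
  also have "\<dots> \<le> s powr p * t * MK"
    using sublinear_term(2)[OF nu(1) nv(1)] H1_mass_le_1(1)[OF nu] H1_mass_le_1(1)[OF nv] u v
    by (intro mult_left_mono) (auto simp: MK_def)
  finally show ?thesis .
qed

lemma energy_eq:
  "energy Q K p a l u = 1/2 * H1_inner u u + 1/4 * coupling u u u u - 1/6 * (LINT x|lebesgue. u x ^ 6)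
     - l / (p + 1) * (LINT x|lebesgue. K x * \<bar>u x\<bar> powr (p + 1))"
proof -
  have "(LINT x|lebesgue. Q x * potential Q a u x * (u x)\<^sup>2) = coupling u u u u"
    unfolding interaction_potential coupling_def by (simp add: power2_eq_square)
  then show ?thesis by (simp add: energy_def H1_norm_square)
qed

definition energy_rate :: "real \<Rightarrow> real" where
  "energy_rate s = s\<^sup>2 + s ^ 4 * C + 8192 * s ^ 6 + l * (s powr p * s * MK)"

definition derivative_rate :: "real \<Rightarrow> real" where
  "derivative_rate s = s + s ^ 3 * C + 8192 * s ^ 5 + l * (s powr p * MK)"

lemma energy_bound:
  assumes u: "u \<in> H1" "H1_norm u \<le> s" "0 < s"
  shows "\<bar>energy Q K p a l u\<bar> \<le> energy_rate s"
proof -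
  have 1: "\<bar>H1_inner u u\<bar> \<le> s\<^sup>2" using inner_scale[OF u u] by (simp add: power2_eq_square)
  have 2: "\<bar>coupling u u u u\<bar> \<le> s ^ 4 * C"
    using coupling_scale[OF u(1) u(1) u(1) u(1) u(2) u(2) u(2) u(2) u(3) u(3) u(3) u(3)]
    by (simp add: eval_nat_numeral mult_ac)
  have 3: "\<bar>LINT x|lebesgue. u x ^ 6\<bar> \<le> 8192 * s ^ 6"
  proof -
    have "u x ^ 5 * u x = u x ^ 6" "s ^ 5 * s = s ^ 6" for x by (simp_all add: eval_nat_numeral)
    then show ?thesis using critical_scale[OF u u] by simp
  qed
  have 4: "\<bar>LINT x|lebesgue. K x * \<bar>u x\<bar> powr (p + 1)\<bar> \<le> s powr p * s * MK"
    using sublinear_scale[OF u u] by (simp add: spow_self p)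
  have 5: "\<bar>l / (p + 1) * (LINT x|lebesgue. K x * \<bar>u x\<bar> powr (p + 1))\<bar> \<le> l * (s powr p * s * MK)"
    unfolding abs_mult using l p 4 by (intro mult_mono) (auto simp: field_simps)
  have "\<bar>1/2 * x + 1/4 * y - 1/6 * z - k\<bar> \<le> X + Y + Z + W"
    if "\<bar>x\<bar> \<le> X" "\<bar>y\<bar> \<le> Y" "\<bar>z\<bar> \<le> Z" "\<bar>k\<bar> \<le> W" for x y z k X Y Z W :: real
    using that by linarith
  from this[OF 1 2 3 5] show ?thesis unfolding energy_eq energy_rate_def .
qed

lemma energy_differential_bound:
  assumes u: "u \<in> H1" "H1_norm u \<le> s" "0 < s" and v: "v \<in> H1" "H1_norm v \<le> 1"
  shows "\<bar>energy_differential u v\<bar> \<le> derivative_rate s"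
proof -
  have 1: "\<bar>H1_inner u v\<bar> \<le> s" using inner_scale[OF u v] by simp
  have 2: "\<bar>coupling u u u v\<bar> \<le> s ^ 3 * C"
    using coupling_scale[OF u(1) u(1) u(1) v(1) u(2) u(2) u(2) v(2) u(3) u(3) u(3)]
    by (simp add: eval_nat_numeral mult_ac)
  have 3: "\<bar>LINT x|lebesgue. u x ^ 5 * v x\<bar> \<le> 8192 * s ^ 5" using critical_scale[OF u v] by simp
  have 4: "\<bar>LINT x|lebesgue. K x * (spow p (u x) * v x)\<bar> \<le> s powr p * MK" using sublinear_scale[OF u v] by simp
  have 5: "\<bar>l * (LINT x|lebesgue. K x * (spow p (u x) * v x))\<bar> \<le> l * (s powr p * MK)"
    unfolding abs_mult using l 4 by (intro mult_mono) auto
  show ?thesis unfolding energy_differential_def derivative_rate_def using 1 2 3 5 by (simp add: abs_le_iff)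
qed

lemma energy_differential_lin:
  assumes u: "u \<in> H1" and v: "v \<in> H1" and w: "w \<in> H1"
  shows "energy_differential u (\<lambda>x. v x + r * w x) = energy_differential u v + r * energy_differential u w"
proof -
  have "(LINT x|lebesgue. u x ^ 5 * (v x + r * w x)) = (LINT x|lebesgue. u x ^ 5 * v x + r * (u x ^ 5 * w x))"
    by (simp add: algebra_simps)
  also have "\<dots> = (LINT x|lebesgue. u x ^ 5 * v x) + r * (LINT x|lebesgue. u x ^ 5 * w x)"
    using critical_term(1)[OF u v] critical_term(1)[OF u w] by simp
  finally have 1: "(LINT x|lebesgue. u x ^ 5 * (v x + r * w x)) = (LINT x|lebesgue. u x ^ 5 * v x) + r * (LINT x|lebesgue. u x ^ 5 * w x)" .
  have "(LINT x|lebesgue. K x * (spow p (u x) * (v x + r * w x)))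
     = (LINT x|lebesgue. K x * (spow p (u x) * v x) + r * (K x * (spow p (u x) * w x)))"
    by (simp add: algebra_simps)
  also have "\<dots> = (LINT x|lebesgue. K x * (spow p (u x) * v x)) + r * (LINT x|lebesgue. K x * (spow p (u x) * w x))"
    using sublinear_term(1)[OF u v] sublinear_term(1)[OF u w] by simp
  finally have 2: "(LINT x|lebesgue. K x * (spow p (u x) * (v x + r * w x)))
     = (LINT x|lebesgue. K x * (spow p (u x) * v x)) + r * (LINT x|lebesgue. K x * (spow p (u x) * w x))" .
  show ?thesis
    unfolding energy_differential_def 1 2 H1_inner_lin[OF u v w] coupling_lin[OF u u u v w] by (simp add: algebra_simps)
qed

lemma energy_differential_functional:
  assumes u: "u \<in> H1" shows "H1_functional (energy_differential u)"
proof -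
  have "energy_differential u (\<lambda>x. 0) = 0" using energy_differential_lin[OF u H1_zero H1_zero, of 1] by simp
  then have scale: "energy_differential u (\<lambda>x. r * v x) = r * energy_differential u v" if "v \<in> H1" for r v
    using energy_differential_lin[OF u H1_zero that, of r] by simp
  define s where "s = H1_norm u + 1"
  have s: "H1_norm u \<le> s" "0 < s" using H1_norm_nonneg[of u] by (auto simp: s_def)
  define R where "R = derivative_rate s"
  have b: "\<bar>energy_differential u v\<bar> \<le> R * t" if v: "v \<in> H1" "H1_norm v \<le> t" "0 < t" for v t
  proof -
    note nv = H1_normalise[OF v]
    have "\<bar>(1 / t) * energy_differential u v\<bar> \<le> R"
      using energy_differential_bound[OF u s nv] scale[OF v(1), of "1 / t"] by (simp add: R_def)
    then show ?thesis using v by (simp add: abs_mult field_simps)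
  qed
  have "\<bar>energy_differential u v\<bar> \<le> R * H1_norm v" if v: "v \<in> H1" for v
  proof (rule field_le_epsilon)
    fix e :: real assume e: "0 < e"
    have R: "0 \<le> R" using b[OF H1_zero, of "H1_norm (\<lambda>x. 0) + 1"] H1_norm_nonneg[of "\<lambda>x. 0"]
      by (smt (verit) zero_le_mult_iff)
    have "\<bar>energy_differential u v\<bar> \<le> R * (H1_norm v + e / (R + 1))"
      using R e H1_norm_nonneg[of v] by (intro b v) (auto simp: add_nonneg_pos)
    also have "\<dots> \<le> R * H1_norm v + e" using R e by (simp add: field_simps)
    finally show "\<bar>energy_differential u v\<bar> \<le> R * H1_norm v + e" .
  qed
  then show ?thesis unfolding H1_functional_def
    using energy_differential_lin[OF u, of _ _ 1] scale by auto
qed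

text \<open>The source \<open>Q (u + v)\<^sup>2\<close> splits into three terms; the expansion of the symmetric form has the linear
  part \<open>4 T(Q u\<^sup>2, Q u v)\<close> and terms at least quadratic in \<open>v\<close>.\<close>

lemma coupling_expand:
  assumes u: "u \<in> H1" and v: "v \<in> H1"
  defines "s \<equiv> (\<lambda>x. u x + v x)"
  shows "coupling s s s s = coupling u u u u + 4 * coupling u u u v
     + (2 * coupling u u v v + 4 * coupling u v u v + 4 * coupling u v v v + coupling v v v v)"
proof -
  obtain C0 where C0: "bounded_form (interaction a) C0" using form by blast
  define f where "f = (\<lambda>x. Q x * (u x * u x))"
  define g where "g = (\<lambda>x. Q x * (u x * v x))"
  define h where "h = (\<lambda>x. Q x * (v x * v x))"
  have f: "in_L (6/5) f" and g: "in_L (6/5) g" and h: "in_L (6/5) h"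
    unfolding f_def g_def h_def by (rule source; fact)+
  let ?I = "interaction a"
  have fg: "in_L (6/5) (\<lambda>x. f x + 2 * g x)" by (rule in_L_lin_real[OF f g]) simp
  define X where "X = (\<lambda>x. (f x + 2 * g x) + 1 * h x)"
  have X: "in_L (6/5) X" unfolding X_def by (rule in_L_lin_real[OF fg h]) simp
  have eX: "(\<lambda>x. Q x * (s x * s x)) = X" by (auto simp: X_def f_def g_def h_def s_def algebra_simps)
  have exp: "?I k X = ?I k f + 2 * ?I k g + ?I k h" if k: "in_L (6/5) k" for k
    unfolding X_def using bounded_formD(2)[OF C0 k fg h, of 1] bounded_formD(2)[OF C0 k f g, of 2] by simp
  have "coupling s s s s = ?I X X" unfolding coupling_def eX ..
  also have "\<dots> = ?I f X + 2 * ?I g X + ?I h X"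
    unfolding exp[OF X] bounded_formD(1)[OF C0 X f] bounded_formD(1)[OF C0 X g] bounded_formD(1)[OF C0 X h] ..
  also have "\<dots> = ?I f f + 4 * ?I f g + (2 * ?I f h + 4 * ?I g g + 4 * ?I g h + ?I h h)"
    unfolding exp[OF f] exp[OF g] exp[OF h]
      bounded_formD(1)[OF C0 g f] bounded_formD(1)[OF C0 h f] bounded_formD(1)[OF C0 h g] by simp
  finally show ?thesis by (simp add: coupling_def f_def g_def h_def)
qed

text \<open>The nonlocal, the critical and the quadratic term leave remainders of order \<open>t\<^sup>2\<close>. The remainder of
  the sublinear term has order \<open>t\<^sup>p\<^sup>+\<^sup>1\<close>, the largest of all for \<open>t \<le> 1\<close>.\<close>

lemma remainder_bound:
  assumes u: "u \<in> H1" "H1_norm u \<le> U" "1 \<le> U" and v: "v \<in> H1" "H1_norm v \<le> t" "0 < t" "t \<le> 1"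
  shows "\<bar>energy Q K p a l (\<lambda>x. u x + v x) - energy Q K p a l u - energy_differential u v\<bar>
    \<le> (1 + 11 * U\<^sup>2 * C + 57 * (mass 6 u + 4096) + 4 * l * MK) * t powr (p + 1)"
proof -
  \<comment> \<open>Pointwise Young inequalities apply to \<open>w\<close>, which is in the unit ball.\<close>
  define w where "w = (\<lambda>x. (1 / t) * v x)"
  have w: "w \<in> H1" "H1_norm w \<le> 1" unfolding w_def using H1_normalise[OF v(1,2,3)] by auto
  have vw: "v x = t * w x" for x using v by (simp add: w_def)
  have U: "0 < U" using u by simp
  have s: "(\<lambda>x. u x + v x) \<in> H1" using H1_lin[OF u(1) v(1), of 1] by simp
  have t2: "t\<^sup>2 \<le> t powr (p + 1)"
  proof -
    have "t powr 2 \<le> t powr (p + 1)" using v p by (intro powr_mono') auto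
    then show ?thesis using v by simp
  qed
  have um: "u \<in> borel_measurable lebesgue" and vm: "v \<in> borel_measurable lebesgue" and wm: "w \<in> borel_measurable lebesgue"
    using H1_mass(1)[OF u(1)] H1_mass(1)[OF v(1)] H1_mass(1)[OF w(1)] by (auto dest: in_L_measurable)
  have i6: "integrable lebesgue (\<lambda>x. k x ^ 6)" if "k \<in> H1" for k
    using critical_term(1)[OF that that] by (simp add: eval_nat_numeral mult_ac)
  have iK: "integrable lebesgue (\<lambda>x. K x * \<bar>k x\<bar> powr (p + 1))" if "k \<in> H1" for k
    using sublinear_term(1)[OF that that] by (simp add: spow_self p)
  define R1 where "R1 = H1_inner v v"
  define R2 where "R2 = 2 * coupling u u v v + 4 * coupling u v u v + 4 * coupling u v v v + coupling v v v v"
  define R3 where "R3 = (LINT x|lebesgue. (u x + v x) ^ 6 - u x ^ 6 - 6 * (u x ^ 5 * v x))"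
  define R4 where "R4 = (LINT x|lebesgue. K x * (\<bar>u x + v x\<bar> powr (p + 1) - \<bar>u x\<bar> powr (p + 1) - (p + 1) * (spow p (u x) * v x)))"
  have e1: "H1_inner (\<lambda>x. u x + v x) (\<lambda>x. u x + v x) = H1_inner u u + 2 * H1_inner u v + R1"
    using H1_inner_add_square[OF u(1) v(1), of 1] by (simp add: R1_def)
  have e3: "(LINT x|lebesgue. (u x + v x) ^ 6) = (LINT x|lebesgue. u x ^ 6) + 6 * (LINT x|lebesgue. u x ^ 5 * v x) + R3"
    unfolding R3_def using i6[OF s] i6[OF u(1)] critical_term(1)[OF u(1) v(1)] by simp
  have e4: "(LINT x|lebesgue. K x * \<bar>u x + v x\<bar> powr (p + 1)) = (LINT x|lebesgue. K x * \<bar>u x\<bar> powr (p + 1))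
       + (p + 1) * (LINT x|lebesgue. K x * (spow p (u x) * v x)) + R4"
  proof -
    have "R4 = (LINT x|lebesgue. K x * \<bar>u x + v x\<bar> powr (p + 1) - K x * \<bar>u x\<bar> powr (p + 1) - (p + 1) * (K x * (spow p (u x) * v x)))"
      unfolding R4_def by (simp add: algebra_simps)
    also have "\<dots> = (LINT x|lebesgue. K x * \<bar>u x + v x\<bar> powr (p + 1)) - (LINT x|lebesgue. K x * \<bar>u x\<bar> powr (p + 1))
       - (p + 1) * (LINT x|lebesgue. K x * (spow p (u x) * v x))"
      using iK[OF s] iK[OF u(1)] sublinear_term(1)[OF u(1) v(1)] by simp
    finally show ?thesis by simp
  qed
  have "energy Q K p a l (\<lambda>x. u x + v x) - energy Q K p a l u - energy_differential u v
     = 1/2 * R1 + 1/4 * R2 - 1/6 * R3 - l / (p + 1) * R4"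
  proof -
    have pl: "l / (p + 1) * ((p + 1) * y) = l * y" for y using p by simp
    show ?thesis
      unfolding energy_eq energy_differential_def e1 e3 e4 coupling_expand[OF u(1) v(1)] R2_def[symmetric] distrib_left pl
      by (simp add: algebra_simps)
  qed
  moreover have "\<bar>1/2 * R1\<bar> \<le> 1 * t powr (p + 1)"
    using inner_scale[OF v(1,2,3) v(1,2,3)] t2 by (simp add: R1_def power2_eq_square abs_mult)
  moreover have "\<bar>1/4 * R2\<bar> \<le> (11 * U\<^sup>2 * C) * t powr (p + 1)"
  proof -
    have 1: "\<bar>coupling u u v v\<bar> \<le> U * U * t * t * C" and 2: "\<bar>coupling u v u v\<bar> \<le> U * t * U * t * C"
      and 3: "\<bar>coupling u v v v\<bar> \<le> U * t * t * t * C" and 4: "\<bar>coupling v v v v\<bar> \<le> t * t * t * t * C"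
      using u v U by (auto intro!: coupling_scale)
    have c3: "U * t * t * t * C \<le> U\<^sup>2 * C * t\<^sup>2"
    proof -
      have "U * t * (t\<^sup>2 * C) \<le> U * U * (t\<^sup>2 * C)" using u v C by (intro mult_right_mono mult_left_mono) auto
      then show ?thesis by (simp add: power2_eq_square mult_ac)
    qed
    have c4: "t * t * t * t * C \<le> U\<^sup>2 * C * t\<^sup>2"
    proof -
      have "t * t * (t\<^sup>2 * C) \<le> U * U * (t\<^sup>2 * C)" using u v C by (intro mult_right_mono mult_mono) auto
      then show ?thesis by (simp add: power2_eq_square mult_ac)
    qed
    have c12: "U * U * t * t * C = U\<^sup>2 * C * t\<^sup>2" "U * t * U * t * C = U\<^sup>2 * C * t\<^sup>2"
      by (simp_all add: power2_eq_square mult_ac)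
    have "\<bar>R2\<bar> \<le> 11 * (U\<^sup>2 * C * t\<^sup>2)"
      unfolding R2_def using 1 2 3 4 c3 c4 unfolding c12 by linarith
    also have "\<dots> = 11 * U\<^sup>2 * C * t\<^sup>2" by simp
    also have "\<dots> \<le> 11 * U\<^sup>2 * C * t powr (p + 1)" using t2 C by (intro mult_left_mono) auto
    finally show ?thesis by simp
  qed
  moreover have "\<bar>1/6 * R3\<bar> \<le> 57 * (mass 6 u + 4096) * t powr (p + 1)"
  proof -
    have "\<bar>R3\<bar> \<le> t\<^sup>2 * 57 * (mass 6 u + mass 6 w)"
      unfolding R3_def
    proof (rule critical_bound(2)[OF H1_mass(2)[OF u(1)] H1_mass(2)[OF w(1)]])
      show "(\<lambda>x. (u x + v x) ^ 6 - u x ^ 6 - 6 * (u x ^ 5 * v x)) \<in> borel_measurable lebesgue"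
        using um vm by measurable
      show "\<bar>(u x + v x) ^ 6 - u x ^ 6 - 6 * (u x ^ 5 * v x)\<bar> \<le> t\<^sup>2 * 57 * (u x ^ 6 + w x ^ 6)" for x
        using sixth_power_taylor[OF less_imp_le[OF v(3)] v(4), of "u x" "w x"] unfolding vw mult.assoc .
    qed
    also have "\<dots> \<le> t\<^sup>2 * 57 * (mass 6 u + 4096)"
      using H1_mass_le_1(2)[OF w] by (intro mult_left_mono) auto
    also have "\<dots> \<le> t powr (p + 1) * 57 * (mass 6 u + 4096)"
      using t2 mass_nonneg[of 6 u] by (intro mult_right_mono) auto
    finally show ?thesis by (simp add: abs_mult mult_ac)
  qed
  moreover have "\<bar>l / (p + 1) * R4\<bar> \<le> 4 * l * MK * t powr (p + 1)"
  proof -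
    have tp: "t powr p * t = t powr (p + 1)" using v by (simp add: powr_add)
    have "\<bar>R4\<bar> \<le> 4 * t powr (p + 1) * (mass (2 / (1 - p)) K + mass 2 w + mass 2 w)"
      unfolding R4_def
    proof (rule sublinear_bound(2)[OF p K H1_mass(1)[OF w(1)] H1_mass(1)[OF w(1)]])
      show "(\<lambda>x. K x * (\<bar>u x + v x\<bar> powr (p + 1) - \<bar>u x\<bar> powr (p + 1) - (p + 1) * (spow p (u x) * v x))) \<in> borel_measurable lebesgue"
        using um vm in_L_measurable[OF K] spow_measurable[OF um, of p] by measurable
      fix x
      have "\<bar>\<bar>u x + v x\<bar> powr (p + 1) - \<bar>u x\<bar> powr (p + 1) - (p + 1) * (spow p (u x) * v x)\<bar> \<le> 4 * (\<bar>v x\<bar> powr p * \<bar>v x\<bar>)"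
        by (rule abs_powr_taylor[OF p])
      also have "\<bar>v x\<bar> powr p * \<bar>v x\<bar> = t powr (p + 1) * (\<bar>w x\<bar> powr p * \<bar>w x\<bar>)"
        unfolding vw tp[symmetric] using v by (simp add: abs_mult powr_mult mult_ac)
      finally show "\<bar>K x * (\<bar>u x + v x\<bar> powr (p + 1) - \<bar>u x\<bar> powr (p + 1) - (p + 1) * (spow p (u x) * v x))\<bar>
          \<le> 4 * t powr (p + 1) * (\<bar>K x\<bar> * (\<bar>w x\<bar> powr p * \<bar>w x\<bar>))"
        unfolding abs_mult[of "K x"] by (auto dest: mult_left_mono[of _ _ "\<bar>K x\<bar>"] simp: mult_ac)
    qed (use v in auto)
    also have "\<dots> \<le> 4 * t powr (p + 1) * MK"
      using H1_mass_le_1(1)[OF w] by (intro mult_left_mono) (auto simp: MK_def)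
    finally have "l / (p + 1) * \<bar>R4\<bar> \<le> l * (4 * t powr (p + 1) * MK)"
      using l p by (intro mult_mono) (auto simp: field_simps)
    then show ?thesis using l p by (simp add: abs_mult mult_ac)
  qed
  moreover have "\<bar>x\<bar> \<le> (c1 + c2 + c3 + c4) * y"
    if "x = r1 + r2 - r3 - r4" "\<bar>r1\<bar> \<le> c1 * y" "\<bar>r2\<bar> \<le> c2 * y" "\<bar>r3\<bar> \<le> c3 * y" "\<bar>r4\<bar> \<le> c4 * y"
    for x y r1 r2 r3 r4 c1 c2 c3 c4 :: real
    using that unfolding distrib_right by linarith
  ultimately show ?thesis by blast
qed

lemma energy_derivative:
  assumes u: "u \<in> H1" shows "has_H1_derivative (energy Q K p a l) (energy_differential u) u"
  unfolding has_H1_derivative_def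
proof (intro conjI allI impI energy_differential_functional[OF u])
  fix e :: real assume e: "0 < e"
  define U where "U = H1_norm u + 1"
  have U: "H1_norm u \<le> U" "1 \<le> U" using H1_norm_nonneg[of u] by (auto simp: U_def)
  define D where "D = 1 + 11 * U\<^sup>2 * C + 57 * (mass 6 u + 4096) + 4 * l * MK"
  have D: "D > 0" unfolding D_def using C l MK mass_nonneg[of 6 u] by (intro add_pos_nonneg) auto
  define d where "d = min 1 ((e / D) powr (1 / p))"
  have d: "0 < d" "d \<le> 1" using e D by (auto simp: d_def)
  have dp: "D * d powr p \<le> e"
  proof -
    have "d powr p \<le> ((e / D) powr (1 / p)) powr p" using p d by (intro powr_mono2) (auto simp: d_def)
    also have "\<dots> = e / D" using p e D by (simp add: powr_powr)
    finally show ?thesis using D by (simp add: field_simps)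
  qed
  show "\<exists>d>0. \<forall>v\<in>H1. H1_norm v < d \<longrightarrow>
     \<bar>energy Q K p a l (\<lambda>x. u x + v x) - energy Q K p a l u - energy_differential u v\<bar> \<le> e * H1_norm v"
  proof (intro exI[of _ d] conjI d(1) ballI impI)
    fix v assume v: "v \<in> H1" "H1_norm v < d"
    let ?r = "\<bar>energy Q K p a l (\<lambda>x. u x + v x) - energy Q K p a l u - energy_differential u v\<bar>"
    have "?r \<le> e * t" if t: "H1_norm v \<le> t" "0 < t" "t \<le> d" for t
    proof -
      have "?r \<le> D * t powr (p + 1)"
        unfolding D_def using remainder_bound[OF u U v(1) t(1,2)] t d by simp
      also have "\<dots> = D * t powr p * t" using t by (simp add: powr_add)
      also have "\<dots> \<le> D * d powr p * t" using t D p by (intro mult_right_mono mult_left_mono powr_mono2) auto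
      also have "\<dots> \<le> e * t" using dp t by (intro mult_right_mono) auto
      finally show ?thesis .
    qed
    note b = this
    \<comment> \<open>\<open>H1_norm\<close> is only a seminorm on functions; if it vanishes, let \<open>t\<close> tend to zero.\<close>
    show "?r \<le> e * H1_norm v"
    proof (cases "H1_norm v = 0")
      case False
      then show ?thesis using b[of "H1_norm v"] v H1_norm_nonneg[of v] by (simp add: less_le)
    next
      case True
      have "?r \<le> 0"
      proof (rule field_le_epsilon)
        fix x :: real assume x: "0 < x"
        have "?r \<le> e * min d (x / e)" using True d e x by (intro b) auto
        also have "\<dots> \<le> e * (x / e)" using e by (intro mult_left_mono) auto
        finally show "?r \<le> 0 + x" using e by simp
      qed
      then show ?thesis using True by simp
    qed
  qed
qed

end

lemma H1_derivative_unique: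
  assumes L: "has_H1_derivative F L u" and L': "has_H1_derivative F L' u" and v: "v \<in> H1"
  shows "L v = L' v"
proof -
  have "\<bar>L v - L' v\<bar> \<le> 0"
  proof (rule field_le_epsilon)
    fix x :: real assume x: "0 < x"
    define P where "P = H1_norm v + 1"
    define e where "e = x / (2 * P)"
    have P: "0 < P" using H1_norm_nonneg[of v] by (simp add: P_def add_nonneg_pos)
    have e: "0 < e" using x P by (simp add: e_def)
    obtain d where d: "0 < d" "\<And>w. w \<in> H1 \<Longrightarrow> H1_norm w < d \<Longrightarrow> \<bar>F (\<lambda>x. u x + w x) - F u - L w\<bar> \<le> e * H1_norm w"
      using L e unfolding has_H1_derivative_def by blast
    obtain d' where d': "0 < d'" "\<And>w. w \<in> H1 \<Longrightarrow> H1_norm w < d' \<Longrightarrow> \<bar>F (\<lambda>x. u x + w x) - F u - L' w\<bar> \<le> e * H1_norm w"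
      using L' e unfolding has_H1_derivative_def by blast
    define t where "t = min d d' / (2 * P)"
    have t: "0 < t" using d d' P by (simp add: t_def)
    have "t * H1_norm v < t * P" using t by (simp add: P_def)
    also have "\<dots> = min d d' / 2" using P by (simp add: t_def)
    also have "\<dots> < min d d'"
    proof -
      have "0 < min d d'" using d(1) d'(1) by simp
      then show ?thesis by linarith
    qed
    finally have tv: "t * H1_norm v < min d d'" .
    let ?w = "\<lambda>x. t * v x"
    have w: "?w \<in> H1" "H1_norm ?w = t * H1_norm v" using H1_scale[OF v] H1_norm_scale[OF v, of t] t by auto
    have lin: "L ?w = t * L v" "L' ?w = t * L' v"
      using L L' v by (auto simp: has_H1_derivative_def H1_functional_def)
    have "\<bar>L ?w - L' ?w\<bar> \<le> 2 * (e * H1_norm ?w)"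
      using d(2)[OF w(1)] d'(2)[OF w(1)] tv w(2) by fastforce
    then have "t * \<bar>L v - L' v\<bar> \<le> t * (2 * e * H1_norm v)"
      using t by (simp add: lin w(2) abs_mult mult_ac flip: right_diff_distrib)
    then have "\<bar>L v - L' v\<bar> \<le> 2 * e * H1_norm v" using t by simp
    also have "\<dots> \<le> 2 * e * P" using e by (intro mult_left_mono) (auto simp: P_def)
    also have "\<dots> = x" using P by (simp add: e_def)
    finally show "\<bar>L v - L' v\<bar> \<le> 0 + x" by simp
  qed
  then show ?thesis by simp
qed

lemma (in coupled_energy) dual_norm_bound:
  assumes u: "u \<in> H1" "H1_norm u \<le> s" "0 < s"
  shows "H1_dual_norm (H1_derivative (energy Q K p a l) u) \<le> ennreal (derivative_rate s)"
  unfolding H1_dual_norm_def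
proof (rule SUP_least)
  fix v assume v: "v \<in> {v \<in> H1. H1_norm v \<le> 1}"
  have "has_H1_derivative (energy Q K p a l) (H1_derivative (energy Q K p a l) u) u"
    unfolding H1_derivative_def
    by (rule someI[where P = "\<lambda>L. has_H1_derivative (energy Q K p a l) L u", OF energy_derivative[OF u(1)]])
  then have "H1_derivative (energy Q K p a l) u v = energy_differential u v"
    using energy_derivative[OF u(1)] v by (intro H1_derivative_unique) auto
  then show "ennreal \<bar>H1_derivative (energy Q K p a l) u v\<bar> \<le> ennreal (derivative_rate s)"
    using energy_differential_bound[OF u] v by (auto intro: ennreal_leI)
qed

section \<open>Squeezing\<close>

text \<open>Subtracting a quarter of the equation tested with \<open>u\<close> from the energy eliminates the nonlocal
  term and leaves \<open>\<parallel>u\<parallel>\<^sup>2/4 + \<bar>u\<bar>\<^sub>6\<^sup>6/12 \<le> c + C \<lambda> \<parallel>u\<parallel>\<^sup>p\<^sup>+\<^sup>1\<close>.\<close>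

lemma solution_norm_bound:
  assumes p: "0 < p" "p < 1" and K: "in_L (2 / (1 - p)) K" and l: "0 < l" and c: "c \<le> 0"
    and u: "u \<in> sublevel_solutions Q K p c a l"
  shows "H1_norm u \<le> (4 * l * (mass (2 / (1 - p)) K + 2)) powr (1 / (1 - p))"
proof -
  have uH: "u \<in> H1" and E: "energy Q K p a l u \<le> c" and
    eq: "(LINT x|lebesgue. weak_gradient u x \<bullet> weak_gradient u x) + (LINT x|lebesgue. u x * u x)
     + (LINT x|lebesgue. Q x * potential Q a u x * u x * u x)
     = (LINT x|lebesgue. \<bar>u x\<bar> ^ 4 * u x * u x) + l * (LINT x|lebesgue. K x * \<bar>u x\<bar> powr (p - 1) * u x * u x)"
    using u by (auto simp: sublevel_solutions_def solutions_def)
  define N where "N = H1_norm u"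
  define P where "P = (LINT x|lebesgue. Q x * potential Q a u x * (u x)\<^sup>2)"
  define S where "S = (LINT x|lebesgue. \<bar>u x\<bar> ^ 6)"
  define k where "k = (LINT x|lebesgue. K x * \<bar>u x\<bar> powr (p + 1))"
  define M where "M = mass (2 / (1 - p)) K + 2"
  have M: "0 < M" using mass_nonneg[of "2 / (1 - p)" K] by (simp add: M_def)
  have N0: "0 \<le> N" by (simp add: N_def H1_norm_nonneg)
  have S0: "0 \<le> S" unfolding S_def by (intro integral_nonneg_AE AE_I2) simp
  have S': "(LINT x|lebesgue. \<bar>u x\<bar> ^ 4 * u x * u x) = S"
    unfolding S_def by (intro Bochner_Integration.integral_cong) (auto simp: eval_nat_numeral mult_ac)
  have k': "(LINT x|lebesgue. K x * \<bar>u x\<bar> powr (p - 1) * u x * u x) = k"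
    unfolding k_def spow_self[OF p(1), symmetric] by (simp add: spow_def mult.assoc)
  have P': "(LINT x|lebesgue. Q x * potential Q a u x * u x * u x) = P"
    unfolding P_def by (simp add: power2_eq_square mult.assoc)
  have n: "N\<^sup>2 = (LINT x|lebesgue. weak_gradient u x \<bullet> weak_gradient u x) + (LINT x|lebesgue. u x * u x)"
    by (simp add: N_def H1_norm_square H1_inner_def dirichlet_def)
  have e1: "N\<^sup>2 + P = S + l * k"
    unfolding n P'[symmetric] S'[symmetric] k'[symmetric] by (rule eq)
  have e2: "1/2 * N\<^sup>2 + 1/4 * P - 1/6 * S - l / (p + 1) * k \<le> 0"
    using E c by (simp add: energy_def N_def P_def S_def k_def)
  have "1/4 * N\<^sup>2 + 1/12 * S \<le> (l / (p + 1) - l / 4) * k" using e1 e2 by (simp add: algebra_simps)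
  also have "\<dots> \<le> l * \<bar>k\<bar>"
  proof -
    have "(l / (p + 1) - l / 4) * k \<le> \<bar>l / (p + 1) - l / 4\<bar> * \<bar>k\<bar>" by (metis abs_ge_self abs_mult)
    also have "\<dots> \<le> l * \<bar>k\<bar>"
    proof (rule mult_right_mono)
      have "l / (p + 1) \<le> l" "l / 4 \<le> l / (p + 1)" using l p by (auto simp: field_simps)
      then show "\<bar>l / (p + 1) - l / 4\<bar> \<le> l" using l by simp
    qed simp
    finally show ?thesis .
  qed
  finally have N2: "N\<^sup>2 \<le> 4 * (l * \<bar>k\<bar>)" using S0 by simp
  show ?thesis
  proof (cases "N = 0")
    case True
    then show ?thesis by (simp add: N_def)
  next
    case False
    then have Np: "0 < N" using N0 by simp
    note nu = H1_normalise[OF uH, of N] 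
    define w where "w = (\<lambda>x. (1 / N) * u x)"
    have w: "w \<in> H1" "H1_norm w \<le> 1" using nu Np by (auto simp: w_def N_def)
    have wm: "w \<in> borel_measurable lebesgue" using H1_mass(1)[OF w(1)] by (rule in_L_measurable)
    have kw: "K x * \<bar>u x\<bar> powr (p + 1) = N powr (p + 1) * (K x * \<bar>w x\<bar> powr (p + 1))" for x
      using Np by (simp add: w_def abs_mult powr_divide)
    have "\<bar>k\<bar> = N powr (p + 1) * \<bar>LINT x|lebesgue. K x * \<bar>w x\<bar> powr (p + 1)\<bar>"
      unfolding k_def kw integral_mult_right_zero abs_mult by simp
    also have "\<dots> \<le> N powr (p + 1) * (1 * (mass (2 / (1 - p)) K + mass 2 w + mass 2 w))"
    proof (intro mult_left_mono sublinear_bound(2)[OF p K H1_mass(1)[OF w(1)] H1_mass(1)[OF w(1)]])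
      show "(\<lambda>x. K x * \<bar>w x\<bar> powr (p + 1)) \<in> borel_measurable lebesgue"
        using wm in_L_measurable[OF K] by measurable
      show "\<bar>K x * \<bar>w x\<bar> powr (p + 1)\<bar> \<le> 1 * (\<bar>K x\<bar> * (\<bar>w x\<bar> powr p * \<bar>w x\<bar>))" for x
        by (simp add: abs_mult powr_add)
    qed auto
    also have "\<dots> \<le> N powr (p + 1) * M"
      using H1_mass_le_1(1)[OF w] by (intro mult_left_mono) (auto simp: M_def)
    finally have "4 * (l * \<bar>k\<bar>) \<le> 4 * (l * (N powr (p + 1) * M))" using l by simp
    with N2 have "N\<^sup>2 \<le> 4 * l * M * N powr (p + 1)" by (simp add: mult_ac)
    moreover have "N\<^sup>2 = N powr (1 - p) * N powr (p + 1)"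
      using Np by (simp add: powr_add[symmetric])
    ultimately have "N powr (1 - p) \<le> 4 * l * M" using Np by simp
    then have "(N powr (1 - p)) powr (1 / (1 - p)) \<le> (4 * l * M) powr (1 / (1 - p))"
      using p by (intro powr_mono2) auto
    moreover have "(N powr (1 - p)) powr (1 / (1 - p)) = N" using Np p by (simp add: powr_powr)
    ultimately show ?thesis by (simp add: N_def M_def)
  qed
qed

lemma tendsto_0_within:
  fixes f b :: "real \<Rightarrow> real"
  assumes "S \<subseteq> {0<..}" "\<And>l. l \<in> S \<Longrightarrow> \<bar>f l\<bar> \<le> b l" "(b \<longlongrightarrow> 0) (at_right 0)"
  shows "(f \<longlongrightarrow> 0) (at 0 within S)"
proof (rule Lim_null_comparison)
  show "\<forall>\<^sub>F l in at 0 within S. norm (f l) \<le> b l"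
    using assms(2) by (auto simp: eventually_at_filter)
  show "(b \<longlongrightarrow> 0) (at 0 within S)"
    by (rule tendsto_mono[OF at_le[OF assms(1)] assms(3)])
qed

lemma tendsto_0_within_ennreal:
  fixes f :: "real \<Rightarrow> ennreal" and b :: "real \<Rightarrow> real"
  assumes "S \<subseteq> {0<..}" "\<And>l. l \<in> S \<Longrightarrow> f l \<le> ennreal (b l)" "(b \<longlongrightarrow> 0) (at_right 0)"
  shows "(f \<longlongrightarrow> 0) (at 0 within S)"
proof (rule tendsto_sandwich[OF _ _ tendsto_const])
  show "\<forall>\<^sub>F l in at 0 within S. f l \<le> ennreal (b l)"
    using assms(2) by (auto simp: eventually_at_filter)
  have "(b \<longlongrightarrow> 0) (at 0 within S)"
    by (rule tendsto_mono[OF at_le[OF assms(1)] assms(3)])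
  from tendsto_ennrealI[OF this] show "((\<lambda>l. ennreal (b l)) \<longlongrightarrow> 0) (at 0 within S)" by simp
qed simp

theorem theorem2p5:
  fixes p c :: real
    and Q K :: "real ^ 3 \<Rightarrow> real"
    and u :: "real \<Rightarrow> real \<Rightarrow> real ^ 3 \<Rightarrow> real"
  assumes p: "0 < p" "p < 1"
    and Q_nontrivial: "\<not> (AE x in lebesgue. Q x = 0)"
    and K_nontrivial: "\<not> (AE x in lebesgue. K x = 0)"
    and Q: "(\<exists>s\<ge>2. in_L s Q) \<or>
            (in_L_infty Q \<and> (\<forall>t>0. emeasure lebesgue {x. \<bar>Q x\<bar> \<ge> t} < \<infinity>))"
    and K: "in_L (2 / (1 - p)) K" "emeasure lebesgue {x. K x > 0} > 0"
    and c: "c \<le> 0"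
    and u: "\<And>a l. 0 \<le> a \<Longrightarrow> 0 < l \<Longrightarrow> sublevel_solutions Q K p c a l \<noteq> {} \<Longrightarrow>
              u a l \<in> sublevel_solutions Q K p c a l"
  shows
    "((\<lambda>l. SUP a\<in>{a. 0 < a \<and> sublevel_solutions Q K p c a l \<noteq> {}}. ennreal (H1_norm (u a l)))
        \<longlongrightarrow> 0) (at 0 within {l. 0 < l \<and> (\<exists>a>0. sublevel_solutions Q K p c a l \<noteq> {})})
     \<and> ((\<lambda>l. H1_norm (u 0 l)) \<longlongrightarrow> 0) (lambda_to_zero Q K p c 0)
     \<and> (\<forall>a>0.
          ((\<lambda>l. energy Q K p a l (u a l)) \<longlongrightarrow> 0) (lambda_to_zero Q K p c a)
        \<and> ((\<lambda>l. energy Q K p 0 l (u 0 l)) \<longlongrightarrow> 0) (lambda_to_zero Q K p c 0)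
        \<and> ((\<lambda>l. energy Q K p a l (u 0 l)) \<longlongrightarrow> 0) (lambda_to_zero Q K p c 0)
        \<and> ((\<lambda>l. energy Q K p 0 l (u a l)) \<longlongrightarrow> 0) (lambda_to_zero Q K p c a)
        \<and> ((\<lambda>l. H1_dual_norm (H1_derivative (energy Q K p a l) (u 0 l))) \<longlongrightarrow> 0)
             (lambda_to_zero Q K p c 0)
        \<and> ((\<lambda>l. H1_dual_norm (H1_derivative (energy Q K p 0 l) (u a l))) \<longlongrightarrow> 0)
             (lambda_to_zero Q K p c a))"
proof -
  have Q': "(\<exists>s\<ge>2. in_L s Q) \<or> in_L_infty Q" using Q by blast
  define M where "M = mass (2 / (1 - p)) K + 2"
  have M: "0 < M" using mass_nonneg[of "2 / (1 - p)" K] by (simp add: M_def)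
  define \<rho> where "\<rho> l = (4 * l * M) powr (1 / (1 - p))" for l
  have \<rho>_pos: "0 < \<rho> l" if "0 < l" for l using that M by (simp add: \<rho>_def)
  have \<rho>: "(\<rho> \<longlongrightarrow> 0) (at_right 0)"
  proof -
    have "((\<lambda>l. (4 * l * M) powr (1 / (1 - p))) \<longlongrightarrow> (4 * 0 * M) powr (1 / (1 - p))) (at_right 0)"
      using p M by (intro tendsto_powr' tendsto_intros) (auto simp: eventually_at_filter)
    then show ?thesis by (simp add: \<rho>_def[abs_def])
  qed
  have small: "u a l \<in> H1 \<and> H1_norm (u a l) \<le> \<rho> l"
    if "0 \<le> a" "0 < l" "sublevel_solutions Q K p c a l \<noteq> {}" for a l
  proof -
    note ul = u[OF that]
    have "u a l \<in> H1" using ul by (simp add: sublevel_solutions_def solutions_def)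
    then show ?thesis using solution_norm_bound[OF p K(1) that(2) c ul] by (simp add: \<rho>_def M_def)
  qed
  define S where "S a = {l. 0 < l \<and> sublevel_solutions Q K p c a l \<noteq> {}}" for a
  have S: "S a \<subseteq> {0<..}" for a by (auto simp: S_def)
  have 1: "((\<lambda>l. SUP a\<in>{a. 0 < a \<and> sublevel_solutions Q K p c a l \<noteq> {}}. ennreal (H1_norm (u a l)))
        \<longlongrightarrow> 0) (at 0 within {l. 0 < l \<and> (\<exists>a>0. sublevel_solutions Q K p c a l \<noteq> {})})"
  proof (rule tendsto_0_within_ennreal[OF _ _ \<rho>])
    fix l assume l: "l \<in> {l. 0 < l \<and> (\<exists>a>0. sublevel_solutions Q K p c a l \<noteq> {})}"
    show "(SUP a\<in>{a. 0 < a \<and> sublevel_solutions Q K p c a l \<noteq> {}}. ennreal (H1_norm (u a l))) \<le> ennreal (\<rho> l)"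
    proof (rule SUP_least, rule ennreal_leI)
      fix a assume "a \<in> {a. 0 < a \<and> sublevel_solutions Q K p c a l \<noteq> {}}"
      then show "H1_norm (u a l) \<le> \<rho> l" using small[of a l] l by simp
    qed
  qed auto
  have 2: "((\<lambda>l. H1_norm (u 0 l)) \<longlongrightarrow> 0) (lambda_to_zero Q K p c 0)"
    unfolding lambda_to_zero_def S_def[symmetric]
    by (rule tendsto_0_within[OF S _ \<rho>]) (auto simp: S_def small H1_norm_nonneg)
  \<comment> \<open>The functional may belong to another parameter than the solution.\<close>
  have 3: "((\<lambda>l. energy Q K p b l (u a l)) \<longlongrightarrow> 0) (lambda_to_zero Q K p c a) \<and>
    ((\<lambda>l. H1_dual_norm (H1_derivative (energy Q K p b l) (u a l))) \<longlongrightarrow> 0) (lambda_to_zero Q K p c a)"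
    if a: "0 \<le> a" for a b
  proof -
    obtain C where C: "0 \<le> C" and bound: "\<And>u v w z. u \<in> H1 \<Longrightarrow> v \<in> H1 \<Longrightarrow> w \<in> H1 \<Longrightarrow> z \<in> H1 \<Longrightarrow>
        H1_norm u \<le> 1 \<Longrightarrow> H1_norm v \<le> 1 \<Longrightarrow> H1_norm w \<le> 1 \<Longrightarrow> H1_norm z \<le> 1 \<Longrightarrow>
        \<bar>interaction b (\<lambda>x. Q x * (u x * v x)) (\<lambda>x. Q x * (w x * z x))\<bar> \<le> C"
      using interaction_source_bound[OF Q', of b] by blast
    have ce: "coupled_energy Q K p b l C" if "0 < l" for l
    proof
      show "in_L (6/5) (\<lambda>x. Q x * (u x * v x))" if "u \<in> H1" "v \<in> H1" for u v
        using source_in_L65[OF Q'] that by blast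
    qed (use p K(1) that C bound in auto)
    define f where "f l = (\<rho> l)\<^sup>2 + (\<rho> l) ^ 4 * C + 8192 * (\<rho> l) ^ 6 + l * ((\<rho> l) powr p * \<rho> l * M)" for l
    define g where "g l = \<rho> l + (\<rho> l) ^ 3 * C + 8192 * (\<rho> l) ^ 5 + l * ((\<rho> l) powr p * M)" for l
    have \<rho>p: "((\<lambda>l. \<rho> l powr p) \<longlongrightarrow> 0 powr p) (at_right 0)"
      using p by (intro tendsto_powr' \<rho> tendsto_const) (auto simp: \<rho>_def)
    have "(f \<longlongrightarrow> 0\<^sup>2 + 0 ^ 4 * C + 8192 * 0 ^ 6 + 0 * (0 powr p * 0 * M)) (at_right 0)"
      unfolding f_def by (intro tendsto_intros \<rho> \<rho>p)
    then have f: "(f \<longlongrightarrow> 0) (at_right 0)" by simp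
    have "(g \<longlongrightarrow> 0 + 0 ^ 3 * C + 8192 * 0 ^ 5 + 0 * (0 powr p * M)) (at_right 0)"
      unfolding g_def by (intro tendsto_intros \<rho> \<rho>p)
    then have g: "(g \<longlongrightarrow> 0) (at_right 0)" by simp
    have fl: "\<bar>energy Q K p b l (u a l)\<bar> \<le> f l" and gl: "H1_dual_norm (H1_derivative (energy Q K p b l) (u a l)) \<le> ennreal (g l)"
      if "l \<in> S a" for l
    proof -
      have ul: "0 < l" "u a l \<in> H1" "H1_norm (u a l) \<le> \<rho> l" using that small[OF a] by (auto simp: S_def)
      interpret coupled_energy Q K p b l C by (rule ce[OF ul(1)])
      show "\<bar>energy Q K p b l (u a l)\<bar> \<le> f l"
        using energy_bound[OF ul(2,3) \<rho>_pos[OF ul(1)]] by (simp add: energy_rate_def MK_def f_def M_def)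
      show "H1_dual_norm (H1_derivative (energy Q K p b l) (u a l)) \<le> ennreal (g l)"
        using dual_norm_bound[OF ul(2,3) \<rho>_pos[OF ul(1)]] by (simp add: derivative_rate_def MK_def g_def M_def)
    qed
    show ?thesis
      unfolding lambda_to_zero_def S_def[symmetric]
      using tendsto_0_within[OF S fl f] tendsto_0_within_ennreal[OF S gl g] by auto
  qed
  show ?thesis using 1 2 3 by auto
qed

end
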